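(* Let $\bar A=(A_0,A_1)$ be a compatible couple of (quasi-)Banach spaces with $A_0\cap A_1\neq\{0\}$. Let $0<q_1,r_1\le\infty$ and $a_1,b_1\in SV$ be such that $\left\|s^{-1/r_1}b_1(s)\|u^{-1/q_1}a_1(u)\|_{q_1,(s,1)}\right\|_{r_1,(0,1)}<\infty$, and put $$\chi_1(t)=\left\|s^{-1/r_1}b_1(s)\|u^{-1/q_1}a_1(u)\|_{q_1,(s,t)}\right\|_{r_1,(0,t)}.$$ Let $0<r,r_0\le\infty$, $a,b_0\in SV$, and $\|s^{-1/r_0}b_0(s)\|_{r_0,(1,\infty)}<\infty$. Put $\chi_0(t)=\|s^{-1/r_0}b_0(s)\|_{r_0,(t,\infty)}$ and $\rho(t)=t\frac{\chi_0(t)}{\chi_1(t)}$. For given $0\le\theta\le1$ denote $a^{\#}=\chi_0^{1-\theta}\chi_1^{\theta}\,(a\circ\rho)$. (i) If $0<\theta<1$, then $\left(\bar A_{0,r_0,b_0},\bar A^{\mathcal R}_{1,r_1,b_1,q_1,a_1}\right)_{\theta,r,a}=\bar A_{\theta,r,a^{\#}}$. (ii) If $\|s^{-1/r}a(s)\|_{r,(1,\infty)}<\infty$, then, with $\theta=0$ (i.e. $a^{\#}=\chi_0\,(a\circ\rho)$), $\left(\bar A_{0,r_0,b_0},\bar A^{\mathcal R}_{1,r_1,b_1,q_1,a_1}\right)_{0,r,a}=\bar A_{0,r,a^{\#}}\cap\bar A^{\mathcal L}_{0,r,a\circ\rho,r_0,b_0}$. (iii) If $\|s^{-1/r}a(s)\|_{r,(0,1)}<\infty$,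 then, with $\theta=1$ (i.e. $a^{\#}=\chi_1\,(a\circ\rho)$), $$\left(\bar A_{0,r_0,b_0},\bar A^{\mathcal R}_{1,r_1,b_1,q_1,a_1}\right)_{1,r,a}=\bar A_{1,r,a^{\#}}\cap\bar A^{\mathcal R}_{1,r,B_1,q_1,a_1}\cap\bar A^{\mathcal R,\mathcal R}_{1,r,a\circ\rho,r_1,b_1,q_1,a_1},$$ where $B_1(t)=\|s^{-1/r_1}b_1(s)\|_{r_1,(0,t)}\,a(\rho(t))$.
   Context: Conventions: $1/\infty=0$; $\|\cdot\|_{q,(a,b)}$ is the usual (quasi-)norm of $L_q$ on the interval $(a,b)$, $0<q\le\infty$. Two positive functions satisfy $f\approx g$ (are equivalent) if $C^{-1}g\le f\le Cg$ for some constant $C>0$ independent of all significant quantities. $b\in SV$ (slowly varying) means that $b$ is a positive Lebesgue measurable function on $(0,\infty)$ such that for each $\varepsilon>0$ the function $t^{\varepsilon}b(t)$ is equivalent to an increasing function and $t^{-\varepsilon}b(t)$ is equivalent to a decreasing function. For a compatible couple $(X_0,X_1)$ of (quasi-)normed spaces, $K(t,f;X_0,X_1)=\inf\{\|f_0\|_{X_0}+t\|f_1\|_{X_1}: f=f_0+f_1,\ f_i\in X_i\}$ for $f\in X_0+X_1$, $t>0$; $K(t,f):=K(t,f;A_0,A_1)$. For $0\le\theta\le1$, $0<q\le\infty$, $b\in SV$, $(X_0,X_1)_{\theta,q,b}$ is the space of all $f\in X_0+X_1$ with finite (quasi-)norm $\|u^{-\theta-1/q}b(u)K(u,f;X_0,X_1)\|_{q,(0,\infty)}$,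 and $\bar A_{\theta,q,b}:=(A_0,A_1)_{\theta,q,b}$. For $0<p,r,q\le\infty$ and $a,b,c\in SV$, the following are the spaces of all $f\in A_0+A_1$ with finite (quasi-)norm: - $\bar A^{\mathcal L}_{\theta,r,b,q,a}$: $\left\|t^{-1/r}b(t)\|u^{-\theta-1/q}a(u)K(u,f)\|_{q,(0,t)}\right\|_{r,(0,\infty)}$; - $\bar A^{\mathcal R}_{\theta,r,b,q,a}$: $\left\|t^{-1/r}b(t)\|u^{-\theta-1/q}a(u)K(u,f)\|_{q,(t,\infty)}\right\|_{r,(0,\infty)}$; - $\bar A^{\mathcal R,\mathcal R}_{\theta,p,c,r,b,q,a}$: $\left\|t^{-1/p}c(t)\left\|u^{-1/r}b(u)\|v^{-\theta-1/q}a(v)K(v,f)\|_{q,(u,\infty)}\right\|_{r,(t,\infty)}\right\|_{p,(0,\infty)}$. Equality of (quasi-)normed spaces means that each is continuously embedded in the other; intersections carry the maximum (equivalently, the sum) of the (quasi-)norms. Standing assumption: none of the spaces under consideration is $\{0\}$. *)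

theory Defs
  imports "HOL-Analysis.Analysis"
begin

section \<open>Lebesgue quasi-norms on subsets of the real line\<close>

text \<open>Intended for exponents \<open>p > 0\<close>.\<close>

definition enn_powr :: "ennreal \<Rightarrow> real \<Rightarrow> ennreal" where
  "enn_powr x p = (if x = \<infinity> then \<infinity> else ennreal (enn2real x powr p))"

text \<open>
  The \<open>L\<^sub>q\<close> quasi-norm, \<open>0 < q \<le> \<infinity>\<close>. The essential supremum of the library is set to \<open>\<infinity>\<close> on
  non-measurable functions; the two agree on measurable ones. The version below is monotone in
  \<open>f\<close> without any measurability, just as \<open>nn_integral\<close> is. This matters because a composition
  \<open>a \<circ> \<rho>\<close> of a Lebesgue measurable \<open>a\<close> with a continuous \<open>\<rho>\<close> need not be measurable, although it is
  pointwise equivalent to a measurable function if \<open>a\<close> is slowly varying.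
\<close>

definition Lnorm :: "ennreal \<Rightarrow> real set \<Rightarrow> (real \<Rightarrow> ennreal) \<Rightarrow> ennreal" where
  "Lnorm q S f =
     (if q = \<infinity> then Inf {z. AE u in lebesgue_on S. f u \<le> z}
      else enn_powr (\<integral>\<^sup>+u. enn_powr (f u) (enn2real q) \<partial>lebesgue_on S) (1 / enn2real q))"

text \<open>
  \<open>wnorm \<theta> q b S F\<close> is \<open>\<parallel>u\<^bsup>-\<theta>-1/q\<^esup> b(u) F(u)\<parallel>\<close> in \<open>L\<^sub>q(S)\<close>. For \<open>q = \<infinity>\<close> we have \<open>1 / q = 0\<close> in \<open>ennreal\<close>.
\<close>

definition wnorm ::
  "real \<Rightarrow> ennreal \<Rightarrow> (real \<Rightarrow> real) \<Rightarrow> real set \<Rightarrow> (real \<Rightarrow> ennreal) \<Rightarrow> ennreal" where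
  "wnorm \<theta> q b S F = Lnorm q S (\<lambda>u. ennreal (u powr (- \<theta> - enn2real (1 / q)) * b u) * F u)"

section \<open>Slowly varying functions\<close>

definition equiv_fun :: "(real \<Rightarrow> real) \<Rightarrow> (real \<Rightarrow> real) \<Rightarrow> bool" where
  "equiv_fun f g \<longleftrightarrow> (\<forall>t>0. 0 < f t \<and> 0 < g t) \<and>
     (\<exists>C>0. \<forall>t>0. inverse C * g t \<le> f t \<and> f t \<le> C * g t)"

definition SV :: "(real \<Rightarrow> real) set" where
  "SV = {b. b \<in> borel_measurable (lebesgue_on {0<..}) \<and> (\<forall>t>0. 0 < b t) \<and>
     (\<forall>\<epsilon>>0.
        (\<exists>g. mono_on {0<..} g \<and> equiv_fun (\<lambda>t. t powr \<epsilon> * b t) g) \<and>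
        (\<exists>g. antimono_on {0<..} g \<and> equiv_fun (\<lambda>t. t powr (-\<epsilon>) * b t) g))}"

section \<open>Quasi-normed spaces inside an ambient vector space\<close>

text \<open>
  A quasi-normed space whose elements lie in the ambient vector space \<open>'v\<close> is represented by its
  quasi-norm, extended by \<open>\<infinity>\<close> outside the space.
\<close>

type_synonym 'v qnorm = "'v \<Rightarrow> ennreal"

definition carrier_sp :: "'v qnorm \<Rightarrow> 'v set" where
  "carrier_sp N = {x. N x < \<infinity>}"

definition quasi_normed :: "'v::real_vector qnorm \<Rightarrow> bool" where
  "quasi_normed N \<longleftrightarrow>
     (\<forall>x. N x = 0 \<longleftrightarrow> x = 0) \<and>
     (\<forall>c x. N (c *\<^sub>R x) = ennreal \<bar>c\<bar> * N x) \<and>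
     (\<exists>C::real. \<forall>x y. N (x + y) \<le> ennreal C * (N x + N y))"

definition quasi_banach :: "'v::real_vector qnorm \<Rightarrow> bool" where
  "quasi_banach N \<longleftrightarrow> quasi_normed N \<and>
     (\<forall>X :: nat \<Rightarrow> 'v. range X \<subseteq> carrier_sp N \<longrightarrow>
        (\<forall>e>0. \<exists>M. \<forall>m\<ge>M. \<forall>n\<ge>M. N (X m - X n) < e) \<longrightarrow>
        (\<exists>x\<in>carrier_sp N. (\<lambda>n. N (X n - x)) \<longlonglongrightarrow> 0))"

definition hausdorff_tvs :: "'v::real_vector topology \<Rightarrow> bool" where
  "hausdorff_tvs T \<longleftrightarrow> topspace T = UNIV \<and> Hausdorff_space T \<and>
     continuous_map (prod_topology T T) T (\<lambda>(x, y). x + y) \<and>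
     continuous_map (prod_topology euclideanreal T) T (\<lambda>(c, x). c *\<^sub>R x)"

text \<open>Continuity of the inclusion of a quasi-normed space into a topological vector space.\<close>

definition embedded_in_tvs :: "'v::real_vector qnorm \<Rightarrow> 'v topology \<Rightarrow> bool" where
  "embedded_in_tvs N T \<longleftrightarrow>
     (\<forall>x\<in>carrier_sp N. \<forall>U. openin T U \<and> x \<in> U \<longrightarrow>
        (\<exists>e>0. \<forall>y\<in>carrier_sp N. N (y - x) < e \<longrightarrow> y \<in> U))"

definition compatible_couple :: "'v::real_vector qnorm \<Rightarrow> 'v qnorm \<Rightarrow> bool" where
  "compatible_couple A0 A1 \<longleftrightarrow>
     (\<exists>T. hausdorff_tvs T \<and> embedded_in_tvs A0 T \<and> embedded_in_tvs A1 T)"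

definition sum_sp :: "'v::real_vector qnorm \<Rightarrow> 'v qnorm \<Rightarrow> 'v set" where
  "sum_sp X0 X1 = {f0 + f1 | f0 f1. f0 \<in> carrier_sp X0 \<and> f1 \<in> carrier_sp X1}"

definition inter_sp :: "'v qnorm \<Rightarrow> 'v qnorm \<Rightarrow> 'v qnorm" (infixl "\<sqinter>\<^sub>q" 70) where
  "(N \<sqinter>\<^sub>q M) = (\<lambda>f. max (N f) (M f))"

definition embedded_sp :: "'v qnorm \<Rightarrow> 'v qnorm \<Rightarrow> bool" (infix "\<hookrightarrow>\<^sub>q" 50) where
  "N \<hookrightarrow>\<^sub>q M \<longleftrightarrow> carrier_sp N \<subseteq> carrier_sp M \<and>
     (\<exists>C::real. \<forall>f\<in>carrier_sp N. M f \<le> ennreal C * N f)"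

definition equal_sp :: "'v qnorm \<Rightarrow> 'v qnorm \<Rightarrow> bool" (infix "\<cong>\<^sub>q" 50) where
  "N \<cong>\<^sub>q M \<longleftrightarrow> N \<hookrightarrow>\<^sub>q M \<and> M \<hookrightarrow>\<^sub>q N"

section \<open>The K-functional and the interpolation spaces\<close>

definition Kfun :: "'v::real_vector qnorm \<Rightarrow> 'v qnorm \<Rightarrow> real \<Rightarrow> 'v \<Rightarrow> ennreal" where
  "Kfun X0 X1 t f = Inf {X0 f0 + ennreal t * X1 f1 | f0 f1.
     f = f0 + f1 \<and> f0 \<in> carrier_sp X0 \<and> f1 \<in> carrier_sp X1}"

definition interp_sp ::
  "'v::real_vector qnorm \<Rightarrow> 'v qnorm \<Rightarrow> real \<Rightarrow> ennreal \<Rightarrow> (real \<Rightarrow> real) \<Rightarrow> 'v qnorm" where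
  "interp_sp X0 X1 \<theta> q b f =
     (if f \<in> sum_sp X0 X1 then wnorm \<theta> q b {0<..} (\<lambda>u. Kfun X0 X1 u f) else \<infinity>)"

definition L_sp ::
  "'v::real_vector qnorm \<Rightarrow> 'v qnorm \<Rightarrow> real \<Rightarrow> ennreal \<Rightarrow> (real \<Rightarrow> real) \<Rightarrow>
     ennreal \<Rightarrow> (real \<Rightarrow> real) \<Rightarrow> 'v qnorm" where
  "L_sp A0 A1 \<theta> r b q a f =
     (if f \<in> sum_sp A0 A1
      then wnorm 0 r b {0<..} (\<lambda>t. wnorm \<theta> q a {0<..<t} (\<lambda>u. Kfun A0 A1 u f))
      else \<infinity>)"

definition R_sp ::
  "'v::real_vector qnorm \<Rightarrow> 'v qnorm \<Rightarrow> real \<Rightarrow> ennreal \<Rightarrow> (real \<Rightarrow> real) \<Rightarrow>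
     ennreal \<Rightarrow> (real \<Rightarrow> real) \<Rightarrow> 'v qnorm" where
  "R_sp A0 A1 \<theta> r b q a f =
     (if f \<in> sum_sp A0 A1
      then wnorm 0 r b {0<..} (\<lambda>t. wnorm \<theta> q a {t<..} (\<lambda>u. Kfun A0 A1 u f))
      else \<infinity>)"

definition RR_sp ::
  "'v::real_vector qnorm \<Rightarrow> 'v qnorm \<Rightarrow> real \<Rightarrow> ennreal \<Rightarrow> (real \<Rightarrow> real) \<Rightarrow>
     ennreal \<Rightarrow> (real \<Rightarrow> real) \<Rightarrow> ennreal \<Rightarrow> (real \<Rightarrow> real) \<Rightarrow> 'v qnorm" where
  "RR_sp A0 A1 \<theta> p c r b q a f =
     (if f \<in> sum_sp A0 A1
      then wnorm 0 p c {0<..} (\<lambda>t. wnorm 0 r b {t<..}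
             (\<lambda>u. wnorm \<theta> q a {u<..} (\<lambda>v. Kfun A0 A1 v f)))
      else \<infinity>)"

section \<open>The weight functions of the reiteration formula\<close>

text \<open>
  The norms below are finite for every \<open>t > 0\<close> as soon as the corresponding norm for \<open>t = 1\<close> is finite
  (for \<open>head_norm\<close>: as soon as the iterated norm in \<open>head_norm2\<close> is finite) and the weights are slowly varying, so the
  conversion to \<open>real\<close> loses nothing where they are used.
\<close>

definition tail_norm :: "ennreal \<Rightarrow> (real \<Rightarrow> real) \<Rightarrow> real \<Rightarrow> real" where
  "tail_norm r b t = enn2real (wnorm 0 r b {t<..} (\<lambda>s. 1))"

definition head_norm :: "ennreal \<Rightarrow> (real \<Rightarrow> real) \<Rightarrow> real \<Rightarrow> real" where
  "head_norm r b t = enn2real (wnorm 0 r b {0<..<t} (\<lambda>s. 1))"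

definition head_norm2 ::
  "ennreal \<Rightarrow> (real \<Rightarrow> real) \<Rightarrow> ennreal \<Rightarrow> (real \<Rightarrow> real) \<Rightarrow> real \<Rightarrow> real" where
  "head_norm2 r b q a t =
     enn2real (wnorm 0 r b {0<..<t} (\<lambda>s. wnorm 0 q a {s<..<t} (\<lambda>u. 1)))"

definition rho :: "(real \<Rightarrow> real) \<Rightarrow> (real \<Rightarrow> real) \<Rightarrow> real \<Rightarrow> real" where
  "rho \<chi>0 \<chi>1 t = t * (\<chi>0 t / \<chi>1 t)"

definition sharp ::
  "real \<Rightarrow> (real \<Rightarrow> real) \<Rightarrow> (real \<Rightarrow> real) \<Rightarrow> (real \<Rightarrow> real) \<Rightarrow> real \<Rightarrow> real" where
  "sharp \<theta> \<chi>0 \<chi>1 a t = \<chi>0 t powr (1 - \<theta>) * \<chi>1 t powr \<theta> * (a \<circ> rho \<chi>0 \<chi>1) t"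

end

theory Submission
  imports Defs
begin

text \<open>
  The heart of the matter is a Holmstedt formula: with \<open>k(u) = K(u, f; A\<^sub>0, A\<^sub>1)\<close>, the K-functional of the
  two endpoint spaces at \<open>\<rho>(t)\<close> is equivalent to the sum of four terms, namely the endpoint norm of the
  first space restricted to \<open>(0, t)\<close>, the term \<open>\<chi>\<^sub>0(t) k(t)\<close>, and \<open>\<rho>(t)\<close> times the two parts of the endpoint
  norm of the second space that involve only \<open>k\<close> on \<open>(t, \<infinity>)\<close>. The upper bound comes from a nearly
  optimal decomposition for \<open>k(t)\<close>. The lower bound rests on \<open>k(u) \<le> N\<^sub>0 / \<chi>\<^sub>0(u)\<close> and
  \<open>k(u) \<le> u N\<^sub>1 / \<chi>\<^sub>1(u)\<close>, where \<open>N\<^sub>0\<close>, \<open>N\<^sub>1\<close> are the endpoint norms. The substitution \<open>u = \<rho>(t)\<close> turns the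
  interpolation norm into the weighted norms of these four terms. If \<open>\<theta> > 0\<close>, a Hardy inequality absorbs
  the first term into the second; if \<open>\<theta> < 1\<close>, it absorbs the last two. What remains is the right-hand
  side in each of the three cases.

  All functions that occur are almost constant on dyadic blocks. This is why the exponents of
  the inner and outer norms need not be related, and why \<open>\<rho>\<close> need not be continuous or monotone for the
  substitution. It also allows all weights to be replaced by Borel functions.
\<close>

section \<open>Powers of extended nonnegative reals\<close>

text \<open>The exponents \<open>q1\<close>, \<open>r1\<close>, \<open>r0\<close>, \<open>r\<close>
  are unrelated and may lie below 1, so Minkowski's inequality cannot serve. The estimates are made
  pointwise instead, in the form of a decay \<open>dst u t powr (- \<gamma>)\<close>, where
  \<open>dst\<close> measures logarithmic distance. A power of \<open>t\<close> times a slowly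
  varying function supplies such a decay, and it is spent in portions: half of it pays for the
  slowly varying factor, a quarter for comparing a value at \<open>u\<close> with the maximal
  function at \<open>t\<close>, and the last quarter makes the remaining kernel bounded in every
  L_q. This is the origin of the parameters \<open>\<theta> / 4\<close> and
  \<open>(1 - \<theta>) / 4\<close>. Every constant is obtained before the function \<open>k\<close>
  or the element \<open>f\<close> is fixed, hence is uniform in it. Norms stay in
  \<open>ennreal\<close>, so infinite values need no separate treatment as long as the constants are
  finite; \<open>enn2real\<close> is applied only to the weights, once they are known to be
  finite.\<close>

lemma enn_powr_0 [simp]: "enn_powr 0 p = 0"
  by (simp add: enn_powr_def)

lemma enn_powr_top [simp]: "enn_powr top p = top"
  by (simp add: enn_powr_def)

lemma enn_powr_ennreal: "0 \<le> x \<Longrightarrow> enn_powr (ennreal x) p = ennreal (x powr p)"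
  by (simp add: enn_powr_def)

lemma enn_powr_lt_top: "x < top \<Longrightarrow> enn_powr x p < top"
  by (cases x) (auto simp: enn_powr_def)

lemma enn_powr_mono: "x \<le> y \<Longrightarrow> 0 < p \<Longrightarrow> enn_powr x p \<le> enn_powr y p"
  by (cases x; cases y) (auto simp: enn_powr_def top_unique intro!: ennreal_leI powr_mono2)

lemma enn_powr_mult: "0 < p \<Longrightarrow> enn_powr (x * y) p = enn_powr x p * enn_powr y p"
  by (cases x; cases y; cases "x = 0"; cases "y = 0")
     (auto simp: enn_powr_ennreal ennreal_mult[symmetric] powr_mult
        ennreal_mult_top ennreal_top_mult ennreal_eq_0_iff)

lemma enn_powr_powr: "0 < p \<Longrightarrow> 0 < s \<Longrightarrow> enn_powr (enn_powr x p) s = enn_powr x (p * s)"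
  by (cases x) (auto simp: enn_powr_ennreal powr_powr)

lemma enn_powr_one [simp]: "enn_powr x 1 = x"
  by (cases x) (auto simp: enn_powr_ennreal)

text \<open>A sum is at most twice the maximum. The crude constant avoids a case distinction between
  \<open>p < 1\<close> and \<open>p \<ge> 1\<close>.\<close>

lemma enn_powr_add_le:
  assumes "0 < p"
  shows "enn_powr (x + y) p \<le> ennreal (2 powr p) * (enn_powr x p + enn_powr y p)"
proof -
  have "x + y \<le> 2 * max x y"
    by (metis add_mono max.cobounded1 max.cobounded2 mult_2)
  then have "enn_powr (x + y) p \<le> enn_powr (2 * max x y) p"
    using assms by (rule enn_powr_mono)
  also have "\<dots> = ennreal (2 powr p) * enn_powr (max x y) p"
    using assms enn_powr_ennreal[of 2 p] by (simp add: enn_powr_mult)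
  also have "enn_powr (max x y) p \<le> enn_powr x p + enn_powr y p"
    by (simp add: max_def)
  finally show ?thesis by (simp add: mult_left_mono)
qed

lemma measurable_enn_powr [measurable]:
  assumes [measurable]: "f \<in> borel_measurable M"
  shows "(\<lambda>x. enn_powr (f x) p) \<in> borel_measurable M"
  unfolding enn_powr_def by measurable

text \<open>Superlevel sets of a monotone function are intervals. This makes norms over
  \<open>{t<..}\<close> or \<open>{0<..<t}\<close> Borel functions of \<open>t\<close> for arbitrary
  integrands.\<close>

lemma borel_measurable_mono_ennreal:
  fixes f :: "real \<Rightarrow> ennreal"
  assumes "mono f"
  shows "f \<in> borel_measurable borel"
proof (rule borel_measurableI_greater)
  fix y
  have "is_interval {x. y < f x}"
    unfolding is_interval_1 using assms by (auto dest: monoD intro: less_le_trans)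
  then show "{x \<in> space borel. y < f x} \<in> sets borel"
    by (simp add: real_interval_borel_measurable)
qed

lemma borel_measurable_antimono_ennreal:
  fixes f :: "real \<Rightarrow> ennreal"
  assumes "antimono f"
  shows "f \<in> borel_measurable borel"
proof (rule borel_measurableI_greater)
  fix y
  have "is_interval {x. y < f x}"
    unfolding is_interval_1 using assms by (auto dest: antimonoD intro: less_le_trans)
  then show "{x \<in> space borel. y < f x} \<in> sets borel"
    by (simp add: real_interval_borel_measurable)
qed

section \<open>The multiplicative Haar measure of the half-line\<close>

text \<open>With respect to \<open>du / u\<close> the factor \<open>u\<^bsup>-1/q\<^esup>\<close> of the weighted norms disappears, and all norms are scale invariant.\<close>

definition haar :: "real measure" where
  "haar = density lborel (\<lambda>u. ennreal (1 / u) * indicator {0<..} u)"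

lemma sets_haar [simp, measurable_cong]: "sets haar = sets borel"
  by (simp add: haar_def)

lemma space_haar [simp]: "space haar = UNIV"
  by (simp add: haar_def)

lemma nn_integral_haar:
  "f \<in> borel_measurable borel \<Longrightarrow>
    (\<integral>\<^sup>+u. f u \<partial>haar) = (\<integral>\<^sup>+u. ennreal (1 / u) * indicator {0<..} u * f u \<partial>lborel)"
  unfolding haar_def by (subst nn_integral_density) auto

lemma AE_haar_iff: "(AE u in haar. P u) \<longleftrightarrow> (AE u in lborel. 0 < u \<longrightarrow> P u)"
  unfolding haar_def
  by (subst AE_density) (auto simp: indicator_def intro!: AE_cong)

lemma AE_haar_pos: "AE u in haar. 0 < u"
  by (simp add: AE_haar_iff)

lemma AE_haar_neq: "AE u in haar. u \<noteq> t"
  unfolding AE_haar_iff by (rule AE_mp[OF AE_lborel_singleton[of t]]) auto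

lemma sigma_finite_haar: "sigma_finite_measure haar"
  unfolding haar_def
  by (subst sigma_finite_measure.sigma_finite_iff_density_finite[OF sigma_finite_lborel])
     (auto simp: ennreal_mult_eq_top_iff indicator_def)

lemma pair_sigma_finite_haar: "pair_sigma_finite haar haar"
  by (simp add: pair_sigma_finite_def sigma_finite_haar)

lemma nn_integral_haar_scale:
  assumes [measurable]: "f \<in> borel_measurable borel" and c: "0 < c"
  shows "(\<integral>\<^sup>+u. f (c * u) \<partial>haar) = (\<integral>\<^sup>+u. f u \<partial>haar)"
proof -
  have "(\<integral>\<^sup>+u. f u \<partial>haar) = (\<integral>\<^sup>+u. ennreal (1 / u) * indicator {0<..} u * f u \<partial>lborel)"
    by (simp add: nn_integral_haar)
  also have "\<dots> = ennreal c * (\<integral>\<^sup>+u. ennreal (1 / (c * u)) * indicator {0<..} (c * u) * f (c * u) \<partial>lborel)"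
    using c by (subst nn_integral_real_affine[where c = c and t = 0]) auto
  also have "\<dots> = (\<integral>\<^sup>+u. ennreal c * (ennreal (1 / (c * u)) * indicator {0<..} (c * u) * f (c * u)) \<partial>lborel)"
    by (subst nn_integral_cmult) auto
  also have "\<dots> = (\<integral>\<^sup>+u. ennreal (1 / u) * indicator {0<..} u * f (c * u) \<partial>lborel)"
  proof (rule nn_integral_cong)
    fix u :: real
    show "ennreal c * (ennreal (1 / (c * u)) * indicator {0<..} (c * u) * f (c * u)) =
      ennreal (1 / u) * indicator {0<..} u * f (c * u)"
      using c by (cases "0 < u")
        (auto simp: zero_less_mult_iff mult.assoc[symmetric] ennreal_mult'[symmetric])
  qed
  also have "\<dots> = (\<integral>\<^sup>+u. f (c * u) \<partial>haar)"
    by (simp add: nn_integral_haar)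
  finally show ?thesis by simp
qed

lemma AE_haar_scale:
  assumes [measurable]: "Measurable.pred borel P" and c: "0 < c" and "AE u in haar. P u"
  shows "AE u in haar. P (c * u)"
proof -
  have "AE u in lborel. 0 < u \<longrightarrow> P u"
    using assms by (simp add: AE_haar_iff)
  then have "AE u in lborel. 0 < 0 + c * u \<longrightarrow> P (0 + c * u)"
    using c by (intro AE_borel_affine) auto
  then show ?thesis
    using c by (simp add: AE_haar_iff zero_less_mult_iff)
qed

lemma emeasure_haar_Icc:
  assumes "0 < s" "s \<le> t"
  shows "emeasure haar {s..t} = ennreal (ln (t / s))"
proof -
  have "emeasure haar {s..t} = (\<integral>\<^sup>+u. ennreal (1 / u) * indicator {0<..} u * indicator {s..t} u \<partial>lborel)"
    using nn_integral_indicator[of "{s..t}" haar] nn_integral_haar[of "indicator {s..t}"] by simp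
  also have "\<dots> = (\<integral>\<^sup>+u. ennreal (1 / u) * indicator {s..t} u \<partial>lborel)"
    using assms by (intro nn_integral_cong) (auto simp: indicator_def)
  also have "\<dots> = ennreal (ln t - ln s)"
    using assms
    by (intro nn_integral_FTC_Icc) (auto intro!: derivative_eq_intros simp: divide_simps)
  finally show ?thesis
    using assms by (simp add: ln_div)
qed

lemma emeasure_haar_Ioo:
  assumes "0 < s" "s \<le> t"
  shows "emeasure haar {s<..<t} = ennreal (ln (t / s))"
proof -
  have "emeasure haar {s<..<t} = emeasure haar {s..t}"
  proof (rule emeasure_eq_AE)
    show "AE u in haar. u \<in> {s<..<t} \<longleftrightarrow> u \<in> {s..t}"
      using AE_haar_neq[of s] AE_haar_neq[of t] by eventually_elim auto
  qed auto
  then show ?thesis using emeasure_haar_Icc[OF assms] by simp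
qed

section \<open>The multiplicative distance\<close>

text \<open>This is \<open>exp\<close> of the distance between \<open>ln u\<close> and
  \<open>ln v\<close>, so the triangle inequality takes a product form and the smallest value is
  1.\<close>

definition dst :: "real \<Rightarrow> real \<Rightarrow> real" where
  "dst u v = max (u / v) (v / u)"

lemma dst_commute: "dst u v = dst v u"
  by (simp add: dst_def max.commute)

lemma dst_ge_1: "0 < u \<Longrightarrow> 0 < v \<Longrightarrow> 1 \<le> dst u v"
  unfolding dst_def by (cases "u \<le> v") (auto simp: le_max_iff_disj)

lemma dst_pos: "0 < u \<Longrightarrow> 0 < v \<Longrightarrow> 0 < dst u v"
  using dst_ge_1[of u v] by linarith

lemma dst_le: "0 < u \<Longrightarrow> u \<le> v \<Longrightarrow> dst u v = v / u"
  unfolding dst_def by (intro max_absorb2) (auto simp: field_simps intro: mult_mono)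

lemma dst_ge: "0 < v \<Longrightarrow> v \<le> u \<Longrightarrow> dst u v = u / v"
  using dst_le[of v u] by (simp add: dst_commute)

lemma dst_self: "0 < u \<Longrightarrow> dst u u = 1"
  by (simp add: dst_def)

lemma dst_ge_ratio: "u / v \<le> dst u v" "v / u \<le> dst u v"
  by (auto simp: dst_def)

lemma dst_triangle:
  assumes "0 < u" "0 < v" "0 < w"
  shows "dst u w \<le> dst u v * dst v w"
proof -
  have "u / w = (u / v) * (v / w)" "w / u = (v / u) * (w / v)"
    using assms by auto
  moreover have "(u / v) * (v / w) \<le> dst u v * dst v w"
    "(v / u) * (w / v) \<le> dst u v * dst v w"
    using assms
    by (intro mult_mono dst_ge_ratio less_imp_le dst_pos divide_pos_pos; simp)+
  ultimately show ?thesis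
    by (simp only: dst_def[of u w] max.bounded_iff)
qed

lemma dst_scale: "0 < c \<Longrightarrow> dst (c * u) (c * v) = dst u v"
  by (simp add: dst_def)

lemma dst_less_iff: "0 < u \<Longrightarrow> 0 < v \<Longrightarrow> dst u v < L \<longleftrightarrow> u / L < v \<and> v < L * u"
proof -
  assume a: "0 < u" "0 < v"
  have "dst u v < L \<longleftrightarrow> u / v < L \<and> v / u < L"
    by (simp add: dst_def)
  moreover have "0 < L" if "u / v < L"
    using a that by (meson divide_pos_pos less_trans)
  moreover have "0 < L" if "v < L * u"
    using a that by (metis less_trans zero_less_mult_pos2)
  ultimately show ?thesis
    using a by (auto simp: field_simps)
qed

lemma dst_le_iff: "0 < u \<Longrightarrow> 0 < v \<Longrightarrow> dst u v \<le> L \<longleftrightarrow> u / L \<le> v \<and> v \<le> L * u"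
proof -
  assume a: "0 < u" "0 < v"
  have "dst u v \<le> L \<longleftrightarrow> u / v \<le> L \<and> v / u \<le> L"
    by (simp add: dst_def)
  moreover have "0 < L" if "u / v \<le> L"
    using a that by (meson divide_pos_pos less_le_trans)
  moreover have "0 < L" if "v \<le> L * u"
    using a that by (metis less_le_trans zero_less_mult_pos2)
  ultimately show ?thesis
    using a by (auto simp: field_simps)
qed

lemma measurable_dst [measurable]:
  assumes [measurable]: "f \<in> borel_measurable M" "g \<in> borel_measurable M"
  shows "(\<lambda>x. dst (f x) (g x)) \<in> borel_measurable M"
  unfolding dst_def by measurable

text \<open>In logarithmic coordinates the integrand is \<open>exp (- \<beta> * |x|)\<close>; each
  half-line contributes \<open>1 / \<beta>\<close>.\<close>

lemma haar_kernel_1: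
  assumes "0 < \<beta>"
  shows "(\<integral>\<^sup>+u. ennreal (dst u 1 powr (- \<beta>)) \<partial>haar) = ennreal (2 / \<beta>)"
proof -
  have 1: "(\<integral>\<^sup>+u. ennreal (u powr (\<beta> - 1)) * indicator {0..1} u \<partial>lborel) = ennreal (1 / \<beta>)"
    using has_integral_powr_from_0[of "\<beta> - 1" 1] assms
    by (subst nn_integral_has_integral_lebesgue') auto
  have "((\<lambda>u. - (u powr (- \<beta>)) / \<beta>) \<longlongrightarrow> - 0 / \<beta>) at_top"
    using assms by (intro tendsto_intros tendsto_neg_powr filterlim_ident) auto
  then have 2: "(\<integral>\<^sup>+u. ennreal (u powr (- \<beta> - 1)) * indicator {1..} u \<partial>lborel) = ennreal (0 - - (1 powr (- \<beta>)) / \<beta>)"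
    using assms
    by (intro nn_integral_FTC_atLeast) (auto intro!: derivative_eq_intros simp: field_simps)
  have "(\<integral>\<^sup>+u. ennreal (dst u 1 powr (- \<beta>)) \<partial>haar)
      = (\<integral>\<^sup>+u. ennreal (1 / u) * indicator {0<..} u * ennreal (dst u 1 powr (- \<beta>)) \<partial>lborel)"
    by (rule nn_integral_haar) measurable
  also have "\<dots> = (\<integral>\<^sup>+u. ennreal (u powr (\<beta> - 1)) * indicator {0..1} u
       + ennreal (u powr (- \<beta> - 1)) * indicator {1..} u \<partial>lborel)"
  proof (rule nn_integral_cong_AE)
    show "AE u in lborel. ennreal (1 / u) * indicator {0<..} u * ennreal (dst u 1 powr (- \<beta>)) =
       ennreal (u powr (\<beta> - 1)) * indicator {0..1} u + ennreal (u powr (- \<beta> - 1)) * indicator {1..} u"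
      using AE_lborel_singleton[of 0] AE_lborel_singleton[of 1]
    proof eventually_elim
      case (elim u)
      consider "u < 0" | "0 < u" "u < 1" | "1 < u" using elim by linarith
      then show ?case
      proof cases
        case 1 then show ?thesis by (auto simp: indicator_def)
      next
        case 2
        then have "(1 / u) * dst u 1 powr (- \<beta>) = u powr (\<beta> - 1)"
          by (simp add: dst_le powr_divide powr_minus powr_diff)
        then show ?thesis using 2 by (auto simp: indicator_def ennreal_mult'[symmetric])
      next
        case 3
        then have "(1 / u) * dst u 1 powr (- \<beta>) = u powr (- \<beta> - 1)"
          by (simp add: dst_ge powr_diff)
        then show ?thesis using 3 by (auto simp: indicator_def ennreal_mult'[symmetric])
      qed
    qed
  qed
  also have "\<dots> = ennreal (2 / \<beta>)"
    using assms by (subst nn_integral_add) (auto simp: 1 2 ennreal_plus[symmetric] simp del: ennreal_plus)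
  finally show ?thesis .
qed

lemma haar_kernel:
  assumes "0 < \<beta>" "0 < v"
  shows "(\<integral>\<^sup>+u. ennreal (dst u v powr (- \<beta>)) \<partial>haar) = ennreal (2 / \<beta>)"
proof -
  have "(\<integral>\<^sup>+u. ennreal (dst u v powr (- \<beta>)) \<partial>haar) = (\<integral>\<^sup>+u. ennreal (dst (v * u) v powr (- \<beta>)) \<partial>haar)"
    using assms by (intro nn_integral_haar_scale[symmetric]) auto
  also have "\<dots> = (\<integral>\<^sup>+u. ennreal (dst u 1 powr (- \<beta>)) \<partial>haar)"
    using dst_scale[of v _ 1] assms by simp
  finally show ?thesis using haar_kernel_1[OF assms(1)] by simp
qed

section \<open>Quasi-norms with respect to the Haar measure\<close>

text \<open>The counterpart of \<open>Lnorm\<close> for the Haar measure, again monotone without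
  measurability. Only the part of \<open>S\<close> in the half-line counts, so \<open>UNIV\<close>
  and \<open>{0<..}\<close> are interchangeable.\<close>

definition mn :: "ennreal \<Rightarrow> real set \<Rightarrow> (real \<Rightarrow> ennreal) \<Rightarrow> ennreal" where
  "mn q S f =
     (if q = \<infinity> then Inf {z. AE u in haar. u \<in> S \<longrightarrow> f u \<le> z}
      else enn_powr (\<integral>\<^sup>+u. enn_powr (f u) (enn2real q) * indicator S u \<partial>haar) (1 / enn2real q))"

lemma enn2real_pos: "0 < q \<Longrightarrow> q \<noteq> top \<Longrightarrow> 0 < enn2real q"
  by (simp add: enn2real_positive_iff less_top)

text \<open>The infimum is already reached by a sequence of almost-everywhere bounds, and countably
  many null sets may be united. Hence the essential supremum is itself an almost-everywhere
  bound.\<close>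

lemma AE_le_Inf:
  fixes f :: "'a \<Rightarrow> ennreal"
  shows "AE u in M. P u \<longrightarrow> f u \<le> Inf {z. AE u in M. P u \<longrightarrow> f u \<le> z}"
proof -
  let ?Z = "{z. AE u in M. P u \<longrightarrow> f u \<le> z}"
  have "?Z \<noteq> {}" by (auto intro!: exI[of _ top])
  then obtain z :: "nat \<Rightarrow> ennreal" where z: "range z \<subseteq> ?Z" "Inf ?Z = (INF i. z i)"
    by (meson ennreal_Inf_countable_INF)
  have "AE u in M. \<forall>i. P u \<longrightarrow> f u \<le> z i"
    using z(1) by (subst AE_all_countable) auto
  then show ?thesis
    unfolding z(2) by (auto intro!: INF_greatest elim!: eventually_mono)
qed

lemma mn_top_AE: "AE u in haar. u \<in> S \<longrightarrow> f u \<le> mn top S f"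
  using AE_le_Inf[of "\<lambda>u. u \<in> S" f haar] by (simp add: mn_def)

lemma mn_top_le: "(AE u in haar. u \<in> S \<longrightarrow> f u \<le> z) \<Longrightarrow> mn top S f \<le> z"
  by (simp add: mn_def Inf_lower)

lemma mn_mono_AE:
  assumes q: "0 < q" and le: "AE u in haar. u \<in> S \<longrightarrow> u \<in> T \<and> f u \<le> g u"
  shows "mn q S f \<le> mn q T g"
proof (cases "q = top")
  case True
  have "AE u in haar. u \<in> S \<longrightarrow> f u \<le> mn top T g"
    using mn_top_AE[of T g] le by eventually_elim (auto intro: order_trans)
  then show ?thesis using True mn_top_le by simp
next
  case False
  with q have p: "0 < enn2real q" by (simp add: enn2real_pos)
  have "(\<integral>\<^sup>+u. enn_powr (f u) (enn2real q) * indicator S u \<partial>haar)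
      \<le> (\<integral>\<^sup>+u. enn_powr (g u) (enn2real q) * indicator T u \<partial>haar)"
    using le by (intro nn_integral_mono_AE, eventually_elim)
      (auto simp: indicator_def intro: enn_powr_mono p)
  then show ?thesis using False p by (simp add: mn_def enn_powr_mono)
qed

lemma mn_mono:
  assumes "0 < q" and "\<And>u. 0 < u \<Longrightarrow> u \<in> S \<Longrightarrow> u \<in> T \<and> f u \<le> g u"
  shows "mn q S f \<le> mn q T g"
  by (rule mn_mono_AE[OF assms(1)], rule eventually_mono[OF AE_haar_pos]) (use assms(2) in blast)

lemma mn_cong:
  assumes "0 < q" and "\<And>u. 0 < u \<Longrightarrow> u \<in> S \<Longrightarrow> f u = g u"
  shows "mn q S f = mn q S g"
  using assms by (intro antisym mn_mono) auto

lemma mn_cmult: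
  assumes q: "0 < q" and [measurable]: "f \<in> borel_measurable borel" "S \<in> sets borel"
  shows "mn q S (\<lambda>u. c * f u) = c * mn q S f"
proof (cases "q = top")
  case False
  with q have p: "0 < enn2real q" by (simp add: enn2real_pos)
  have "(\<integral>\<^sup>+u. enn_powr (c * f u) (enn2real q) * indicator S u \<partial>haar)
     = enn_powr c (enn2real q) * (\<integral>\<^sup>+u. enn_powr (f u) (enn2real q) * indicator S u \<partial>haar)"
    using p by (subst nn_integral_cmult[symmetric]) (auto simp: enn_powr_mult mult.assoc)
  then show ?thesis
    using False p by (simp add: mn_def enn_powr_mult enn_powr_powr)
next
  case True
  show ?thesis unfolding True
  proof (rule antisym)
    show "mn top S (\<lambda>u. c * f u) \<le> c * mn top S f"
      using mn_top_AE[of S f] by (intro mn_top_le, eventually_elim) (auto intro: mult_left_mono)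
    have AE: "AE u in haar. u \<in> S \<longrightarrow> c * f u \<le> mn top S (\<lambda>u. c * f u)"
      by (rule mn_top_AE)
    consider "c = 0" | "c = top" | "0 < c" "c < top"
      by (metis less_top not_gr_zero)
    then show "c * mn top S f \<le> mn top S (\<lambda>u. c * f u)"
    proof cases
      \<comment> \<open>With \<open>c = top\<close>, a finite right-hand side forces
        \<open>f\<close> to vanish almost everywhere on \<open>S\<close>, and then the left-hand
        side is \<open>top * 0 = 0\<close>.\<close>
      case 2
      show ?thesis
      proof (cases "mn top S (\<lambda>u. c * f u) = top")
        case False
        from AE have "AE u in haar. u \<in> S \<longrightarrow> f u \<le> 0"
          by eventually_elim (use False 2 in \<open>auto simp: ennreal_top_mult top_unique split: if_splits\<close>)
        then have "mn top S f = 0" using mn_top_le[of S f 0] by simp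
        then show ?thesis by simp
      qed simp
    next
      case 3
      have "AE u in haar. u \<in> S \<longrightarrow> f u \<le> mn top S (\<lambda>u. c * f u) / c"
        using AE
      proof eventually_elim
        case (elim u)
        have "f u = (c * f u) / c"
          using 3 by (simp add: ennreal_mult_divide_eq mult.commute[of c])
        then show ?case
          using elim by (metis divide_right_mono_ennreal)
      qed
      then have "mn top S f \<le> mn top S (\<lambda>u. c * f u) / c" by (rule mn_top_le)
      then have "c * mn top S f \<le> c * (mn top S (\<lambda>u. c * f u) / c)" by (rule mult_left_mono) simp
      also have "\<dots> = mn top S (\<lambda>u. c * f u)"
        using 3 by (simp add: ennreal_times_divide mult.commute[of c] ennreal_mult_divide_eq)
      finally show ?thesis .
    qed simp
  qed
qed

lemma mn_le_cmult:
  assumes "0 < q" and "g \<in> borel_measurable borel" "T \<in> sets borel"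
    and "\<And>u. 0 < u \<Longrightarrow> u \<in> S \<Longrightarrow> u \<in> T \<and> f u \<le> c * g u"
  shows "mn q S f \<le> c * mn q T g"
proof -
  have "mn q S f \<le> mn q T (\<lambda>u. c * g u)"
    by (rule mn_mono[OF assms(1) assms(4)])
  then show ?thesis by (simp only: mn_cmult[OF assms(1-3)])
qed

text \<open>The constant of \<open>enn_powr_add_le\<close> for the final root of order
  \<open>q\<close>; an essential supremum over two pieces costs no constant.\<close>

definition Kq :: "ennreal \<Rightarrow> ennreal" where
  "Kq q = (if q = top then 1 else ennreal (2 powr (1 / enn2real q)))"

lemma Kq_less_top [simp]: "Kq q < top"
  by (simp add: Kq_def)

text \<open>The exceptional point \<open>t\<close> is a null set. This allows the half-line to be
  cut at \<open>t\<close> into the open intervals \<open>{0<..<t}\<close> and \<open>{t<..}\<close>,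
  with a separate majorant on each.\<close>

lemma mn_split:
  assumes q: "0 < q"
    and [measurable]: "f \<in> borel_measurable borel" "g \<in> borel_measurable borel"
      "S1 \<in> sets borel" "S2 \<in> sets borel"
    and disj: "S1 \<inter> S2 = {}"
    and le: "\<And>u. 0 < u \<Longrightarrow> u \<in> S \<Longrightarrow> u \<noteq> t \<Longrightarrow> (u \<in> S1 \<and> h u \<le> f u) \<or> (u \<in> S2 \<and> h u \<le> g u)"
  shows "mn q S h \<le> Kq q * (mn q S1 f + mn q S2 g)"
proof (cases "q = top")
  case True
  have "AE u in haar. u \<in> S \<longrightarrow> h u \<le> mn top S1 f + mn top S2 g"
    using mn_top_AE[of S1 f] mn_top_AE[of S2 g] AE_haar_pos AE_haar_neq[of t]
  proof eventually_elim
    case (elim u)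
    show ?case
    proof
      assume "u \<in> S"
      from le[OF elim(3) this elim(4)]
      have "h u \<le> mn top S1 f \<or> h u \<le> mn top S2 g"
        using elim by (meson order_trans)
      then show "h u \<le> mn top S1 f + mn top S2 g"
        by (meson add_increasing add_increasing2 zero_le)
    qed
  qed
  then show ?thesis using True by (simp add: Kq_def mn_top_le)
next
  case False
  define p where "p = enn2real q"
  have p: "0 < p" using q False by (simp add: enn2real_pos p_def)
  have "(\<integral>\<^sup>+u. enn_powr (h u) p * indicator S u \<partial>haar) \<le>
        (\<integral>\<^sup>+u. enn_powr (f u) p * indicator S1 u + enn_powr (g u) p * indicator S2 u \<partial>haar)"
    using AE_haar_pos AE_haar_neq[of t]
  proof (intro nn_integral_mono_AE, eventually_elim)
    case (elim u)
    then show ?case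
      using le[of u] disj by (auto simp: indicator_def intro!: enn_powr_mono p)
  qed
  also have "\<dots> = (\<integral>\<^sup>+u. enn_powr (f u) p * indicator S1 u \<partial>haar)
       + (\<integral>\<^sup>+u. enn_powr (g u) p * indicator S2 u \<partial>haar)"
    by (intro nn_integral_add) measurable
  finally have "enn_powr (\<integral>\<^sup>+u. enn_powr (h u) p * indicator S u \<partial>haar) (1 / p) \<le>
     enn_powr ((\<integral>\<^sup>+u. enn_powr (f u) p * indicator S1 u \<partial>haar)
       + (\<integral>\<^sup>+u. enn_powr (g u) p * indicator S2 u \<partial>haar)) (1 / p)"
    using p by (intro enn_powr_mono) auto
  also have "\<dots> \<le> ennreal (2 powr (1 / p)) * (enn_powr (\<integral>\<^sup>+u. enn_powr (f u) p * indicator S1 u \<partial>haar) (1 / p)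
       + enn_powr (\<integral>\<^sup>+u. enn_powr (g u) p * indicator S2 u \<partial>haar) (1 / p))"
    using p by (intro enn_powr_add_le) simp
  finally show ?thesis
    using False by (simp add: mn_def p_def Kq_def)
qed

text \<open>Cut the domain according to which function is larger; on each piece the sum is at most
  twice the larger one, and \<open>mn_split\<close> applies.\<close>

lemma mn_add:
  assumes q: "0 < q"
    and [measurable]: "f \<in> borel_measurable borel" "g \<in> borel_measurable borel" "S \<in> sets borel"
  shows "mn q S (\<lambda>u. f u + g u) \<le> 2 * Kq q * (mn q S f + mn q S g)"
proof -
  let ?A = "{u \<in> S. g u \<le> f u}" and ?B = "{u \<in> S. f u < g u}"
  have [measurable]: "?A \<in> sets borel" "?B \<in> sets borel"
    by measurable
  have "mn q S (\<lambda>u. f u + g u) \<le> Kq q * (mn q ?A (\<lambda>u. 2 * f u) + mn q ?B (\<lambda>u. 2 * g u))"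
  proof (rule mn_split[where t = 0, OF q])
    fix u assume "u \<in> S"
    then show "u \<in> ?A \<and> f u + g u \<le> 2 * f u \<or> u \<in> ?B \<and> f u + g u \<le> 2 * g u"
      by (cases "g u \<le> f u") (auto simp: mult_2 add_mono intro: add_right_mono less_imp_le)
  qed (measurable, auto)
  also have "mn q ?A (\<lambda>u. 2 * f u) = 2 * mn q ?A f"
    by (rule mn_cmult[OF q]) measurable
  also have "mn q ?B (\<lambda>u. 2 * g u) = 2 * mn q ?B g"
    by (rule mn_cmult[OF q]) measurable
  also have "Kq q * (2 * mn q ?A f + 2 * mn q ?B g) \<le> Kq q * (2 * mn q S f + 2 * mn q S g)"
    by (intro mult_left_mono add_mono mn_mono q) auto
  also have "\<dots> = 2 * Kq q * (mn q S f + mn q S g)"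
    by (simp add: algebra_simps)
  finally show ?thesis .
qed

text \<open>The norm of the constant 1 over a block \<open>{t<..<2 * t}\<close>, whose Haar measure
  is \<open>ln 2\<close> wherever the block lies.\<close>

definition Lq :: "ennreal \<Rightarrow> ennreal" where
  "Lq q = (if q = top then 1 else ennreal (ln 2 powr (1 / enn2real q)))"

lemma Lq_pos [simp]: "0 < Lq q" and Lq_less_top [simp]: "Lq q < top"
  by (simp_all add: Lq_def)

lemma mn_const:
  assumes q: "0 < q" and t: "0 < t"
  shows "mn q {t<..<2 * t} (\<lambda>u. 1) = Lq q"
proof (cases "q = top")
  case True
  have "1 \<le> mn top {t<..<2 * t} (\<lambda>u. 1)"
  proof (rule ccontr)
    assume "\<not> 1 \<le> mn top {t<..<2 * t} (\<lambda>u. 1)"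
    with mn_top_AE[of "{t<..<2 * t}" "\<lambda>u. 1"] have "AE u in haar. u \<notin> {t<..<2 * t}"
      by (auto elim!: eventually_mono)
    then have "emeasure haar {t<..<2 * t} = 0"
      by (subst (asm) AE_iff_measurable[of "{t<..<2 * t}"]) auto
    then show False using t by (simp add: emeasure_haar_Ioo)
  qed
  moreover have "mn top {t<..<2 * t} (\<lambda>u. 1) \<le> 1" by (rule mn_top_le) simp
  ultimately show ?thesis using True by (simp add: Lq_def)
next
  case False
  define p where "p = enn2real q"
  have p: "0 < p" using q False by (simp add: enn2real_pos p_def)
  have "enn_powr 1 p = 1" using enn_powr_ennreal[of 1 p] by simp
  then have "mn q {t<..<2 * t} (\<lambda>u. 1) = enn_powr (emeasure haar {t<..<2 * t}) (1 / p)"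
    using False by (simp add: mn_def p_def)
  also have "\<dots> = ennreal (ln 2 powr (1 / p))"
    using t by (simp add: emeasure_haar_Ioo enn_powr_ennreal)
  finally show ?thesis using False by (simp add: Lq_def p_def)
qed

lemma mn_ge:
  assumes q: "0 < q" and t: "0 < t" and "\<And>u. t < u \<Longrightarrow> u < 2 * t \<Longrightarrow> u \<in> S \<and> m \<le> f u"
  shows "Lq q * m \<le> mn q S f"
proof -
  have "m * mn q {t<..<2 * t} (\<lambda>u. 1) = mn q {t<..<2 * t} (\<lambda>u. m * 1)"
    by (rule mn_cmult[symmetric, OF q]) auto
  also have "\<dots> \<le> mn q S f"
    using assms(3) by (intro mn_mono q) auto
  finally show ?thesis unfolding mn_const[OF q t] by (simp only: mult.commute)
qed

lemma mn_scale:
  assumes q: "0 < q" and c: "0 < c"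
    and [measurable]: "f \<in> borel_measurable borel" "S \<in> sets borel"
  shows "mn q ((*) c -` S) (\<lambda>u. f (c * u)) = mn q S f"
proof (cases "q = top")
  case False
  have "(\<integral>\<^sup>+u. enn_powr (f (c * u)) (enn2real q) * indicator ((*) c -` S) u \<partial>haar)
     = (\<integral>\<^sup>+u. enn_powr (f (c * u)) (enn2real q) * indicator S (c * u) \<partial>haar)"
    by (simp add: indicator_def)
  also have "\<dots> = (\<integral>\<^sup>+u. enn_powr (f u) (enn2real q) * indicator S u \<partial>haar)"
    by (rule nn_integral_haar_scale[OF _ c]) measurable
  finally show ?thesis using False by (simp add: mn_def)
next
  case True
  have "(AE u in haar. u \<in> S \<longrightarrow> f u \<le> z) \<longleftrightarrow> (AE u in haar. c * u \<in> S \<longrightarrow> f (c * u) \<le> z)" for z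
  proof
    show "AE u in haar. c * u \<in> S \<longrightarrow> f (c * u) \<le> z" if "AE u in haar. u \<in> S \<longrightarrow> f u \<le> z"
      using AE_haar_scale[OF _ c that] by measurable
    show "AE u in haar. u \<in> S \<longrightarrow> f u \<le> z" if "AE u in haar. c * u \<in> S \<longrightarrow> f (c * u) \<le> z"
      using AE_haar_scale[of "\<lambda>u. c * u \<in> S \<longrightarrow> f (c * u) \<le> z" "1 / c"] c that by simp
  qed
  then show ?thesis using True by (simp add: mn_def)
qed

text \<open>The bound for the norm of \<open>dst u t powr (- \<alpha>)\<close>: the value of
  \<open>haar_kernel\<close> at the exponent \<open>\<alpha> * q\<close>, followed by the root of
  order \<open>q\<close>; for \<open>q = top\<close> the supremum is at most 1.\<close>

definition Pq :: "real \<Rightarrow> ennreal \<Rightarrow> ennreal" where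
  "Pq \<alpha> q = (if q = top then 1 else ennreal ((2 / (\<alpha> * enn2real q)) powr (1 / enn2real q)))"

lemma Pq_less_top [simp]: "Pq \<alpha> q < top"
  by (simp add: Pq_def)

lemma mn_dst_powr:
  assumes q: "0 < q" and \<alpha>: "0 < \<alpha>" and t: "0 < t"
  shows "mn q S (\<lambda>u. ennreal (dst u t powr (- \<alpha>))) \<le> Pq \<alpha> q"
proof (cases "q = top")
  case True
  have "AE u in haar. u \<in> S \<longrightarrow> ennreal (dst u t powr (- \<alpha>)) \<le> 1"
    using AE_haar_pos
  proof eventually_elim
    case (elim u)
    have "dst u t powr (- \<alpha>) \<le> dst u t powr 0"
      using dst_ge_1[OF elim t] \<alpha> by (intro powr_mono) auto
    then show ?case using dst_ge_1[OF elim t] by (simp split: if_splits)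
  qed
  then show ?thesis using True by (simp add: Pq_def mn_top_le)
next
  case False
  define p where "p = enn2real q"
  have p: "0 < p" using q False by (simp add: enn2real_pos p_def)
  have "(\<integral>\<^sup>+u. enn_powr (ennreal (dst u t powr (- \<alpha>))) p * indicator S u \<partial>haar)
     \<le> (\<integral>\<^sup>+u. ennreal (dst u t powr (- (\<alpha> * p))) \<partial>haar)"
    by (intro nn_integral_mono) (auto simp: indicator_def enn_powr_ennreal powr_powr)
  also have "\<dots> = ennreal (2 / (\<alpha> * p))"
    using \<alpha> p t by (intro haar_kernel) auto
  finally have "enn_powr (\<integral>\<^sup>+u. enn_powr (ennreal (dst u t powr (- \<alpha>))) p * indicator S u \<partial>haar) (1 / p)
     \<le> enn_powr (ennreal (2 / (\<alpha> * p))) (1 / p)"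
    using p by (intro enn_powr_mono) auto
  then show ?thesis using False \<alpha> p by (simp add: mn_def p_def Pq_def enn_powr_ennreal)
qed

lemma measurable_mn_Ioi:
  assumes "0 < q" shows "(\<lambda>s. mn q {s<..} f) \<in> borel_measurable borel"
  by (rule borel_measurable_antimono_ennreal, rule antimonoI, rule mn_mono[OF assms]) auto

lemma measurable_mn_Ioo_left:
  assumes "0 < q" shows "(\<lambda>s. mn q {s<..<t} f) \<in> borel_measurable borel"
  by (rule borel_measurable_antimono_ennreal, rule antimonoI, rule mn_mono[OF assms]) auto

lemma measurable_mn_Ioo_right:
  assumes "0 < q" shows "(\<lambda>t. mn q {s<..<t} f) \<in> borel_measurable borel"
  by (rule borel_measurable_mono_ennreal, rule monoI, rule mn_mono[OF assms]) auto

section \<open>Comparison with the weighted Lebesgue norms\<close>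

lemma Lnorm_top_AE:
  assumes S: "S \<in> sets lebesgue"
  shows "Lnorm top S f = Inf {z. AE u in lborel. u \<in> S \<longrightarrow> f u \<le> z}"
proof -
  have "(AE u in lebesgue_on S. f u \<le> z) \<longleftrightarrow> (AE u in lborel. u \<in> S \<longrightarrow> f u \<le> z)" for z
    by (subst AE_restrict_space_iff) (use S in simp_all, rule AE_completion_iff)
  then show ?thesis by (simp add: Lnorm_def)
qed

lemma Lnorm_finite:
  assumes "S \<in> sets lebesgue" "q \<noteq> top"
  shows "Lnorm q S f = enn_powr (\<integral>\<^sup>+u. enn_powr (f u) (enn2real q) * indicator S u \<partial>lborel) (1 / enn2real q)"
proof -
  have "(\<integral>\<^sup>+u. f u \<partial>lebesgue_on S) = (\<integral>\<^sup>+u. f u * indicator S u \<partial>lborel)" for f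
    using assms(1) by (subst nn_integral_restrict_space) (simp_all add: nn_integral_completion)
  then show ?thesis using assms(2) by (simp add: Lnorm_def)
qed

text \<open>The factor \<open>u powr (- 1 / q)\<close>, raised to the power \<open>q\<close>, is
  exactly the Haar density \<open>1 / u\<close>.\<close>

lemma wnorm_eq_mn:
  assumes q: "0 < q"
    and [measurable]: "b \<in> borel_measurable borel" "F \<in> borel_measurable borel" "S \<in> sets borel"
    and S: "S \<subseteq> {0<..}"
  shows "wnorm \<theta> q b S F = mn q S (\<lambda>u. ennreal (u powr (- \<theta>) * b u) * F u)"
proof (cases "q = top")
  case True
  define f where "f = (\<lambda>u. ennreal (u powr (- \<theta>) * b u) * F u)"
  have "(0 < u \<longrightarrow> u \<in> S \<longrightarrow> f u \<le> z) = (u \<in> S \<longrightarrow> f u \<le> z)" for u z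
    using S by auto
  then have "mn top S f = Lnorm top S f"
    by (simp add: mn_def Lnorm_top_AE AE_haar_iff)
  then show ?thesis
    using True by (simp add: wnorm_def f_def)
next
  case False
  define p where "p = enn2real q"
  have p: "0 < p" using q False by (simp add: enn2real_pos p_def)
  have q': "enn2real (1 / q) = 1 / p"
    using False q by (cases q) (auto simp: p_def divide_ennreal[symmetric] simp flip: ennreal_1)
  have "(\<integral>\<^sup>+u. enn_powr (ennreal (u powr (- \<theta> - 1 / p) * b u) * F u) p * indicator S u \<partial>lborel) =
    (\<integral>\<^sup>+u. ennreal (1 / u) * indicator {0<..} u * (enn_powr (ennreal (u powr (- \<theta>) * b u) * F u) p * indicator S u) \<partial>lborel)"
  proof (rule nn_integral_cong)
    fix u
    show "enn_powr (ennreal (u powr (- \<theta> - 1 / p) * b u) * F u) p * indicator S u =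
      ennreal (1 / u) * indicator {0<..} u * (enn_powr (ennreal (u powr (- \<theta>) * b u) * F u) p * indicator S u)"
    proof (cases "u \<in> S")
      case True
      then have u: "0 < u" using S by auto
      have exps: "- \<theta> - 1 / p = - (1 / p) + - \<theta>" by simp
      have "u powr (- \<theta> - 1 / p) * b u = u powr (- (1 / p)) * (u powr (- \<theta>) * b u)"
        unfolding exps powr_add by (rule mult.assoc)
      moreover have "enn_powr (ennreal (u powr (- (1 / p)))) p = ennreal (1 / u)"
        using u p powr_powr[of u "- (1 / p)" p] powr_minus_divide[of u 1] by (simp add: enn_powr_ennreal)
      moreover have "ennreal (u powr (- (1 / p)) * (u powr (- \<theta>) * b u)) =
          ennreal (u powr (- (1 / p))) * ennreal (u powr (- \<theta>) * b u)"
        by (rule ennreal_mult') simp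
      ultimately have "enn_powr (ennreal (u powr (- \<theta> - 1 / p) * b u) * F u) p =
        ennreal (1 / u) * enn_powr (ennreal (u powr (- \<theta>) * b u) * F u) p"
        by (simp only: enn_powr_mult[OF p] mult.assoc)
      then show ?thesis using True u by simp
    qed simp
  qed
  also have "\<dots> = (\<integral>\<^sup>+u. enn_powr (ennreal (u powr (- \<theta>) * b u) * F u) p * indicator S u \<partial>haar)"
    by (rule nn_integral_haar[symmetric]) measurable
  finally show ?thesis
    using False by (simp add: wnorm_def Lnorm_finite mn_def p_def[symmetric] q')
qed

text \<open>The integral of an arbitrary function is a supremum over simple functions below it, and
  a simple \<open>h\<close> below \<open>f\<close> yields the simple function \<open>h / c\<close>
  below \<open>g\<close>. Finiteness of \<open>c\<close> is what makes division undo
  multiplication.\<close>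

lemma nn_integral_le_cmult:
  assumes c: "c < top" and le: "\<And>u. f u \<le> c * g u"
  shows "(\<integral>\<^sup>+u. f u \<partial>M) \<le> c * (\<integral>\<^sup>+u. g u \<partial>M)"
proof (cases "c = 0")
  case True
  then show ?thesis using le by simp
next
  case False
  show ?thesis unfolding nn_integral_def[of M f]
  proof (rule SUP_least, clarsimp)
    fix h assume h: "simple_function M h" "h \<le> f"
    have "h u / c \<le> g u" for u
    proof -
      have "h u \<le> c * g u" using h(2) le[of u] by (auto simp: le_fun_def intro: order_trans)
      then have "h u / c \<le> c * g u / c" by (rule divide_right_mono_ennreal)
      then show ?thesis using False c by (simp add: mult.commute[of c] ennreal_mult_divide_eq)
    qed
    then have "(\<integral>\<^sup>+u. h u / c \<partial>M) \<le> (\<integral>\<^sup>+u. g u \<partial>M)" by (intro nn_integral_mono) auto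
    then have "c * (\<integral>\<^sup>+u. h u / c \<partial>M) \<le> c * (\<integral>\<^sup>+u. g u \<partial>M)" by (rule mult_left_mono) simp
    also have "c * (\<integral>\<^sup>+u. h u / c \<partial>M) = (\<integral>\<^sup>+u. c * (h u / c) \<partial>M)"
      using h(1) by (intro nn_integral_cmult[symmetric]) (auto intro: borel_measurable_simple_function)
    also have "\<dots> = (\<integral>\<^sup>+u. h u \<partial>M)"
      using False c by (simp add: ennreal_times_divide mult.commute[of c] ennreal_mult_divide_eq)
    also have "\<dots> = integral\<^sup>S M h" using h(1) by (rule nn_integral_eq_simple_integral)
    finally show "integral\<^sup>S M h \<le> c * (\<integral>\<^sup>+u. g u \<partial>M)" .
  qed
qed

text \<open>This is stated for arbitrary functions because it is applied to the weights \<open>a \<circ> \<rho>\<close>, which need not be measurable.\<close>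

lemma wnorm_le_cmult:
  assumes q: "0 < q" and c: "c < top" and S: "S \<in> sets borel" "S \<subseteq> {0<..}"
    and le: "\<And>u. u \<in> S \<Longrightarrow> ennreal (b u) * F u \<le> c * (ennreal (b' u) * G u)"
  shows "wnorm \<theta> q b S F \<le> c * wnorm \<theta> q b' S G"
proof -
  define f where "f = (\<lambda>u. ennreal (u powr (- \<theta> - enn2real (1 / q)) * b u) * F u)"
  define g where "g = (\<lambda>u. ennreal (u powr (- \<theta> - enn2real (1 / q)) * b' u) * G u)"
  have fg: "f u \<le> c * g u" if "u \<in> S" for u
  proof -
    have "f u = ennreal (u powr (- \<theta> - enn2real (1 / q))) * (ennreal (b u) * F u)"
      by (simp add: f_def ennreal_mult' mult.assoc)
    also have "\<dots> \<le> ennreal (u powr (- \<theta> - enn2real (1 / q))) * (c * (ennreal (b' u) * G u))"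
      using le[OF that] by (rule mult_left_mono) simp
    also have "\<dots> = c * g u"
      unfolding g_def by (subst ennreal_mult') (simp_all add: mult_ac)
    finally show ?thesis .
  qed
  have "Lnorm q S f \<le> c * Lnorm q S g"
  proof (cases "q = top")
    case True
    have "AE u in lborel. u \<in> S \<longrightarrow> f u \<le> c * Inf {z. AE u in lborel. u \<in> S \<longrightarrow> g u \<le> z}"
      using AE_le_Inf[of "\<lambda>u. u \<in> S" g lborel]
      by eventually_elim (meson fg mult_left_mono order_trans zero_le)
    then have "Inf {z. AE u in lborel. u \<in> S \<longrightarrow> f u \<le> z}
        \<le> c * Inf {z. AE u in lborel. u \<in> S \<longrightarrow> g u \<le> z}"
      by (intro Inf_lower) simp
    then show ?thesis using True S by (simp add: Lnorm_top_AE)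
  next
    case False
    define p where "p = enn2real q"
    have p: "0 < p" using q False by (simp add: enn2real_pos p_def)
    have "(\<integral>\<^sup>+u. enn_powr (f u) p * indicator S u \<partial>lborel)
       \<le> enn_powr c p * (\<integral>\<^sup>+u. enn_powr (g u) p * indicator S u \<partial>lborel)"
    proof (rule nn_integral_le_cmult)
      fix u
      show "enn_powr (f u) p * indicator S u \<le> enn_powr c p * (enn_powr (g u) p * indicator S u)"
        using enn_powr_mono[OF fg p, of u] p by (auto simp: indicator_def enn_powr_mult)
    qed (use c enn_powr_lt_top in auto)
    then have "enn_powr (\<integral>\<^sup>+u. enn_powr (f u) p * indicator S u \<partial>lborel) (1 / p) \<le>
      enn_powr (enn_powr c p * (\<integral>\<^sup>+u. enn_powr (g u) p * indicator S u \<partial>lborel)) (1 / p)"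
      using p by (intro enn_powr_mono) auto
    then show ?thesis
      using False p S by (simp add: Lnorm_finite p_def[symmetric] enn_powr_mult enn_powr_powr)
  qed
  then show ?thesis by (simp add: wnorm_def f_def g_def)
qed

lemma wnorm_cong:
  assumes "0 < q" "S \<in> sets borel" "S \<subseteq> {0<..}"
    and "\<And>u. u \<in> S \<Longrightarrow> b u = b' u" and "\<And>u. u \<in> S \<Longrightarrow> F u = G u"
  shows "wnorm \<theta> q b S F = wnorm \<theta> q b' S G"
  using wnorm_le_cmult[of q 1 S b F b' G \<theta>] wnorm_le_cmult[of q 1 S b' G b F \<theta>] assms
  by (intro antisym) auto

section \<open>Slowly varying functions through the multiplicative distance\<close>

text \<open>The two almost-monotonicity conditions of \<open>SV\<close> merged into one inequality
  that does not ask which of \<open>s\<close> and \<open>t\<close> is larger; measurability is kept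
  apart.\<close>

definition slow :: "(real \<Rightarrow> real) \<Rightarrow> bool" where
  "slow w \<longleftrightarrow> (\<forall>t>0. 0 < w t) \<and>
     (\<forall>\<epsilon>>0. \<exists>C. \<forall>s>0. \<forall>t>0. w s \<le> C * dst s t powr \<epsilon> * w t)"

lemma slow_pos: "slow w \<Longrightarrow> 0 < t \<Longrightarrow> 0 < w t"
  by (simp add: slow_def)

lemma slowE:
  assumes "slow w" "0 < \<epsilon>"
  obtains C where "1 \<le> C" "\<And>s t. 0 < s \<Longrightarrow> 0 < t \<Longrightarrow> w s \<le> C * dst s t powr \<epsilon> * w t"
proof -
  have "\<exists>C. \<forall>s>0. \<forall>t>0. w s \<le> C * dst s t powr \<epsilon> * w t"
    using assms by (simp add: slow_def)
  then obtain C where "\<forall>s>0. \<forall>t>0. w s \<le> C * dst s t powr \<epsilon> * w t" ..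
  then have C: "\<And>s t. 0 < s \<Longrightarrow> 0 < t \<Longrightarrow> w s \<le> C * dst s t powr \<epsilon> * w t"
    by simp
  have "w 1 \<le> C * w 1" using C[of 1 1] by (simp add: dst_self)
  then have "1 \<le> C" using slow_pos[OF assms(1), of 1] by simp
  then show ?thesis using C by (rule that)
qed

lemma slow_mult:
  assumes v: "slow v" and w: "slow w"
  shows "slow (\<lambda>t. v t * w t)"
  unfolding slow_def
proof (intro conjI allI impI)
  fix \<epsilon> :: real assume "0 < \<epsilon>"
  then have e: "0 < \<epsilon> / 2" by simp
  obtain C where C: "1 \<le> C" "\<And>s t. 0 < s \<Longrightarrow> 0 < t \<Longrightarrow> v s \<le> C * dst s t powr (\<epsilon> / 2) * v t"
    using slowE[OF v e] by blast
  obtain D where D: "1 \<le> D" "\<And>s t. 0 < s \<Longrightarrow> 0 < t \<Longrightarrow> w s \<le> D * dst s t powr (\<epsilon> / 2) * w t"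
    using slowE[OF w e] by blast
  show "\<exists>C. \<forall>s>0. \<forall>t>0. v s * w s \<le> C * dst s t powr \<epsilon> * (v t * w t)"
  proof (intro exI allI impI)
    fix s t :: real assume st: "0 < s" "0 < t"
    have "v s * w s \<le> (C * dst s t powr (\<epsilon> / 2) * v t) * (D * dst s t powr (\<epsilon> / 2) * w t)"
      using st C D slow_pos[OF v] slow_pos[OF w]
      by (intro mult_mono) (auto intro!: mult_nonneg_nonneg simp: less_imp_le)
    also have "\<dots> = (C * D) * (dst s t powr (\<epsilon> / 2) * dst s t powr (\<epsilon> / 2)) * (v t * w t)"
      by (simp add: mult_ac)
    also have "\<dots> = (C * D) * dst s t powr \<epsilon> * (v t * w t)"
      by (simp add: powr_add[symmetric])
    finally show "v s * w s \<le> (C * D) * dst s t powr \<epsilon> * (v t * w t)" .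
  qed
qed (use slow_pos[OF v] slow_pos[OF w] in auto)

lemma slow_inverse:
  assumes w: "slow w"
  shows "slow (\<lambda>t. inverse (w t))"
  unfolding slow_def
proof (intro conjI allI impI)
  fix \<epsilon> :: real assume e: "0 < \<epsilon>"
  obtain C where C: "1 \<le> C" "\<And>s t. 0 < s \<Longrightarrow> 0 < t \<Longrightarrow> w s \<le> C * dst s t powr \<epsilon> * w t"
    using slowE[OF w e] by blast
  show "\<exists>C. \<forall>s>0. \<forall>t>0. inverse (w s) \<le> C * dst s t powr \<epsilon> * inverse (w t)"
  proof (intro exI allI impI)
    fix s t :: real assume st: "0 < s" "0 < t"
    show "inverse (w s) \<le> C * dst s t powr \<epsilon> * inverse (w t)"
      using C(2)[OF st(2,1)] slow_pos[OF w st(1)] slow_pos[OF w st(2)]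
      by (simp add: field_simps dst_commute[of t s])
  qed
qed (use slow_pos[OF w] in auto)

lemma slow_divide: "slow v \<Longrightarrow> slow w \<Longrightarrow> slow (\<lambda>t. v t / w t)"
  unfolding divide_inverse by (intro slow_mult slow_inverse)

lemma slow_powr_pos:
  assumes w: "slow w" and g: "0 < \<gamma>"
  shows "slow (\<lambda>t. w t powr \<gamma>)"
  unfolding slow_def
proof (intro conjI allI impI)
  fix \<epsilon> :: real assume "0 < \<epsilon>"
  then have e: "0 < \<epsilon> / \<gamma>" using g by simp
  obtain C where C: "1 \<le> C" "\<And>s t. 0 < s \<Longrightarrow> 0 < t \<Longrightarrow> w s \<le> C * dst s t powr (\<epsilon> / \<gamma>) * w t"
    using slowE[OF w e] by blast
  show "\<exists>C. \<forall>s>0. \<forall>t>0. w s powr \<gamma> \<le> C * dst s t powr \<epsilon> * w t powr \<gamma>"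
  proof (intro exI allI impI)
    fix s t :: real assume st: "0 < s" "0 < t"
    have "w s powr \<gamma> \<le> (C * dst s t powr (\<epsilon> / \<gamma>) * w t) powr \<gamma>"
      using C(2)[OF st] slow_pos[OF w st(1)] g by (intro powr_mono2) auto
    also have "\<dots> = C powr \<gamma> * dst s t powr \<epsilon> * w t powr \<gamma>"
      using C(1) g slow_pos[OF w st(2)] by (simp add: powr_mult powr_powr)
    finally show "w s powr \<gamma> \<le> C powr \<gamma> * dst s t powr \<epsilon> * w t powr \<gamma>" .
  qed
next
  fix t :: real assume "0 < t"
  then have "0 < w t" by (rule slow_pos[OF w])
  then show "0 < w t powr \<gamma>" by simp
qed

lemma slow_cong:
  assumes "slow v" "\<And>t. 0 < t \<Longrightarrow> v t = w t"
  shows "slow w"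
  using assms unfolding slow_def by simp

lemma slow_one: "slow (\<lambda>t. 1)"
  unfolding slow_def
proof (intro conjI allI impI)
  fix \<epsilon> :: real assume "0 < \<epsilon>"
  show "\<exists>C::real. \<forall>s>0. \<forall>t>0. 1 \<le> C * dst s t powr \<epsilon> * 1"
    using dst_ge_1 \<open>0 < \<epsilon>\<close> by (intro exI[of _ 1]) (auto intro!: ge_one_powr_ge_zero)
qed auto

lemma slow_powr:
  assumes w: "slow w"
  shows "slow (\<lambda>t. w t powr \<gamma>)"
proof -
  consider "\<gamma> = 0" | "0 < \<gamma>" | "0 < - \<gamma>" by linarith
  then show ?thesis
  proof cases
    case 1
    show ?thesis
    proof (rule slow_cong[OF slow_one])
      fix t :: real assume "0 < t"
      then have "0 < w t" by (rule slow_pos[OF w])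
      then show "1 = w t powr \<gamma>" using 1 by simp
    qed
  next
    case 2 then show ?thesis by (rule slow_powr_pos[OF w])
  next
    case 3
    show ?thesis
      by (rule slow_cong[OF slow_inverse[OF slow_powr_pos[OF w 3]]])
         (simp add: powr_minus[symmetric])
  qed
qed

text \<open>The square in the distance only doubles the exponent, which is arbitrary. The intended
  \<open>\<rho>\<close> is \<open>t \<mapsto> t * \<sigma> t\<close> with slowly varying
  \<open>\<sigma>\<close>, for which \<open>slow_times_id_dst\<close> provides the
  hypothesis.\<close>

lemma slow_compose:
  assumes a: "slow a" and \<rho>: "\<And>t. 0 < t \<Longrightarrow> 0 < \<rho> t"
    and A: "\<And>s t. 0 < s \<Longrightarrow> 0 < t \<Longrightarrow> dst (\<rho> s) (\<rho> t) \<le> A * (dst s t)\<^sup>2"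
  shows "slow (\<lambda>t. a (\<rho> t))"
  unfolding slow_def
proof (intro conjI allI impI)
  fix \<epsilon> :: real assume "0 < \<epsilon>"
  then have e: "0 < \<epsilon> / 2" by simp
  obtain C where C: "1 \<le> C" "\<And>s t. 0 < s \<Longrightarrow> 0 < t \<Longrightarrow> a s \<le> C * dst s t powr (\<epsilon> / 2) * a t"
    using slowE[OF a e] by blast
  have A0: "0 \<le> A"
    using A[of 1 1] dst_ge_1[OF \<rho>[of 1] \<rho>[of 1]] by (simp add: dst_self)
  show "\<exists>C. \<forall>s>0. \<forall>t>0. a (\<rho> s) \<le> C * dst s t powr \<epsilon> * a (\<rho> t)"
  proof (intro exI allI impI)
    fix s t :: real assume st: "0 < s" "0 < t"
    have p: "0 < dst s t" using dst_pos[OF st] .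
    have "dst (\<rho> s) (\<rho> t) powr (\<epsilon> / 2) \<le> (A * (dst s t)\<^sup>2) powr (\<epsilon> / 2)"
      using A[OF st] dst_pos[OF \<rho>[OF st(1)] \<rho>[OF st(2)]] e by (intro powr_mono2) auto
    also have "(dst s t)\<^sup>2 = dst s t powr 2" using p by simp
    also have "(A * dst s t powr 2) powr (\<epsilon> / 2) = A powr (\<epsilon> / 2) * dst s t powr \<epsilon>"
      using A0 by (simp add: powr_mult powr_powr)
    finally have 1: "dst (\<rho> s) (\<rho> t) powr (\<epsilon> / 2) \<le> A powr (\<epsilon> / 2) * dst s t powr \<epsilon>" .
    have "a (\<rho> s) \<le> C * dst (\<rho> s) (\<rho> t) powr (\<epsilon> / 2) * a (\<rho> t)"
      by (rule C(2)[OF \<rho>[OF st(1)] \<rho>[OF st(2)]])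
    also have "\<dots> \<le> C * (A powr (\<epsilon> / 2) * dst s t powr \<epsilon>) * a (\<rho> t)"
      using 1 C(1) slow_pos[OF a \<rho>[OF st(2)]] by (intro mult_right_mono mult_left_mono) auto
    finally show "a (\<rho> s) \<le> (C * A powr (\<epsilon> / 2)) * dst s t powr \<epsilon> * a (\<rho> t)"
      by (simp add: mult_ac)
  qed
qed (use slow_pos[OF a] \<rho> in auto)

lemma dst_powr_ratio:
  assumes "0 < u" "0 < t"
  shows "u \<le> t \<Longrightarrow> u powr \<gamma> = dst u t powr (- \<gamma>) * t powr \<gamma>"
    and "t \<le> u \<Longrightarrow> u powr (- \<gamma>) = dst u t powr (- \<gamma>) * t powr (- \<gamma>)"
  using assms by (simp_all add: dst_le dst_ge powr_divide powr_minus field_simps)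

text \<open>The ratio of the powers is \<open>dst u t powr (- \<gamma>)\<close>. Slow variation with
  exponent \<open>\<gamma> / 2\<close> gives back half of this decay, and the other half
  remains.\<close>

lemma slow_decay:
  assumes \<sigma>: "slow \<sigma>" and g: "0 < \<gamma>"
  obtains C where "1 \<le> C"
    "\<And>u t. 0 < u \<Longrightarrow> u \<le> t \<Longrightarrow> u powr \<gamma> * \<sigma> u \<le> C * dst u t powr (- (\<gamma> / 2)) * (t powr \<gamma> * \<sigma> t)"
    "\<And>u t. 0 < t \<Longrightarrow> t \<le> u \<Longrightarrow> u powr (- \<gamma>) * \<sigma> u \<le> C * dst u t powr (- (\<gamma> / 2)) * (t powr (- \<gamma>) * \<sigma> t)"
proof -
  have g2: "0 < \<gamma> / 2" using g by simp
  obtain C where C: "1 \<le> C" "\<And>s t. 0 < s \<Longrightarrow> 0 < t \<Longrightarrow> \<sigma> s \<le> C * dst s t powr (\<gamma> / 2) * \<sigma> t"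
    using slowE[OF \<sigma> g2] by blast
  have *: "dst u t powr (- \<gamma>) * x * \<sigma> u \<le> C * dst u t powr (- (\<gamma> / 2)) * (x * \<sigma> t)"
    if "0 < u" "0 < t" "0 \<le> x" for u t x
  proof -
    have "dst u t powr (- \<gamma>) * x * \<sigma> u \<le> dst u t powr (- \<gamma>) * x * (C * dst u t powr (\<gamma> / 2) * \<sigma> t)"
      using C(2)[OF that(1,2)] that by (intro mult_left_mono) auto
    also have "\<dots> = C * (dst u t powr (- \<gamma>) * dst u t powr (\<gamma> / 2)) * (x * \<sigma> t)"
      by (simp add: mult_ac)
    also have "dst u t powr (- \<gamma>) * dst u t powr (\<gamma> / 2) = dst u t powr (- (\<gamma> / 2))"
      by (simp add: powr_add[symmetric])
    finally show ?thesis .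
  qed
  show ?thesis
  proof (rule that[OF C(1)])
    show "u powr \<gamma> * \<sigma> u \<le> C * dst u t powr (- (\<gamma> / 2)) * (t powr \<gamma> * \<sigma> t)"
      if "0 < u" "u \<le> t" for u t
      using *[of u t "t powr \<gamma>"] dst_powr_ratio(1)[of u t \<gamma>] that by simp
    show "u powr (- \<gamma>) * \<sigma> u \<le> C * dst u t powr (- (\<gamma> / 2)) * (t powr (- \<gamma>) * \<sigma> t)"
      if "0 < t" "t \<le> u" for u t
      using *[of u t "t powr (- \<gamma>)"] dst_powr_ratio(2)[of u t \<gamma>] that by simp
  qed
qed

text \<open>Here the exponents decouple: pointwise power decay away from a single point bounds the
  norm over any \<open>S\<close> and in any exponent by the same height \<open>m\<close>.\<close>

lemma mn_decay:
  assumes q: "0 < q" and \<alpha>: "0 < \<alpha>" and t: "0 < t"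
    and le: "\<And>u. 0 < u \<Longrightarrow> u \<in> S \<Longrightarrow> f u \<le> m * ennreal (dst u t powr (- \<alpha>))"
  shows "mn q S f \<le> m * Pq \<alpha> q"
proof -
  have "mn q S f \<le> m * mn q UNIV (\<lambda>u. ennreal (dst u t powr (- \<alpha>)))"
    using q le by (intro mn_le_cmult) auto
  also have "\<dots> \<le> m * Pq \<alpha> q"
    using mn_dst_powr[OF q \<alpha> t] by (rule mult_left_mono) simp
  finally show ?thesis .
qed

section \<open>Growth of \<open>t \<mapsto> t \<sigma>(t)\<close> for slowly varying \<open>\<sigma>\<close>\<close>

lemma dst_mult_le:
  assumes "0 < a" "0 < b" "0 < c" "0 < d"
  shows "dst (a * b) (c * d) \<le> dst a c * dst b d"
proof -
  have "(a * b) / (c * d) = (a / c) * (b / d)" "(c * d) / (a * b) = (c / a) * (d / b)" by auto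
  moreover have "(a / c) * (b / d) \<le> dst a c * dst b d" "(c / a) * (d / b) \<le> dst a c * dst b d"
    using assms by (intro mult_mono dst_ge_ratio less_imp_le dst_pos divide_pos_pos; simp)+
  ultimately show ?thesis by (simp only: dst_def[of "a * b"] max.bounded_iff)
qed

lemma slow_dst:
  assumes w: "slow w" and e: "0 < \<epsilon>"
  obtains C where "1 \<le> C" "\<And>s t. 0 < s \<Longrightarrow> 0 < t \<Longrightarrow> dst (w s) (w t) \<le> C * dst s t powr \<epsilon>"
proof -
  obtain C where C: "1 \<le> C" "\<And>s t. 0 < s \<Longrightarrow> 0 < t \<Longrightarrow> w s \<le> C * dst s t powr \<epsilon> * w t"
    using slowE[OF w e] by blast
  show ?thesis
  proof (rule that[OF C(1)])
    fix s t :: real assume st: "0 < s" "0 < t"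
    show "dst (w s) (w t) \<le> C * dst s t powr \<epsilon>"
      using C(2)[OF st] C(2)[OF st(2,1)] slow_pos[OF w st(1)] slow_pos[OF w st(2)]
      by (simp add: dst_def[of "w s"] field_simps dst_commute[of t s])
  qed
qed

text \<open>On the logarithmic scale, multiplication by \<open>\<sigma>\<close> is a perturbation
  with arbitrarily small slope. The first bound takes slope 1 for it. The second takes slope 1/2, so
  that the perturbation can be absorbed; squares are the price of working with \<open>exp\<close> of
  the distance.\<close>

lemma slow_times_id_dst:
  assumes \<sigma>: "slow \<sigma>"
  obtains A where "1 \<le> A"
    "\<And>s t. 0 < s \<Longrightarrow> 0 < t \<Longrightarrow> dst (s * \<sigma> s) (t * \<sigma> t) \<le> A * (dst s t)\<^sup>2"
    "\<And>s t. 0 < s \<Longrightarrow> 0 < t \<Longrightarrow> dst s t \<le> A * (dst (s * \<sigma> s) (t * \<sigma> t))\<^sup>2"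
proof -
  obtain C where C: "1 \<le> C" "\<And>s t. 0 < s \<Longrightarrow> 0 < t \<Longrightarrow> dst (\<sigma> s) (\<sigma> t) \<le> C * dst s t powr 1"
    using slow_dst[OF \<sigma>, of 1] by auto
  obtain D where D: "1 \<le> D" "\<And>s t. 0 < s \<Longrightarrow> 0 < t \<Longrightarrow> dst (\<sigma> s) (\<sigma> t) \<le> D * dst s t powr (1 / 2)"
    using slow_dst[OF \<sigma>, of "1 / 2"] by auto
  define A where "A = C + D\<^sup>2"
  have "1 \<le> A" using C D by (simp add: A_def add_increasing2)
  moreover have "dst (s * \<sigma> s) (t * \<sigma> t) \<le> A * (dst s t)\<^sup>2" if st: "0 < s" "0 < t" for s t
  proof -
    have "dst (s * \<sigma> s) (t * \<sigma> t) \<le> dst s t * dst (\<sigma> s) (\<sigma> t)"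
      using slow_pos[OF \<sigma>] st by (intro dst_mult_le) auto
    also have "\<dots> \<le> dst s t * (C * dst s t powr 1)"
      using C(2)[OF st] dst_pos[OF st] by (intro mult_left_mono) auto
    also have "\<dots> = C * (dst s t)\<^sup>2"
      using dst_pos[OF st] by (simp add: power2_eq_square)
    also have "\<dots> \<le> A * (dst s t)\<^sup>2"
      by (intro mult_right_mono) (auto simp: A_def)
    finally show ?thesis .
  qed
  moreover have "dst s t \<le> A * (dst (s * \<sigma> s) (t * \<sigma> t))\<^sup>2" if st: "0 < s" "0 < t" for s t
  proof -
    let ?R = "dst (s * \<sigma> s) (t * \<sigma> t)"
    note pos = slow_pos[OF \<sigma> st(1)] slow_pos[OF \<sigma> st(2)] dst_pos[OF st]
    have R: "0 < ?R" using pos st by (intro dst_pos) auto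
    have "dst s t = dst ((s * \<sigma> s) * inverse (\<sigma> s)) ((t * \<sigma> t) * inverse (\<sigma> t))"
      using pos by (simp add: mult.assoc)
    also have "\<dots> \<le> ?R * dst (inverse (\<sigma> s)) (inverse (\<sigma> t))"
      using pos st by (intro dst_mult_le) auto
    also have "dst (inverse (\<sigma> s)) (inverse (\<sigma> t)) = dst (\<sigma> s) (\<sigma> t)"
      by (simp add: dst_def max.commute divide_inverse mult.commute)
    also have "?R * dst (\<sigma> s) (\<sigma> t) \<le> ?R * (D * dst s t powr (1 / 2))"
      using D(2)[OF st] R by (intro mult_left_mono) auto
    \<comment> \<open>The unknown distance occurs on both sides, but on the right only under a
      square root, which can be cancelled. Squaring afterwards produces the constant
      \<open>D\<^sup>2\<close> contained in \<open>A\<close>.\<close>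
    finally have "dst s t \<le> (?R * D) * sqrt (dst s t)"
      using pos by (simp add: powr_half_sqrt mult.assoc)
    then have "sqrt (dst s t) * sqrt (dst s t) \<le> (?R * D) * sqrt (dst s t)"
      using pos by simp
    then have "sqrt (dst s t) \<le> ?R * D"
      using pos by (subst (asm) mult_le_cancel_right) (auto simp: not_less)
    then have "(sqrt (dst s t))\<^sup>2 \<le> (?R * D)\<^sup>2"
      using pos by (intro power_mono) auto
    then have "dst s t \<le> D\<^sup>2 * ?R\<^sup>2"
      using pos by (simp add: power_mult_distrib mult.commute)
    also have "\<dots> \<le> A * ?R\<^sup>2"
      using C by (intro mult_right_mono) (auto simp: A_def)
    finally show ?thesis .
  qed
  ultimately show ?thesis using that by blast
qed

text \<open>Without continuity of \<open>\<sigma>\<close> there is no intermediate value theorem.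
  The substitute is the supremum of the points with \<open>t * \<sigma> t \<le> u\<close>: close
  below it the value is at most \<open>u\<close>, beyond it the value exceeds \<open>u\<close>, and
  a bounded move of \<open>t\<close> changes the value by a bounded factor.\<close>

lemma slow_times_id_surj:
  assumes \<sigma>: "slow \<sigma>"
  obtains B where "\<And>u. 0 < u \<Longrightarrow> \<exists>t>0. dst (t * \<sigma> t) u \<le> B"
proof -
  obtain A where A: "1 \<le> A"
    "\<And>s t. 0 < s \<Longrightarrow> 0 < t \<Longrightarrow> dst (s * \<sigma> s) (t * \<sigma> t) \<le> A * (dst s t)\<^sup>2"
    using slow_times_id_dst[OF \<sigma>] by metis
  obtain C where C: "1 \<le> C"
    "\<And>u t. 0 < u \<Longrightarrow> u \<le> t \<Longrightarrow> u powr 1 * \<sigma> u \<le> C * dst u t powr (- (1 / 2)) * (t powr 1 * \<sigma> t)"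
    using slow_decay[OF \<sigma>, of 1] by (metis zero_less_one)
  have C': "u * \<sigma> u \<le> C * sqrt (u / t) * (t * \<sigma> t)" if "0 < u" "u \<le> t" for u t
  proof -
    have "dst u t powr (- (1 / 2)) = sqrt (u / t)"
      using that by (simp add: dst_le powr_minus powr_half_sqrt real_sqrt_divide)
    then show ?thesis using C(2)[OF that] that by simp
  qed
  have pos: "0 < t * \<sigma> t" if "0 < t" for t using slow_pos[OF \<sigma> that] that by simp
  show ?thesis
  proof (rule that)
    fix u :: real assume u: "0 < u"
    define X where "X = {t. 0 < t \<and> t * \<sigma> t \<le> u}"
    let ?r = "1 * \<sigma> 1"
    have r: "0 < ?r" using pos[of 1] by simp
    have "\<exists>t. t \<in> X"
    proof -
      \<comment> \<open>For \<open>t \<le> 1\<close> the decay bound reads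
        \<open>t * \<sigma> t \<le> C * sqrt t * ?r\<close>. The witness makes the right-hand side
        equal to \<open>u\<close>, unless capped at 1.\<close>
      define t where "t = min 1 ((u / (C * ?r))\<^sup>2)"
      have t: "0 < t" "t \<le> 1" using u C(1) r by (auto simp: t_def)
      have "t * \<sigma> t \<le> C * sqrt (t / 1) * ?r" using C'[OF t] by simp
      also have "sqrt (t / 1) \<le> u / (C * ?r)"
        using u C(1) r by (intro real_le_lsqrt) (auto simp: t_def)
      finally have "t * \<sigma> t \<le> u" using u C(1) r by (simp add: mult_left_mono field_simps)
      then show ?thesis using t by (auto simp: X_def)
    qed
    \<comment> \<open>The same bound between 1 and \<open>t \<ge> 1\<close> shows that
      \<open>t * \<sigma> t\<close> is at least \<open>?r * sqrt t / C\<close>.\<close>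
    moreover have "bdd_above X"
    proof (rule bdd_aboveI)
      fix t assume "t \<in> X"
      then have t: "0 < t" "t * \<sigma> t \<le> u" by (auto simp: X_def)
      show "t \<le> max 1 ((C * u / ?r)\<^sup>2)"
      proof (cases "t \<le> 1")
        case False
        then have "?r \<le> C * sqrt (1 / t) * (t * \<sigma> t)" using C'[of 1 t] by simp
        also have "\<dots> \<le> C * sqrt (1 / t) * u" using t C(1) by (intro mult_left_mono) auto
        finally have "?r * sqrt t \<le> C * u"
          using t by (simp add: real_sqrt_divide field_simps)
        then have "sqrt t \<le> C * u / ?r" using r by (simp add: field_simps)
        then have "t \<le> (C * u / ?r)\<^sup>2"
          by (meson t(1) less_imp_le sqrt_le_D)
        then show ?thesis by simp
      qed simp
    qed
    ultimately have X: "X \<noteq> {}" "bdd_above X" by auto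
    have S: "0 < Sup X"
    proof -
      obtain t where "t \<in> X" using X by auto
      then show ?thesis using cSup_upper[OF _ X(2), of t] by (auto simp: X_def)
    qed
    then have "Sup X / 2 < Sup X" by simp
    then obtain t where t: "t \<in> X" "Sup X / 2 < t"
      using less_cSupD[OF X(1), of "Sup X / 2"] by auto
    have tS: "t \<le> Sup X" using cSup_upper[OF t(1) X(2)] .
    \<comment> \<open>\<open>?T\<close> lies outside \<open>X\<close>, so its value exceeds
      \<open>u\<close>. The point \<open>t\<close> in \<open>X\<close> is within a factor 4 of
      \<open>?T\<close>, so the value at \<open>?T\<close> is at most \<open>A * 4\<^sup>2\<close>
      times the value at \<open>t\<close>, which is at most \<open>u\<close>.\<close>
    let ?T = "2 * Sup X"
    have "?T \<notin> X" using cSup_upper[OF _ X(2), of ?T] S by auto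
    then have 1: "u < ?T * \<sigma> ?T" using S by (auto simp: X_def not_le)
    have t0: "0 < t" "t * \<sigma> t \<le> u" using t by (auto simp: X_def)
    have "dst t ?T \<le> 4" using t tS t0 S by (simp add: dst_le field_simps)
    then have "(dst t ?T)\<^sup>2 \<le> 4\<^sup>2"
      using dst_pos[of t ?T] t0 S by (intro power_mono) auto
    then have "dst (t * \<sigma> t) (?T * \<sigma> ?T) \<le> A * 16"
      using A(1) by (intro order_trans[OF A(2)] mult_left_mono) (use t0 S in auto)
    then have "?T * \<sigma> ?T / (t * \<sigma> t) \<le> A * 16"
      using dst_ge_ratio(2)[of "?T * \<sigma> ?T" "t * \<sigma> t"] by linarith
    then have "?T * \<sigma> ?T \<le> A * 16 * (t * \<sigma> t)"
      using pos[OF t0(1)] by (simp add: pos_divide_le_eq)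
    also have "\<dots> \<le> A * 16 * u" using t0 A(1) by (intro mult_left_mono) auto
    finally have "dst (?T * \<sigma> ?T) u \<le> A * 16"
      using 1 u by (simp add: dst_ge pos_divide_le_eq)
    then show "\<exists>t>0. dst (t * \<sigma> t) u \<le> A * 16"
      using S by (intro exI[of _ ?T]) auto
  qed
qed

section \<open>Integral operators with bounded column sums\<close>

text \<open>After raising to the power \<open>q\<close> the inequality is linear in
  \<open>G\<close>, so Fubini and the bound on the integrals over \<open>t\<close> give the result
  even for \<open>q < 1\<close>. \<open>F\<close> is left arbitrary since it will be a maximal
  function.\<close>

lemma schur_test:
  assumes q: "0 < q" "q \<noteq> top"
    and [measurable]: "case_prod k \<in> borel_measurable (borel \<Otimes>\<^sub>M borel)" "G \<in> borel_measurable borel"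
    and B: "\<And>u. 0 < u \<Longrightarrow> (\<integral>\<^sup>+t. k t u \<partial>haar) \<le> B"
    and FG: "\<And>t. 0 < t \<Longrightarrow> enn_powr (F t) (enn2real q) \<le> C * (\<integral>\<^sup>+u. k t u * enn_powr (G u) (enn2real q) \<partial>haar)"
  shows "mn q {0<..} F \<le> enn_powr (C * B) (1 / enn2real q) * mn q {0<..} G"
proof -
  interpret pair_sigma_finite haar haar by (rule pair_sigma_finite_haar)
  define p where "p = enn2real q"
  have p: "0 < p" using q by (simp add: enn2real_pos p_def)
  have [measurable]: "case_prod k \<in> borel_measurable (haar \<Otimes>\<^sub>M haar)"
    by (simp cong: measurable_cong_sets sets_pair_measure_cong)
  have "(\<integral>\<^sup>+t. enn_powr (F t) p * indicator {0<..} t \<partial>haar)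
     \<le> (\<integral>\<^sup>+t. C * (\<integral>\<^sup>+u. k t u * enn_powr (G u) p \<partial>haar) \<partial>haar)"
    using FG by (intro nn_integral_mono) (auto simp: indicator_def p_def)
  also have "\<dots> = C * (\<integral>\<^sup>+t. (\<integral>\<^sup>+u. k t u * enn_powr (G u) p \<partial>haar) \<partial>haar)"
    by (rule nn_integral_cmult) measurable
  also have "(\<integral>\<^sup>+t. (\<integral>\<^sup>+u. k t u * enn_powr (G u) p \<partial>haar) \<partial>haar)
     = (\<integral>\<^sup>+u. (\<integral>\<^sup>+t. k t u * enn_powr (G u) p \<partial>haar) \<partial>haar)"
    by (rule Fubini'[symmetric]) measurable
  also have "\<dots> = (\<integral>\<^sup>+u. (\<integral>\<^sup>+t. k t u \<partial>haar) * enn_powr (G u) p \<partial>haar)"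
    by (intro nn_integral_cong nn_integral_multc) measurable
  also have "\<dots> \<le> (\<integral>\<^sup>+u. B * (enn_powr (G u) p * indicator {0<..} u) \<partial>haar)"
    using AE_haar_pos
    by (intro nn_integral_mono_AE, eventually_elim) (auto intro: mult_right_mono B)
  also have "\<dots> = B * (\<integral>\<^sup>+u. enn_powr (G u) p * indicator {0<..} u \<partial>haar)"
    by (rule nn_integral_cmult) measurable
  finally have "(\<integral>\<^sup>+t. enn_powr (F t) p * indicator {0<..} t \<partial>haar)
     \<le> (C * B) * (\<integral>\<^sup>+u. enn_powr (G u) p * indicator {0<..} u \<partial>haar)"
    by (simp add: mult_left_mono mult.assoc)
  then have "enn_powr (\<integral>\<^sup>+t. enn_powr (F t) p * indicator {0<..} t \<partial>haar) (1 / p)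
     \<le> enn_powr ((C * B) * (\<integral>\<^sup>+u. enn_powr (G u) p * indicator {0<..} u \<partial>haar)) (1 / p)"
    using p by (intro enn_powr_mono) auto
  then show ?thesis
    using q(2) p by (simp add: mn_def p_def[symmetric] enn_powr_mult)
qed

lemma ennreal_inverse_mult_le_iff:
  fixes c z y :: ennreal
  assumes "0 < c" "c < top"
  shows "(1 / c) * z \<le> y \<longleftrightarrow> z \<le> c * y"
proof -
  have c: "(1 / c) * c = 1" "c * (1 / c) = 1"
    using assms by (simp_all add: ennreal_divide_times ennreal_times_divide)
  show ?thesis
    using mult_left_mono[of "(1 / c) * z" y c] mult_left_mono[of z "c * y" "1 / c"]
    by (auto simp: mult.assoc[symmetric] c)
qed

lemma ennreal_le_divideI:
  fixes x y m :: ennreal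
  assumes "m * x \<le> y" "0 < m" "m < top"
  shows "x \<le> (1 / m) * y"
proof -
  have "(1 / m) * m = 1" using assms by (simp add: ennreal_divide_times)
  then show ?thesis
    using mult_left_mono[OF assms(1), of "1 / m"] by (simp add: mult.assoc[symmetric])
qed

lemma ennreal_inverse_less_top:
  fixes m :: ennreal
  shows "0 < m \<Longrightarrow> 1 / m < top"
  by (cases m) (auto simp: divide_ennreal simp flip: ennreal_1)

text \<open>\<open>F t\<close> is bounded by the average of \<open>D * G\<close> over the points
  related to \<open>t\<close>. The lower bound on rows makes the average meaningful, and the upper
  bound on columns limits how often each \<open>G u\<close> is counted. For \<open>q = top\<close> a
  row of positive measure must meet the set where \<open>G\<close> obeys its essential
  bound.\<close>

lemma relation_bound:
  assumes q: "0 < q" and m: "0 < m" "m < top" and B: "B < top" and D: "D < top"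
    and [measurable]: "Measurable.pred (borel \<Otimes>\<^sub>M borel) (case_prod R)"
    and rows: "\<And>t. 0 < t \<Longrightarrow> m \<le> emeasure haar {u. 0 < u \<and> R t u}"
    and cols: "\<And>u. 0 < u \<Longrightarrow> emeasure haar {t. 0 < t \<and> R t u} \<le> B"
  obtains C where "C < top"
    "\<And>F G. G \<in> borel_measurable borel \<Longrightarrow>
        (\<And>t u. 0 < t \<Longrightarrow> 0 < u \<Longrightarrow> R t u \<Longrightarrow> F t \<le> D * G u) \<Longrightarrow>
        mn q {0<..} F \<le> C * mn q {0<..} G"
proof (cases "q = top")
  case True
  show ?thesis
  proof (rule that[OF D])
    fix F G :: "real \<Rightarrow> ennreal"
    assume le: "\<And>t u. 0 < t \<Longrightarrow> 0 < u \<Longrightarrow> R t u \<Longrightarrow> F t \<le> D * G u"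
    let ?N = "mn top {0<..} G"
    have "F t \<le> D * ?N" if t: "0 < t" for t
    proof (rule ccontr)
      assume neg: "\<not> F t \<le> D * ?N"
      have "AE u in haar. \<not> (0 < u \<and> R t u)"
        using mn_top_AE[of "{0<..}" G]
      proof eventually_elim
        case (elim u)
        then show ?case
          using le[OF t, of u] neg by (auto dest: mult_left_mono[of _ _ D] intro: order_trans)
      qed
      then have "emeasure haar {u. 0 < u \<and> R t u} = 0"
        by (subst (asm) AE_iff_measurable[of "{u. 0 < u \<and> R t u}"]) auto
      then show False using rows[OF t] m by simp
    qed
    then show "mn q {0<..} F \<le> D * mn q {0<..} G"
      unfolding True by (intro mn_top_le) auto
  qed
next
  case False
  define p where "p = enn2real q"
  have p: "0 < p" using q False by (simp add: enn2real_pos p_def)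
  define k where "k = (\<lambda>t u. indicator {u. 0 < u \<and> R t u} u * indicator {0<..} t :: ennreal)"
  define c where "c = (1 / m) * enn_powr D p"
  have [measurable]: "case_prod k \<in> borel_measurable (borel \<Otimes>\<^sub>M borel)"
  proof -
    have "case_prod k = (\<lambda>x. if 0 < snd x \<and> case_prod R x \<and> 0 < fst x then 1 else 0)"
      by (auto simp: k_def indicator_def)
    then show ?thesis by simp
  qed
  have fin: "enn_powr (c * B) (1 / p) < top"
    using B D m unfolding c_def
    by (intro enn_powr_lt_top) (auto simp: ennreal_mult_less_top ennreal_inverse_less_top enn_powr_lt_top)
  show ?thesis
  proof (rule that[OF fin])
    fix F G :: "real \<Rightarrow> ennreal"
    assume [measurable]: "G \<in> borel_measurable borel"
    assume le: "\<And>t u. 0 < t \<Longrightarrow> 0 < u \<Longrightarrow> R t u \<Longrightarrow> F t \<le> D * G u"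
    show "mn q {0<..} F \<le> enn_powr (c * B) (1 / p) * mn q {0<..} G"
      unfolding p_def
    proof (rule schur_test[OF q False, where k = k])
      fix u :: real assume u: "0 < u"
      have "(\<integral>\<^sup>+t. k t u \<partial>haar) = (\<integral>\<^sup>+t. indicator {t. 0 < t \<and> R t u} t \<partial>haar)"
        using u by (intro nn_integral_cong) (auto simp: k_def indicator_def)
      also have "\<dots> = emeasure haar {t. 0 < t \<and> R t u}"
        by (rule nn_integral_indicator) measurable
      finally show "(\<integral>\<^sup>+t. k t u \<partial>haar) \<le> B" using cols[OF u] by simp
    next
      fix t :: real assume t: "0 < t"
      have [measurable]: "Measurable.pred borel (R t)"
        by measurable
      \<comment> \<open>The averaging step: the constant value at \<open>t\<close> is spread over
        the row of \<open>t\<close>, where the pointwise hypothesis applies.\<close>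
      have "enn_powr (F t) p * m \<le> enn_powr (F t) p * emeasure haar {u. 0 < u \<and> R t u}"
        using rows[OF t] by (rule mult_left_mono) simp
      also have "\<dots> = (\<integral>\<^sup>+u. enn_powr (F t) p * indicator {u. 0 < u \<and> R t u} u \<partial>haar)"
        by (rule nn_integral_cmult_indicator[symmetric]) simp
      also have "\<dots> \<le> (\<integral>\<^sup>+u. enn_powr D p * (k t u * enn_powr (G u) p) \<partial>haar)"
      proof (rule nn_integral_mono)
        fix u
        show "enn_powr (F t) p * indicator {u. 0 < u \<and> R t u} u \<le> enn_powr D p * (k t u * enn_powr (G u) p)"
        proof (cases "0 < u \<and> R t u")
          case True
          then have "enn_powr (F t) p \<le> enn_powr (D * G u) p"
            using le[OF t] p by (intro enn_powr_mono) auto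
          then show ?thesis using True t p by (simp add: k_def enn_powr_mult)
        qed simp
      qed
      also have "\<dots> = enn_powr D p * (\<integral>\<^sup>+u. k t u * enn_powr (G u) p \<partial>haar)"
        by (rule nn_integral_cmult) measurable
      finally have "enn_powr (F t) p \<le> (1 / m) * (enn_powr D p * (\<integral>\<^sup>+u. k t u * enn_powr (G u) p \<partial>haar))"
        using m by (intro ennreal_le_divideI) (simp_all add: mult.commute)
      then show "enn_powr (F t) (enn2real q) \<le> c * (\<integral>\<^sup>+u. k t u * enn_powr (G u) (enn2real q) \<partial>haar)"
        by (simp add: c_def p_def mult.assoc)
    qed measurable
  qed
qed

section \<open>A maximal function\<close>

text \<open>
  The norms of \<open>Mx \<beta> M\<close> and \<open>M\<close> are equivalent if \<open>M\<close> varies little on dyadic blocks. As \<open>Mx\<close> bounds \<open>M\<close>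
  pointwise with a power loss, it turns Hardy inequalities between different exponents into
  pointwise estimates.
\<close>

definition Mx :: "real \<Rightarrow> (real \<Rightarrow> ennreal) \<Rightarrow> real \<Rightarrow> ennreal" where
  "Mx \<beta> M t = (SUP u\<in>{0<..}. ennreal (dst u t powr (- \<beta>)) * M u)"

lemma ennreal_powr_cancel:
  assumes "0 < x"
  shows "ennreal (x powr \<beta>) * (ennreal (x powr (- \<beta>)) * z) = z"
proof -
  have "x powr \<beta> * x powr (- \<beta>) = 1"
    using assms by (simp add: powr_add[symmetric])
  then have "ennreal (x powr \<beta>) * ennreal (x powr (- \<beta>)) = 1"
    by (simp add: ennreal_mult'[symmetric])
  then show ?thesis by (simp add: mult.assoc[symmetric])
qed

lemma Mx_ge:
  assumes "0 < u" "0 < t"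
  shows "M u \<le> ennreal (dst u t powr \<beta>) * Mx \<beta> M t"
proof -
  have "ennreal (dst u t powr (- \<beta>)) * M u \<le> Mx \<beta> M t"
    unfolding Mx_def using assms by (intro SUP_upper) auto
  then have "ennreal (dst u t powr \<beta>) * (ennreal (dst u t powr (- \<beta>)) * M u) \<le> ennreal (dst u t powr \<beta>) * Mx \<beta> M t"
    by (rule mult_left_mono) simp
  then show ?thesis using ennreal_powr_cancel[OF dst_pos[OF assms]] by simp
qed

text \<open>The maximal function inherits a power modulus from the triangle inequality of
  \<open>dst\<close>. This lets an estimate by \<open>Mx\<close> at one point be inserted into
  another estimate centred elsewhere.\<close>

lemma Mx_shift:
  assumes st: "0 < s" "0 < t" and \<beta>: "0 \<le> \<beta>"
  shows "Mx \<beta> M s \<le> ennreal (dst s t powr \<beta>) * Mx \<beta> M t"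
  unfolding Mx_def[of \<beta> M s]
proof (rule SUP_least)
  fix u :: real assume "u \<in> {0<..}"
  then have u: "0 < u" by simp
  have "dst u t powr \<beta> \<le> (dst u s * dst s t) powr \<beta>"
    using dst_triangle[OF u st] dst_pos[OF u st(2)] \<beta> by (intro powr_mono2) auto
  also have "\<dots> = dst u s powr \<beta> * dst s t powr \<beta>"
    using dst_pos[OF u st(1)] dst_pos[OF st] by (simp add: powr_mult)
  finally have "dst u s powr (- \<beta>) * dst u t powr \<beta> \<le> dst u s powr (- \<beta>) * (dst u s powr \<beta> * dst s t powr \<beta>)"
    by (intro mult_left_mono) auto
  also have "\<dots> = dst s t powr \<beta>"
    using dst_pos[OF u st(1)] by (simp add: mult.assoc[symmetric] powr_add[symmetric])
  finally have le: "dst u s powr (- \<beta>) * dst u t powr \<beta> \<le> dst s t powr \<beta>" .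
  have "ennreal (dst u s powr (- \<beta>)) * M u \<le> ennreal (dst u s powr (- \<beta>)) * (ennreal (dst u t powr \<beta>) * Mx \<beta> M t)"
    using Mx_ge[OF u st(2)] by (intro mult_left_mono) auto
  also have "\<dots> = ennreal (dst u s powr (- \<beta>) * dst u t powr \<beta>) * Mx \<beta> M t"
    by (simp add: ennreal_mult' mult.assoc)
  also have "\<dots> \<le> ennreal (dst s t powr \<beta>) * Mx \<beta> M t"
    using le by (intro mult_right_mono ennreal_leI) auto
  finally show "ennreal (dst u s powr (- \<beta>)) * M u \<le> ennreal (dst s t powr \<beta>) * Mx \<beta> M t" .
qed

text \<open>For finite \<open>q\<close>, the power of a term of the supremum at \<open>u\<close> is
  bounded by its average over the block \<open>{u<..<2 * u}\<close>, because both \<open>M\<close>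
  and the kernel change there only by bounded factors. The supremum thus becomes an integral with
  kernel \<open>dst u t powr (- (\<beta> * p))\<close>, to which the Schur test applies.\<close>

lemma mn_Mx:
  assumes q: "0 < q" and \<beta>: "0 < \<beta>" and D: "D < top"
  obtains C where "C < top"
    "\<And>M. M \<in> borel_measurable borel \<Longrightarrow>
       (\<And>u v. 0 < u \<Longrightarrow> 0 < v \<Longrightarrow> dst u v \<le> 2 \<Longrightarrow> M u \<le> D * M v) \<Longrightarrow>
       mn q {0<..} (Mx \<beta> M) \<le> C * mn q {0<..} M"
proof (cases "q = top")
  case True
  show ?thesis
  proof (rule that[OF D])
    fix M :: "real \<Rightarrow> ennreal"
    assume [measurable]: "M \<in> borel_measurable borel"
    assume mod: "\<And>u v. 0 < u \<Longrightarrow> 0 < v \<Longrightarrow> dst u v \<le> 2 \<Longrightarrow> M u \<le> D * M v"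
    \<comment> \<open>\<open>Mx\<close> takes a genuine supremum, so the essential bound on
      \<open>M\<close> must first become a bound at every point; comparison within a dyadic block
      does this.\<close>
    have M: "M u \<le> D * mn top {0<..} M" if u: "0 < u" for u
    proof -
      have "Lq top * M u \<le> mn top {0<..} (\<lambda>v. D * M v)"
        using u by (intro mn_ge[where t = u]) (auto intro!: mod simp: dst_le pos_divide_le_eq)
      also have "\<dots> = D * mn top {0<..} M"
        by (rule mn_cmult) auto
      finally show ?thesis by (simp add: Lq_def)
    qed
    have "Mx \<beta> M t \<le> D * mn top {0<..} M" if t: "0 < t" for t
      unfolding Mx_def
    proof (rule SUP_least)
      fix u :: real assume "u \<in> {0<..}"
      then have u: "0 < u" by simp
      have "dst u t powr (- \<beta>) \<le> dst u t powr 0"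
        using dst_ge_1[OF u t] \<beta> by (intro powr_mono) auto
      then have "ennreal (dst u t powr (- \<beta>)) \<le> 1"
        using dst_ge_1[OF u t] by (simp split: if_splits)
      then have "ennreal (dst u t powr (- \<beta>)) * M u \<le> 1 * M u" by (rule mult_right_mono) simp
      then show "ennreal (dst u t powr (- \<beta>)) * M u \<le> D * mn top {0<..} M"
        using M[OF u] by simp
    qed
    then show "mn q {0<..} (Mx \<beta> M) \<le> D * mn q {0<..} M"
      unfolding True by (intro mn_top_le) auto
  qed
next
  case False
  define p where "p = enn2real q"
  have p: "0 < p" using q False by (simp add: enn2real_pos p_def)
  define k where "k = (\<lambda>t u. ennreal (dst u t powr (- (\<beta> * p))))"
  \<comment> \<open>\<open>ln 2\<close> is the measure of the averaging block,
    \<open>2 powr (\<beta> * p)\<close> the variation of the kernel over it, and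
    \<open>enn_powr D p\<close> the variation of \<open>M\<close>.\<close>
  define c where "c = (1 / ennreal (ln 2)) * (ennreal (2 powr (\<beta> * p)) * enn_powr D p)"
  define B where "B = ennreal (2 / (\<beta> * p))"
  have fin: "enn_powr (c * B) (1 / p) < top"
    using D unfolding c_def B_def
    by (intro enn_powr_lt_top) (auto simp: ennreal_mult_less_top ennreal_inverse_less_top enn_powr_lt_top)
  show ?thesis
  proof (rule that[OF fin])
    fix M :: "real \<Rightarrow> ennreal"
    assume M[measurable]: "M \<in> borel_measurable borel"
    assume mod: "\<And>u v. 0 < u \<Longrightarrow> 0 < v \<Longrightarrow> dst u v \<le> 2 \<Longrightarrow> M u \<le> D * M v"
    have [measurable]: "case_prod k \<in> borel_measurable (borel \<Otimes>\<^sub>M borel)"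
      unfolding k_def by measurable
    show "mn q {0<..} (Mx \<beta> M) \<le> enn_powr (c * B) (1 / p) * mn q {0<..} M"
      unfolding p_def
    proof (rule schur_test[OF q False, where k = k])
      fix u :: real assume u: "0 < u"
      show "(\<integral>\<^sup>+t. k t u \<partial>haar) \<le> B"
        unfolding k_def B_def dst_commute[of u] using haar_kernel[of "\<beta> * p" u] \<beta> p u by simp
    next
      fix t :: real assume t: "0 < t"
      define J where "J = (\<integral>\<^sup>+u. k t u * enn_powr (M u) p \<partial>haar)"
      have "ennreal (dst u t powr (- \<beta>)) * M u \<le> enn_powr (c * J) (1 / p)" if u: "0 < u" for u
      proof -
        let ?x = "enn_powr (ennreal (dst u t powr (- \<beta>)) * M u) p"
        have "?x * ennreal (ln 2) = ?x * emeasure haar {u<..<2 * u}"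
          using u by (simp add: emeasure_haar_Ioo)
        also have "\<dots> = (\<integral>\<^sup>+v. ?x * indicator {u<..<2 * u} v \<partial>haar)"
          by (rule nn_integral_cmult_indicator[symmetric]) simp
        also have "\<dots> \<le> (\<integral>\<^sup>+v. (ennreal (2 powr (\<beta> * p)) * enn_powr D p) * (k t v * enn_powr (M v) p) \<partial>haar)"
        proof (rule nn_integral_mono)
          fix v
          show "?x * indicator {u<..<2 * u} v \<le> (ennreal (2 powr (\<beta> * p)) * enn_powr D p) * (k t v * enn_powr (M v) p)"
          proof (cases "v \<in> {u<..<2 * u}")
            case True
            then have v: "0 < v" "dst u v \<le> 2" using u by (auto simp: dst_le pos_divide_le_eq)
            have "dst v t \<le> dst v u * dst u t" by (rule dst_triangle[OF v(1) u t])
            also have "\<dots> \<le> 2 * dst u t"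
              using v(2) dst_pos[OF u t] by (intro mult_right_mono) (auto simp: dst_commute)
            finally have "dst v t powr (\<beta> * p) \<le> (2 * dst u t) powr (\<beta> * p)"
              using dst_pos[OF v(1) t] \<beta> p by (intro powr_mono2) auto
            then have "dst v t powr (\<beta> * p) \<le> 2 powr (\<beta> * p) * dst u t powr (\<beta> * p)"
              using dst_pos[OF u t] by (simp add: powr_mult)
            then have "dst u t powr (- (\<beta> * p)) \<le> 2 powr (\<beta> * p) * dst v t powr (- (\<beta> * p))"
              using dst_pos[OF u t] dst_pos[OF v(1) t] by (simp add: powr_minus field_simps)
            then have 1: "ennreal (dst u t powr (- (\<beta> * p))) \<le> ennreal (2 powr (\<beta> * p)) * k t v"
              by (simp add: k_def ennreal_mult'[symmetric] ennreal_leI)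
            have 2: "enn_powr (M u) p \<le> enn_powr D p * enn_powr (M v) p"
              using enn_powr_mono[OF mod[OF u v] p] p by (simp add: enn_powr_mult)
            have "?x = ennreal (dst u t powr (- (\<beta> * p))) * enn_powr (M u) p"
              using p by (simp add: enn_powr_mult enn_powr_ennreal powr_powr)
            also have "\<dots> \<le> (ennreal (2 powr (\<beta> * p)) * k t v) * (enn_powr D p * enn_powr (M v) p)"
              by (intro mult_mono 1 2) auto
            finally show ?thesis using True by (simp add: mult_ac)
          qed simp
        qed
        also have "\<dots> = (ennreal (2 powr (\<beta> * p)) * enn_powr D p) * J"
          unfolding J_def by (rule nn_integral_cmult) (simp add: k_def)
        finally have "?x \<le> (1 / ennreal (ln 2)) * ((ennreal (2 powr (\<beta> * p)) * enn_powr D p) * J)"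
          by (intro ennreal_le_divideI) (simp_all add: mult.commute)
        then have "?x \<le> c * J" by (simp only: c_def mult.assoc)
        then have "enn_powr ?x (1 / p) \<le> enn_powr (c * J) (1 / p)"
          using p by (intro enn_powr_mono) auto
        then show ?thesis using p by (simp add: enn_powr_powr)
      qed
      then have "Mx \<beta> M t \<le> enn_powr (c * J) (1 / p)"
        unfolding Mx_def by (intro SUP_least) auto
      then have "enn_powr (Mx \<beta> M t) p \<le> enn_powr (enn_powr (c * J) (1 / p)) p"
        using p by (intro enn_powr_mono) auto
      then show "enn_powr (Mx \<beta> M t) (enn2real q) \<le> c * (\<integral>\<^sup>+u. k t u * enn_powr (M u) (enn2real q) \<partial>haar)"
        using p by (simp add: enn_powr_powr J_def p_def)
    qed (use M in measurable)
  qed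
qed

section \<open>Change of variables\<close>

text \<open>As \<open>\<rho>\<close> is only known to be Borel, no Jacobian is at hand. The norms
  are compared through relations \<open>dst (\<rho> t) u < K\<close> with fixed \<open>K\<close>: on
  related points \<open>G (\<rho> t)\<close> and \<open>G u\<close> are comparable by the growth
  hypothesis on \<open>G\<close>, and \<open>relation_bound\<close> reduces the claim to the
  measures of rows and columns.\<close>

lemma change_of_variables:
  assumes q: "0 < q" and \<sigma>: "slow \<sigma>" and [measurable]: "\<sigma> \<in> borel_measurable borel"
    and \<kappa>: "0 \<le> \<kappa>" and D: "D < top"
  defines "\<rho> \<equiv> \<lambda>t. t * \<sigma> t"
  obtains C where "C < top"
    "\<And>G. G \<in> borel_measurable borel \<Longrightarrow>
       (\<And>u v. 0 < u \<Longrightarrow> 0 < v \<Longrightarrow> G u \<le> D * ennreal (dst u v powr \<kappa>) * G v) \<Longrightarrow>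
       mn q {0<..} (\<lambda>t. G (\<rho> t)) \<le> C * mn q {0<..} G \<and>
       mn q {0<..} G \<le> C * mn q {0<..} (\<lambda>t. G (\<rho> t))"
proof -
  have [measurable]: "\<rho> \<in> borel_measurable borel" unfolding \<rho>_def by measurable
  have pos: "0 < \<rho> t" if "0 < t" for t using slow_pos[OF \<sigma> that] that by (simp add: \<rho>_def)
  obtain A where A: "1 \<le> A"
    "\<And>s t. 0 < s \<Longrightarrow> 0 < t \<Longrightarrow> dst (\<rho> s) (\<rho> t) \<le> A * (dst s t)\<^sup>2"
    "\<And>s t. 0 < s \<Longrightarrow> 0 < t \<Longrightarrow> dst s t \<le> A * (dst (\<rho> s) (\<rho> t))\<^sup>2"
    unfolding \<rho>_def using slow_times_id_dst[OF \<sigma>] by metis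
  obtain B where B: "\<And>u. 0 < u \<Longrightarrow> \<exists>t>0. dst (\<rho> t) u \<le> B"
    unfolding \<rho>_def using slow_times_id_surj[OF \<sigma>] by metis
  have B1: "1 \<le> B" using B[of 1] dst_ge_1[OF pos zero_less_one] by fastforce
  \<comment> \<open>A point whose image is within \<open>B\<close> of \<open>u\<close>, moved by a
    factor at most 2, still has its image within \<open>A * 2\<^sup>2 * B\<close> of
    \<open>u\<close>; the added 1 makes this strict.\<close>
  define L where "L = 4 * A * B + 1"
  have "0 < A * B" using A B1 by simp
  then have L: "1 < L" "0 < L" unfolding L_def by auto
  have meas_le: "emeasure haar S \<le> ennreal (ln (K\<^sup>2))"
    if K: "1 \<le> K" and S: "\<And>s t. s \<in> S \<Longrightarrow> t \<in> S \<Longrightarrow> 0 < s \<and> dst s t \<le> K" for K S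
  proof (cases "S = {}")
    case False
    then obtain s where s: "s \<in> S" by auto
    have s0: "0 < s" using S[OF s s] by simp
    have "S \<subseteq> {s / K..K * s}"
      using S[OF s] S[OF _ s] dst_le_iff[OF s0, of _ K] by auto
    then have "emeasure haar S \<le> emeasure haar {s / K..K * s}" by (intro emeasure_mono) auto
    also have "\<dots> = ennreal (ln (K * s / (s / K)))"
    proof (rule emeasure_haar_Icc)
      have "s / K \<le> s" using s0 K by (simp add: divide_le_eq)
      also have "\<dots> \<le> K * s" using s0 K by simp
      finally show "s / K \<le> K * s" .
    qed (use s0 K in auto)
    also have "K * s / (s / K) = K\<^sup>2" using s0 K by (simp add: power2_eq_square)
    finally show ?thesis .
  qed simp
  have meas_eq: "emeasure haar {u. 0 < u \<and> dst t u < K} = ennreal (ln (K\<^sup>2))"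
    if K: "1 < K" and t: "0 < t" for K t
  proof -
    have "0 < u" if "t / K < u" for u
      using t K that by (intro less_trans[OF divide_pos_pos that]) auto
    then have "{u. 0 < u \<and> dst t u < K} = {t / K<..<K * t}"
      using dst_less_iff[OF t] by fastforce
    also have "emeasure haar \<dots> = ennreal (ln (K * t / (t / K)))"
    proof (rule emeasure_haar_Ioo)
      have "t / K \<le> t" using t K by (simp add: divide_le_eq)
      also have "\<dots> \<le> K * t" using t K by simp
      finally show "t / K \<le> K * t" .
    qed (use t K in auto)
    also have "K * t / (t / K) = K\<^sup>2" using t K by (simp add: power2_eq_square)
    finally show ?thesis .
  qed
  have lnpos: "0 < ln (K\<^sup>2)" if "1 < K" for K :: real
    using that by (intro ln_gt_zero) (simp add: one_less_power)
  have Lq4: "1 \<le> A * 4\<^sup>2" using A by simp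
  \<comment> \<open>The rows are full blocks around \<open>\<rho> t\<close>. Two members of a column
    have images at distance at most \<open>2 * 2\<close>, so they are themselves at distance at most
    \<open>A * 4\<^sup>2\<close>.\<close>
  obtain C1 where C1: "C1 < top"
    "\<And>F G. G \<in> borel_measurable borel \<Longrightarrow>
        (\<And>t u. 0 < t \<Longrightarrow> 0 < u \<Longrightarrow> dst (\<rho> t) u < 2 \<Longrightarrow> F t \<le> (D * ennreal (2 powr \<kappa>)) * G u) \<Longrightarrow>
        mn q {0<..} F \<le> C1 * mn q {0<..} G"
  proof (rule relation_bound[OF q, where R = "\<lambda>t u. dst (\<rho> t) u < 2" and m = "ennreal (ln (2\<^sup>2))"
        and B = "ennreal (ln ((A * 4\<^sup>2)\<^sup>2))" and D = "D * ennreal (2 powr \<kappa>)"])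
    show "ennreal (ln (2\<^sup>2)) \<le> emeasure haar {u. 0 < u \<and> dst (\<rho> t) u < 2}" if "0 < t" for t
      using meas_eq[of 2 "\<rho> t"] pos[OF that] by simp
    show "emeasure haar {t. 0 < t \<and> dst (\<rho> t) u < 2} \<le> ennreal (ln ((A * 4\<^sup>2)\<^sup>2))" if u: "0 < u" for u
    proof (rule meas_le[OF Lq4])
      fix s t assume "s \<in> {t. 0 < t \<and> dst (\<rho> t) u < 2}" "t \<in> {t. 0 < t \<and> dst (\<rho> t) u < 2}"
      then have s: "0 < s" "dst (\<rho> s) u < 2" and t: "0 < t" "dst (\<rho> t) u < 2" by auto
      have "dst (\<rho> s) (\<rho> t) \<le> dst (\<rho> s) u * dst u (\<rho> t)"
        by (rule dst_triangle) (use s t u pos in auto)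
      also have "\<dots> \<le> 2 * 2"
        using s t u dst_pos[OF u pos[OF t(1)]] by (intro mult_mono) (auto simp: dst_commute)
      finally have "(dst (\<rho> s) (\<rho> t))\<^sup>2 \<le> 4\<^sup>2"
        using dst_pos[OF pos[OF s(1)] pos[OF t(1)]] by (intro power_mono) auto
      then have "A * (dst (\<rho> s) (\<rho> t))\<^sup>2 \<le> A * 4\<^sup>2" using A(1) by (intro mult_left_mono) auto
      then show "0 < s \<and> dst s t \<le> A * 4\<^sup>2" using A(3)[OF s(1) t(1)] s(1) by linarith
    qed
  qed (use D lnpos[of 2] in \<open>auto simp: ennreal_mult_less_top\<close>)
  \<comment> \<open>With the roles exchanged the columns are full blocks, while a row needs a point
    whose image is near \<open>u\<close>; approximate surjectivity provides it, and its neighbours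
    within a factor 2 fill the row.\<close>
  obtain C2 where C2: "C2 < top"
    "\<And>F G. G \<in> borel_measurable borel \<Longrightarrow>
        (\<And>u t. 0 < u \<Longrightarrow> 0 < t \<Longrightarrow> dst (\<rho> t) u < L \<Longrightarrow> F u \<le> (D * ennreal (L powr \<kappa>)) * G t) \<Longrightarrow>
        mn q {0<..} F \<le> C2 * mn q {0<..} G"
  proof (rule relation_bound[OF q, where R = "\<lambda>u t. dst (\<rho> t) u < L" and m = "ennreal (ln (2\<^sup>2))"
        and B = "ennreal (ln (L\<^sup>2))" and D = "D * ennreal (L powr \<kappa>)"])
    show "ennreal (ln (2\<^sup>2)) \<le> emeasure haar {t. 0 < t \<and> dst (\<rho> t) u < L}" if u: "0 < u" for u
    proof -
      obtain s where s: "0 < s" "dst (\<rho> s) u \<le> B" using B[OF u] by blast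
      have "{t. 0 < t \<and> dst s t < 2} \<subseteq> {t. 0 < t \<and> dst (\<rho> t) u < L}"
      proof safe
        fix t assume t: "0 < t" "dst s t < 2"
        have "dst (\<rho> t) u \<le> dst (\<rho> t) (\<rho> s) * dst (\<rho> s) u"
          by (rule dst_triangle) (use s t u pos in auto)
        also have "\<dots> \<le> (A * (dst t s)\<^sup>2) * B"
          using A(2)[OF t(1) s(1)] s dst_pos[OF pos[OF s(1)] u] A(1) by (intro mult_mono) auto
        also have "\<dots> \<le> (A * 2\<^sup>2) * B"
          using t s dst_pos[OF s(1) t(1)] A(1) B1
          by (intro mult_right_mono mult_left_mono power_mono) (auto simp: dst_commute)
        finally show "dst (\<rho> t) u < L" by (simp add: L_def)
      qed
      then have "emeasure haar {t. 0 < t \<and> dst s t < 2} \<le> emeasure haar {t. 0 < t \<and> dst (\<rho> t) u < L}"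
        by (rule emeasure_mono) simp
      then show ?thesis using meas_eq[of 2 s] s(1) by simp
    qed
    show "emeasure haar {u. 0 < u \<and> dst (\<rho> t) u < L} \<le> ennreal (ln (L\<^sup>2))" if "0 < t" for t
      using meas_eq[OF L(1) pos[OF that]] by simp
  qed (use D lnpos[of 2] in \<open>auto simp: ennreal_mult_less_top\<close>)
  show ?thesis
  proof (rule that)
    show "C1 + C2 < top" using C1 C2 by simp
    fix G :: "real \<Rightarrow> ennreal"
    assume [measurable]: "G \<in> borel_measurable borel"
    assume G: "\<And>u v. 0 < u \<Longrightarrow> 0 < v \<Longrightarrow> G u \<le> D * ennreal (dst u v powr \<kappa>) * G v"
    have G': "G u \<le> D * ennreal (K powr \<kappa>) * G v" if "0 < u" "0 < v" "dst u v < K" for u v K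
    proof -
      have "dst u v powr \<kappa> \<le> K powr \<kappa>"
        using that dst_pos[OF that(1,2)] \<kappa> by (intro powr_mono2) auto
      then show ?thesis
        by (intro order_trans[OF G[OF that(1,2)]] mult_right_mono mult_left_mono ennreal_leI) auto
    qed
    have "mn q {0<..} (\<lambda>t. G (\<rho> t)) \<le> C1 * mn q {0<..} G"
      by (rule C1(2)) (auto intro: G' pos)
    moreover have "mn q {0<..} G \<le> C2 * mn q {0<..} (\<lambda>t. G (\<rho> t))"
      by (rule C2(2)) (auto intro!: G' pos simp: dst_commute)
    moreover have "C1 * x \<le> (C1 + C2) * x" "C2 * x \<le> (C1 + C2) * x" for x
      by (intro mult_right_mono; simp)+
    ultimately show "mn q {0<..} (\<lambda>t. G (\<rho> t)) \<le> (C1 + C2) * mn q {0<..} G \<and>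
        mn q {0<..} G \<le> (C1 + C2) * mn q {0<..} (\<lambda>t. G (\<rho> t))"
      by (meson order_trans)
  qed
qed

section \<open>The weights of the endpoint spaces\<close>

lemma dst_mult_self: "0 < c \<Longrightarrow> 0 < u \<Longrightarrow> 0 < t \<Longrightarrow> dst (c * u) u = dst (c * t) t"
  by (simp add: dst_def)

text \<open>The scaling inequality with exponent 1 carries finiteness from the point 1 to every
  point; afterwards \<open>enn2real\<close> is faithful and the inequality can be read in the
  reals.\<close>

lemma slow_enn2real:
  fixes E :: "real \<Rightarrow> ennreal"
  assumes E: "\<And>\<epsilon>. 0 < \<epsilon> \<Longrightarrow> \<exists>C. \<forall>s>0. \<forall>t>0. E s \<le> ennreal (C * dst s t powr \<epsilon>) * E t"
    and fin: "E 1 < top" and pos: "\<And>t. 0 < t \<Longrightarrow> 0 < E t"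
  shows "slow (\<lambda>t. enn2real (E t))" and "\<And>t. 0 < t \<Longrightarrow> ennreal (enn2real (E t)) = E t"
proof -
  have fin': "E t < top" if t: "0 < t" for t
  proof -
    obtain C where "\<forall>s>0. \<forall>t>0. E s \<le> ennreal (C * dst s t powr 1) * E t"
      using E[of 1] by auto
    then have "E t \<le> ennreal (C * dst t 1 powr 1) * E 1" using t by simp
    also have "\<dots> < top" using fin by (simp add: ennreal_mult_less_top)
    finally show ?thesis .
  qed
  show eq: "ennreal (enn2real (E t)) = E t" if "0 < t" for t
    using fin'[OF that] by simp
  have pos': "0 < enn2real (E t)" if "0 < t" for t
    using pos[OF that] fin'[OF that] by (simp add: enn2real_positive_iff)
  show "slow (\<lambda>t. enn2real (E t))"
    unfolding slow_def
  proof (intro conjI allI impI)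
    fix \<epsilon> :: real assume "0 < \<epsilon>"
    then obtain C where C: "\<forall>s>0. \<forall>t>0. E s \<le> ennreal (C * dst s t powr \<epsilon>) * E t"
      using E by blast
    show "\<exists>C. \<forall>s>0. \<forall>t>0. enn2real (E s) \<le> C * dst s t powr \<epsilon> * enn2real (E t)"
    proof (intro exI allI impI)
      fix s t :: real assume st: "0 < s" "0 < t"
      have "E s \<le> ennreal (C * dst s t powr \<epsilon>) * E t" using C st by blast
      also have "\<dots> \<le> ennreal (max C 0 * dst s t powr \<epsilon>) * E t"
        by (intro mult_right_mono ennreal_leI) auto
      also have "\<dots> = ennreal (max C 0 * dst s t powr \<epsilon> * enn2real (E t))"
        by (subst eq[OF st(2), symmetric], subst ennreal_mult'[symmetric]) auto
      finally have "ennreal (enn2real (E s)) \<le> ennreal (max C 0 * dst s t powr \<epsilon> * enn2real (E t))"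
        by (simp only: eq[OF st(1)])
      then show "enn2real (E s) \<le> max C 0 * dst s t powr \<epsilon> * enn2real (E t)"
        by (subst (asm) ennreal_le_iff) auto
    qed
  qed (use pos' in auto)
qed

text \<open>Next to \<open>t\<close> there are blocks of ratio 2 on either side on which the weight
  is comparable to \<open>w t\<close>, and a block carries the norm \<open>Lq q\<close>. Both sides
  are needed: the norm defining \<open>chi0\<close> looks to the right of \<open>t\<close>, those
  defining \<open>hh\<close> and \<open>chi1\<close> look to the left.\<close>

lemma slow_le_mn:
  assumes q: "0 < q" and w: "slow w" and [measurable]: "w \<in> borel_measurable borel"
  obtains C where "C < top"
    "\<And>t S. 0 < t \<Longrightarrow> {t<..<2 * t} \<subseteq> S \<Longrightarrow> S \<in> sets borel \<Longrightarrow> ennreal (w t) \<le> C * mn q S (\<lambda>u. ennreal (w u))"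
    "\<And>t S. 0 < t \<Longrightarrow> {t / 2<..<t} \<subseteq> S \<Longrightarrow> S \<in> sets borel \<Longrightarrow> ennreal (w t) \<le> C * mn q S (\<lambda>u. ennreal (w u))"
proof -
  obtain C where C: "1 \<le> C" "\<And>s t. 0 < s \<Longrightarrow> 0 < t \<Longrightarrow> w s \<le> C * dst s t powr 1 * w t"
    using slowE[OF w, of 1] by auto
  have C2: "ennreal (w t) \<le> ennreal (C * 2) * ennreal (w u)" if "0 < t" "0 < u" "dst t u \<le> 2" for t u
  proof -
    have "w t \<le> C * dst t u powr 1 * w u" by (rule C(2)) fact+
    also have "\<dots> \<le> C * 2 * w u"
      using that C(1) slow_pos[OF w that(2)] dst_pos[OF that(1,2)]
      by (intro mult_right_mono mult_left_mono) auto
    finally show ?thesis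
      using C(1) by (simp add: ennreal_mult'[symmetric] ennreal_leI)
  qed
  have *: "ennreal (w t) \<le> (1 / Lq q) * ennreal (C * 2) * mn q S (\<lambda>u. ennreal (w u))"
    if "0 < s" "0 < t" "{s<..<2 * s} \<subseteq> S" and S: "S \<in> sets borel" and d: "\<And>u. s < u \<Longrightarrow> u < 2 * s \<Longrightarrow> dst t u \<le> 2" for s t S
  proof -
    have "Lq q * ennreal (w t) \<le> mn q S (\<lambda>u. ennreal (C * 2) * ennreal (w u))"
      using that by (intro mn_ge[OF q, of s]) (auto intro!: C2)
    also have "\<dots> = ennreal (C * 2) * mn q S (\<lambda>u. ennreal (w u))"
      using q S by (intro mn_cmult) auto
    finally show ?thesis unfolding mult.assoc by (rule ennreal_le_divideI) auto
  qed
  show ?thesis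
  proof (rule that)
    show "(1 / Lq q) * ennreal (C * 2) < top"
      by (simp add: ennreal_mult_less_top ennreal_inverse_less_top)
    show "ennreal (w t) \<le> (1 / Lq q) * ennreal (C * 2) * mn q S (\<lambda>u. ennreal (w u))"
      if "0 < t" "{t<..<2 * t} \<subseteq> S" "S \<in> sets borel" for t S
      using that by (intro *[of t]) (auto simp: dst_le pos_divide_le_eq)
    show "ennreal (w t) \<le> (1 / Lq q) * ennreal (C * 2) * mn q S (\<lambda>u. ennreal (w u))"
      if "0 < t" "{t / 2<..<t} \<subseteq> S" "S \<in> sets borel" for t S
      using that by (intro *[of "t / 2"]) (auto simp: dst_ge pos_divide_le_eq)
  qed
qed

text \<open>Dilation by \<open>c\<close> preserves the Haar measure and changes the weight by a
  slowly varying factor. \<open>dst (c * t) t\<close> depends on \<open>c\<close> alone; the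
  auxiliary \<open>t\<close> is there so that \<open>c = s / t\<close> turns it into
  \<open>dst s t\<close>.\<close>

lemma slow_mn_scale:
  assumes q: "0 < q" and w: "slow w" and [measurable]: "w \<in> borel_measurable borel" and e: "0 < \<epsilon>"
  obtains C where "1 \<le> C"
    "\<And>c t S T. 0 < c \<Longrightarrow> 0 < t \<Longrightarrow> S \<in> sets borel \<Longrightarrow> T \<in> sets borel \<Longrightarrow>
      (\<And>u. 0 < u \<Longrightarrow> c * u \<in> S \<Longrightarrow> u \<in> T) \<Longrightarrow>
      mn q S (\<lambda>u. ennreal (w u)) \<le> ennreal (C * dst (c * t) t powr \<epsilon>) * mn q T (\<lambda>u. ennreal (w u))"
proof -
  obtain C where C: "1 \<le> C" "\<And>s t. 0 < s \<Longrightarrow> 0 < t \<Longrightarrow> w s \<le> C * dst s t powr \<epsilon> * w t"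
    using slowE[OF w e] by blast
  show ?thesis
  proof (rule that[OF C(1)])
    fix c t :: real and S T
    assume c: "0 < c" "0 < t" and [measurable]: "S \<in> sets borel" "T \<in> sets borel"
      and ST: "\<And>u. 0 < u \<Longrightarrow> c * u \<in> S \<Longrightarrow> u \<in> T"
    have "mn q S (\<lambda>u. ennreal (w u)) = mn q ((*) c -` S) (\<lambda>u. ennreal (w (c * u)))"
      by (rule mn_scale[symmetric, OF q c(1)]) auto
    also have "\<dots> \<le> ennreal (C * dst (c * t) t powr \<epsilon>) * mn q T (\<lambda>u. ennreal (w u))"
    proof (rule mn_le_cmult[OF q])
      fix u assume u: "0 < u" "u \<in> (*) c -` S"
      have "w (c * u) \<le> C * dst (c * t) t powr \<epsilon> * w u"
        using C(2)[of "c * u" u] c u dst_mult_self[OF c(1) u(1) c(2)] by simp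
      then have "ennreal (w (c * u)) \<le> ennreal (C * dst (c * t) t powr \<epsilon>) * ennreal (w u)"
        using C(1) by (subst ennreal_mult'[symmetric]) (auto intro: ennreal_leI)
      then show "u \<in> T \<and> ennreal (w (c * u)) \<le> ennreal (C * dst (c * t) t powr \<epsilon>) * ennreal (w u)"
        using ST u by auto
    qed auto
    finally show "mn q S (\<lambda>u. ennreal (w u)) \<le> ennreal (C * dst (c * t) t powr \<epsilon>) * mn q T (\<lambda>u. ennreal (w u))" .
  qed
qed

section \<open>Slow variation of \<open>\<chi>0\<close>, \<open>\<chi>1\<close> and the head norm of
  \<open>b1\<close>, and their mutual bounds\<close>

locale endpoint_weights =
  fixes q1 r1 r0 :: ennreal and a1 b1 b0 :: "real \<Rightarrow> real"
  assumes q1: "0 < q1" and r1: "0 < r1" and r0: "0 < r0"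
    and slow_a1: "slow a1" and slow_b1: "slow b1" and slow_b0: "slow b0"
    and meas_a1 [measurable]: "a1 \<in> borel_measurable borel"
    and meas_b1 [measurable]: "b1 \<in> borel_measurable borel"
    and meas_b0 [measurable]: "b0 \<in> borel_measurable borel"
    and fin0: "mn r0 {1<..} (\<lambda>s. ennreal (b0 s)) < top"
    and fin1: "mn r1 {0<..<1} (\<lambda>s. ennreal (b1 s) * mn q1 {s<..<1} (\<lambda>u. ennreal (a1 u))) < top"
begin

definition E0 :: "real \<Rightarrow> ennreal" where
  "E0 t = mn r0 {t<..} (\<lambda>s. ennreal (b0 s))"

text \<open>Its real version \<open>hh\<close> is the norm in the weight \<open>B_1\<close> of case
  (iii).\<close>

definition EH :: "real \<Rightarrow> ennreal" where
  "EH t = mn r1 {0<..<t} (\<lambda>s. ennreal (b1 s))"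

definition E1 :: "real \<Rightarrow> ennreal" where
  "E1 t = mn r1 {0<..<t} (\<lambda>s. ennreal (b1 s) * mn q1 {s<..<t} (\<lambda>u. ennreal (a1 u)))"

definition chi0 :: "real \<Rightarrow> real" where "chi0 t = enn2real (E0 t)"
definition chi1 :: "real \<Rightarrow> real" where "chi1 t = enn2real (E1 t)"
definition hh :: "real \<Rightarrow> real" where "hh t = enn2real (EH t)"

lemma measurable_inner [measurable]:
  "(\<lambda>s. mn q1 {s<..<t} f) \<in> borel_measurable borel"
  "(\<lambda>s. mn q1 {s<..} f) \<in> borel_measurable borel"
  by (rule measurable_mn_Ioo_left measurable_mn_Ioi, rule q1)+

lemma E0_scale:
  assumes "0 < \<epsilon>"
  shows "\<exists>C. \<forall>s>0. \<forall>t>0. E0 s \<le> ennreal (C * dst s t powr \<epsilon>) * E0 t"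
proof (rule slow_mn_scale[OF r0 slow_b0 meas_b0 assms], goal_cases)
  case (1 C)
  have "E0 s \<le> ennreal (C * dst s t powr \<epsilon>) * E0 t" if "0 < s" "0 < t" for s t
  proof -
    have "E0 s \<le> ennreal (C * dst (s / t * t) t powr \<epsilon>) * E0 t"
      unfolding E0_def by (rule 1(2)) (use that in \<open>auto simp: field_simps\<close>)
    then show ?thesis using that by simp
  qed
  then show ?case by blast
qed

lemma EH_scale:
  assumes "0 < \<epsilon>"
  shows "\<exists>C. \<forall>s>0. \<forall>t>0. EH s \<le> ennreal (C * dst s t powr \<epsilon>) * EH t"
proof (rule slow_mn_scale[OF r1 slow_b1 meas_b1 assms], goal_cases)
  case (1 C)
  have "EH s \<le> ennreal (C * dst s t powr \<epsilon>) * EH t" if "0 < s" "0 < t" for s t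
  proof -
    have "EH s \<le> ennreal (C * dst (s / t * t) t powr \<epsilon>) * EH t"
      unfolding EH_def by (rule 1(2)) (use that in \<open>auto simp: field_simps\<close>)
    then show ?thesis using that by simp
  qed
  then show ?case by blast
qed

text \<open>One dilation acts on the outer and the inner norm simultaneously; the allowance
  \<open>\<epsilon>\<close> is shared equally between \<open>b1\<close> and
  \<open>a1\<close>.\<close>

lemma E1_scale:
  assumes e: "0 < \<epsilon>"
  shows "\<exists>C. \<forall>s>0. \<forall>t>0. E1 s \<le> ennreal (C * dst s t powr \<epsilon>) * E1 t"
proof -
  have e2: "0 < \<epsilon> / 2" using e by simp
  obtain C where C: "1 \<le> C" "\<And>s t. 0 < s \<Longrightarrow> 0 < t \<Longrightarrow> b1 s \<le> C * dst s t powr (\<epsilon> / 2) * b1 t"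
    using slowE[OF slow_b1 e2] by blast
  show ?thesis
  proof (rule slow_mn_scale[OF q1 slow_a1 meas_a1 e2], intro exI allI impI, goal_cases)
    case (1 D s t)
    note D = 1(1,2) and st = 1(3,4)
    define c where "c = s / t"
    have c: "0 < c" "s = c * t" using st by (auto simp: c_def)
    let ?d = "dst s t powr (\<epsilon> / 2)"
    let ?I = "\<lambda>s t. mn q1 {s<..<t} (\<lambda>u. ennreal (a1 u))"
    have inner: "?I (c * u) s \<le> ennreal (D * ?d) * ?I u t" if u: "0 < u" for u
      unfolding c(2) by (rule D(2)[OF c(1) st(2)]) (use c(1) in auto)
    have "E1 s = mn r1 ((*) c -` {0<..<s}) (\<lambda>u. ennreal (b1 (c * u)) * ?I (c * u) s)"
      unfolding E1_def by (rule mn_scale[symmetric, OF r1 c(1)]) measurable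
    also have "\<dots> \<le> ennreal ((C * D) * dst s t powr \<epsilon>) * E1 t"
      unfolding E1_def
    proof (rule mn_le_cmult[OF r1])
      fix u assume u: "0 < u" "u \<in> (*) c -` {0<..<s}"
      have "b1 (c * u) \<le> C * ?d * b1 u"
        using C(2)[of "c * u" u] c u dst_mult_self[OF c(1) u(1) st(2)] by simp
      then have "ennreal (b1 (c * u)) \<le> ennreal (C * ?d) * ennreal (b1 u)"
        using C(1) by (subst ennreal_mult'[symmetric]) (auto intro: ennreal_leI)
      then have "ennreal (b1 (c * u)) * ?I (c * u) s \<le>
          (ennreal (C * ?d) * ennreal (b1 u)) * (ennreal (D * ?d) * ?I u t)"
        using inner[OF u(1)] by (intro mult_mono) auto
      also have "\<dots> = (ennreal (C * ?d) * ennreal (D * ?d)) * (ennreal (b1 u) * ?I u t)"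
        by (simp add: mult_ac)
      also have "ennreal (C * ?d) * ennreal (D * ?d) = ennreal ((C * ?d) * (D * ?d))"
        using C(1) by (intro ennreal_mult'[symmetric]) auto
      also have "(C * ?d) * (D * ?d) = (C * D) * (?d * ?d)" by (simp add: mult_ac)
      also have "?d * ?d = dst s t powr \<epsilon>" by (simp add: powr_add[symmetric])
      finally show "u \<in> {0<..<t} \<and> ennreal (b1 (c * u)) * ?I (c * u) s \<le>
          ennreal ((C * D) * dst s t powr \<epsilon>) * (ennreal (b1 u) * ?I u t)"
        using u c by auto
    qed measurable
    finally show "E1 s \<le> ennreal ((C * D) * dst s t powr \<epsilon>) * E1 t" .
  qed
qed

lemma b0_le_E0: obtains C where "C < top" "\<And>t. 0 < t \<Longrightarrow> ennreal (b0 t) \<le> C * E0 t"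
  by (rule slow_le_mn[OF r0 slow_b0 meas_b0]) (simp add: E0_def subset_eq)

lemma b1_le_EH: obtains C where "C < top" "\<And>t. 0 < t \<Longrightarrow> ennreal (b1 t) \<le> C * EH t"
  by (rule slow_le_mn[OF r1 slow_b1 meas_b1]) (simp add: EH_def subset_eq)

text \<open>Restrict the outer norm of \<open>E1 t\<close> to \<open>s < t / 2\<close>. Then the
  inner interval contains \<open>{t / 2<..<t}\<close>, whose contribution is of size
  \<open>a1 t\<close> and independent of \<open>s\<close>, and the outer norm leaves
  \<open>EH (t / 2)\<close>, comparable to \<open>EH t\<close>.\<close>

lemma EH_a1_le_E1: obtains C where "C < top" "\<And>t. 0 < t \<Longrightarrow> EH t * ennreal (a1 t) \<le> C * E1 t"
proof -
  obtain C where C: "C < top"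
    "\<And>t S. 0 < t \<Longrightarrow> {t / 2<..<t} \<subseteq> S \<Longrightarrow> S \<in> sets borel \<Longrightarrow> ennreal (a1 t) \<le> C * mn q1 S (\<lambda>u. ennreal (a1 u))"
    using slow_le_mn[OF q1 slow_a1 meas_a1] by metis
  obtain D where D: "\<forall>s>0. \<forall>t>0. EH s \<le> ennreal (D * dst s t powr 1) * EH t"
    using EH_scale[of 1] by auto
  show ?thesis
  proof (rule that)
    show "ennreal (D * 2) * C < top" using C by (simp add: ennreal_mult_less_top)
    fix t :: real assume t: "0 < t"
    let ?m = "mn q1 {t / 2<..<t} (\<lambda>u. ennreal (a1 u))"
    have "dst t (t / 2) = 2" using t by (simp add: dst_ge)
    then have "EH t \<le> ennreal (D * 2) * EH (t / 2)"
      using D t by (metis half_gt_zero powr_one zero_le_numeral)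
    moreover have "ennreal (a1 t) \<le> C * ?m"
      using t by (intro C(2)) auto
    ultimately have "EH t * ennreal (a1 t) \<le> (ennreal (D * 2) * EH (t / 2)) * (C * ?m)"
      by (intro mult_mono) auto
    also have "\<dots> = (ennreal (D * 2) * C) * (?m * EH (t / 2))" by (simp add: mult_ac)
    also have "?m * EH (t / 2) = mn r1 {0<..<t / 2} (\<lambda>s. ?m * ennreal (b1 s))"
      unfolding EH_def by (rule mn_cmult[symmetric, OF r1]) auto
    also have "\<dots> \<le> E1 t" unfolding E1_def
    proof (rule mn_mono[OF r1])
      fix s assume s: "0 < s" "s \<in> {0<..<t / 2}"
      have "?m \<le> mn q1 {s<..<t} (\<lambda>u. ennreal (a1 u))"
        using s by (intro mn_mono q1) auto
      then show "s \<in> {0<..<t} \<and> ?m * ennreal (b1 s) \<le> ennreal (b1 s) * mn q1 {s<..<t} (\<lambda>u. ennreal (a1 u))"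
        using s by (auto simp: mult.commute intro: mult_left_mono)
    qed
    finally show "EH t * ennreal (a1 t) \<le> (ennreal (D * 2) * C) * E1 t"
      by (simp add: mult_left_mono)
  qed
qed

lemma E0_pos: "0 < t \<Longrightarrow> 0 < E0 t"
proof -
  assume t: "0 < t"
  obtain C where "C < top" "\<And>t. 0 < t \<Longrightarrow> ennreal (b0 t) \<le> C * E0 t" using b0_le_E0 by metis
  then show ?thesis
    using slow_pos[OF slow_b0 t] t
    by (metis ennreal_0 ennreal_less_zero_iff le_zero_eq mult_zero_right not_gr_zero)
qed

lemma EH_pos: "0 < t \<Longrightarrow> 0 < EH t"
proof -
  assume t: "0 < t"
  obtain C where "C < top" "\<And>t. 0 < t \<Longrightarrow> ennreal (b1 t) \<le> C * EH t" using b1_le_EH by metis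
  then show ?thesis
    using slow_pos[OF slow_b1 t] t
    by (metis ennreal_0 ennreal_less_zero_iff le_zero_eq mult_zero_right not_gr_zero)
qed

lemma E1_pos: "0 < t \<Longrightarrow> 0 < E1 t"
proof -
  assume t: "0 < t"
  obtain C where "C < top" "\<And>t. 0 < t \<Longrightarrow> EH t * ennreal (a1 t) \<le> C * E1 t" using EH_a1_le_E1 by metis
  moreover have "0 < EH t * ennreal (a1 t)"
    using EH_pos[OF t] slow_pos[OF slow_a1 t] by (simp add: ennreal_zero_less_mult_iff)
  ultimately show ?thesis
    using t by (metis le_zero_eq mult_zero_right not_gr_zero)
qed

text \<open>The head norm of \<open>b1\<close> alone is not assumed finite; an infinite value would
  make the iterated norm \<open>E1 1\<close> infinite.\<close>

lemma EH_1: "EH 1 < top"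
proof (rule ccontr)
  obtain C where C: "C < top" "\<And>t. 0 < t \<Longrightarrow> EH t * ennreal (a1 t) \<le> C * E1 t" using EH_a1_le_E1 by metis
  assume "\<not> EH 1 < top"
  then have "EH 1 * ennreal (a1 1) = top"
    using slow_pos[OF slow_a1, of 1] by (simp add: not_less top_unique ennreal_top_mult)
  then have "top \<le> C * E1 1" using C(2)[of 1] by simp
  moreover have "C * E1 1 < top" using C(1) fin1 by (simp add: E1_def ennreal_mult_less_top)
  ultimately show False by simp
qed

lemma slow_chi0: "slow chi0" and ennreal_chi0: "0 < t \<Longrightarrow> ennreal (chi0 t) = E0 t"
  using slow_enn2real[of E0, OF E0_scale _ E0_pos] fin0 unfolding chi0_def[abs_def] E0_def by auto

lemma slow_chi1: "slow chi1" and ennreal_chi1: "0 < t \<Longrightarrow> ennreal (chi1 t) = E1 t"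
  using slow_enn2real[of E1, OF E1_scale _ E1_pos] fin1 unfolding chi1_def[abs_def] E1_def by auto

lemma slow_hh: "slow hh" and ennreal_hh: "0 < t \<Longrightarrow> ennreal (hh t) = EH t"
  using slow_enn2real[of EH, OF EH_scale EH_1 EH_pos] unfolding hh_def[abs_def] by auto

lemma chi0_pos: "0 < t \<Longrightarrow> 0 < chi0 t" by (rule slow_pos[OF slow_chi0])
lemma chi1_pos: "0 < t \<Longrightarrow> 0 < chi1 t" by (rule slow_pos[OF slow_chi1])
lemma hh_pos: "0 < t \<Longrightarrow> 0 < hh t" by (rule slow_pos[OF slow_hh])

lemma measurable_chi0 [measurable]: "chi0 \<in> borel_measurable borel"
proof -
  have "E0 \<in> borel_measurable borel"
    unfolding E0_def by (rule measurable_mn_Ioi[OF r0])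
  then show ?thesis unfolding chi0_def[abs_def] by measurable
qed

lemma measurable_chi1 [measurable]: "chi1 \<in> borel_measurable borel"
proof -
  have "E1 \<in> borel_measurable borel"
    unfolding E1_def
  proof (rule borel_measurable_mono_ennreal, rule monoI, rule mn_mono[OF r1])
    fix s t u :: real assume st: "s \<le> t" "0 < u" "u \<in> {0<..<s}"
    have "mn q1 {u<..<s} (\<lambda>u. ennreal (a1 u)) \<le> mn q1 {u<..<t} (\<lambda>u. ennreal (a1 u))"
      using st by (intro mn_mono q1) auto
    then show "u \<in> {0<..<t} \<and> ennreal (b1 u) * mn q1 {u<..<s} (\<lambda>u. ennreal (a1 u)) \<le>
        ennreal (b1 u) * mn q1 {u<..<t} (\<lambda>u. ennreal (a1 u))"
      using st by (auto intro: mult_left_mono)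
  qed
  then show ?thesis unfolding chi1_def[abs_def] by measurable
qed

lemma measurable_hh [measurable]: "hh \<in> borel_measurable borel"
proof -
  have "EH \<in> borel_measurable borel"
    unfolding EH_def by (rule measurable_mn_Ioo_right[OF r1])
  then show ?thesis unfolding hh_def[abs_def] by measurable
qed

lemma hh_mono:
  assumes "0 < s" "s \<le> t"
  shows "hh s \<le> hh t"
proof -
  have "EH s \<le> EH t" unfolding EH_def using assms by (intro mn_mono r1) auto
  then have "ennreal (hh s) \<le> ennreal (hh t)" using assms by (simp add: ennreal_hh)
  then show ?thesis using hh_pos[of t] assms by (subst (asm) ennreal_le_iff) auto
qed

text \<open>These allow the weight inside a norm to be exchanged for the corresponding integrated
  quantity at the same point: \<open>b0\<close> for \<open>chi0\<close>, \<open>b1\<close> for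
  \<open>hh\<close>, and \<open>hh * a1\<close> for \<open>chi1\<close>.\<close>

lemma weight_bounds:
  obtains C where "1 \<le> C" "\<And>t. 0 < t \<Longrightarrow> b0 t \<le> C * chi0 t" "\<And>t. 0 < t \<Longrightarrow> b1 t \<le> C * hh t"
    "\<And>t. 0 < t \<Longrightarrow> hh t * a1 t \<le> C * chi1 t"
proof -
  have real: "\<exists>C\<ge>1. \<forall>t>0. f t \<le> C * g t"
    if C: "C < top" "\<And>t. 0 < t \<Longrightarrow> ennreal (f t) \<le> C * ennreal (g t)" and g: "\<And>t. 0 < t \<Longrightarrow> 0 < g t"
    for C and f g :: "real \<Rightarrow> real"
  proof (intro exI conjI allI impI)
    show "1 \<le> max 1 (enn2real C)" by simp
    fix t :: real assume t: "0 < t"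
    have "ennreal (f t) \<le> ennreal (enn2real C) * ennreal (g t)"
      using C(1) C(2)[OF t] by simp
    also have "\<dots> = ennreal (enn2real C * g t)"
      by (rule ennreal_mult'[symmetric]) simp
    finally have "f t \<le> enn2real C * g t"
      using g[OF t] by (subst (asm) ennreal_le_iff) auto
    also have "\<dots> \<le> max 1 (enn2real C) * g t"
      using g[OF t] by (intro mult_right_mono) auto
    finally show "f t \<le> max 1 (enn2real C) * g t" .
  qed
  obtain C0 where C0: "C0 < top" "\<And>t. 0 < t \<Longrightarrow> ennreal (b0 t) \<le> C0 * E0 t"
    using b0_le_E0 by metis
  then have "\<And>t. 0 < t \<Longrightarrow> ennreal (b0 t) \<le> C0 * ennreal (chi0 t)"
    by (simp add: ennreal_chi0)
  from real[of C0 b0 chi0, OF C0(1) this chi0_pos] obtain D0 where D0: "1 \<le> D0" "\<forall>t>0. b0 t \<le> D0 * chi0 t" by blast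
  obtain C1 where C1: "C1 < top" "\<And>t. 0 < t \<Longrightarrow> ennreal (b1 t) \<le> C1 * EH t"
    using b1_le_EH by metis
  then have "\<And>t. 0 < t \<Longrightarrow> ennreal (b1 t) \<le> C1 * ennreal (hh t)"
    by (simp add: ennreal_hh)
  from real[of C1 b1 hh, OF C1(1) this hh_pos] obtain D1 where D1: "1 \<le> D1" "\<forall>t>0. b1 t \<le> D1 * hh t" by blast
  obtain C2 where C2: "C2 < top" "\<And>t. 0 < t \<Longrightarrow> EH t * ennreal (a1 t) \<le> C2 * E1 t"
    using EH_a1_le_E1 by metis
  have "ennreal (hh t * a1 t) \<le> C2 * ennreal (chi1 t)" if "0 < t" for t
    using C2(2)[OF that] that hh_pos[OF that] by (simp add: ennreal_mult' ennreal_hh ennreal_chi1)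
  from real[of C2 "\<lambda>t. hh t * a1 t" chi1, OF C2(1) this chi1_pos] obtain D2 where D2: "1 \<le> D2" "\<forall>t>0. hh t * a1 t \<le> D2 * chi1 t" by blast
  define C where "C = max D0 (max D1 D2)"
  have *: "x \<le> C * y" if "x \<le> D * y" "0 < y" "D \<le> C" for x y D
    using that by (meson less_imp_le mult_right_mono order_trans)
  show ?thesis
  proof (rule that)
    show "1 \<le> C" using D0 by (simp add: C_def)
    fix t :: real assume t: "0 < t"
    show "b0 t \<le> C * chi0 t" using D0 chi0_pos[OF t] t by (intro *[of _ D0]) (auto simp: C_def)
    show "b1 t \<le> C * hh t" using D1 hh_pos[OF t] t by (intro *[of _ D1]) (auto simp: C_def)
    show "hh t * a1 t \<le> C * chi1 t" using D2 chi1_pos[OF t] t by (intro *[of _ D2]) (auto simp: C_def)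
  qed
qed

end

section \<open>Quasi-concave functions and the terms of Holmstedt's formula\<close>

text \<open>Finiteness, monotonicity and the decrease of \<open>k u / u\<close> are what is used of
  a K-functional. Monotonicity is demanded on the whole line to obtain Borel measurability; a
  K-functional complies because \<open>ennreal\<close> truncates negative arguments to 0.\<close>

definition qc :: "(real \<Rightarrow> ennreal) \<Rightarrow> bool" where
  "qc k \<longleftrightarrow> (\<forall>u. k u < top) \<and> mono k \<and> (\<forall>u v. 0 < u \<longrightarrow> u \<le> v \<longrightarrow> k v \<le> ennreal (v / u) * k u)"

lemma qc_measurable [measurable_dest]: "qc k \<Longrightarrow> k \<in> borel_measurable borel"
  unfolding qc_def by (intro borel_measurable_mono_ennreal) auto

lemma qc_mono: "qc k \<Longrightarrow> u \<le> v \<Longrightarrow> k u \<le> k v"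
  unfolding qc_def by (auto dest: monoD)

lemma qc_ratio: "qc k \<Longrightarrow> 0 < u \<Longrightarrow> u \<le> v \<Longrightarrow> k v \<le> ennreal (v / u) * k u"
  unfolding qc_def by blast

lemma ennreal_assoc: "0 \<le> x \<Longrightarrow> ennreal x * (ennreal y * z) = ennreal (x * y) * z"
  by (simp add: ennreal_mult' mult.assoc)

lemma ennreal_scale_mono: "x \<le> y \<Longrightarrow> ennreal x * z \<le> ennreal y * z"
  by (intro mult_right_mono ennreal_leI) auto

lemma qc_decr:
  assumes k: "qc k" and u: "0 < u" "u \<le> v"
  shows "ennreal (1 / v) * k v \<le> ennreal (1 / u) * k u"
proof -
  have "ennreal (1 / v) * k v \<le> ennreal (1 / v) * (ennreal (v / u) * k u)"
    using qc_ratio[OF k u] by (intro mult_left_mono) auto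
  also have "\<dots> = ennreal (1 / u) * k u"
    using u by (simp add: ennreal_assoc)
  finally show ?thesis .
qed

lemma le_cmult_mono:
  fixes x y c C :: ennreal
  shows "x \<le> c * y \<Longrightarrow> c \<le> C \<Longrightarrow> x \<le> C * y"
  by (meson mult_right_mono order_trans zero_le)

lemma mult_cmult_mono:
  fixes x y c w :: ennreal
  shows "x \<le> c * y \<Longrightarrow> w * x \<le> c * (w * y)"
  by (metis mult.left_commute mult_left_mono zero_le)

text \<open>\<open>\<sigma> u / u\<close> decays like a power, so a norm over \<open>{t<..}\<close>
  is governed by the left end of the interval, whatever the exponent.\<close>

lemma mn_tail_slow:
  assumes q: "0 < q" and \<sigma>: "slow \<sigma>"
  obtains C where "C < top"
    "\<And>f m t. 0 < t \<Longrightarrow> (\<And>u. t < u \<Longrightarrow> f u \<le> ennreal (\<sigma> u / u) * m) \<Longrightarrow>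
      mn q {t<..} f \<le> C * (ennreal (\<sigma> t / t) * m)"
proof -
  obtain D where D: "1 \<le> D"
    "\<And>u t. 0 < t \<Longrightarrow> t \<le> u \<Longrightarrow> u powr (- 1) * \<sigma> u \<le> D * dst u t powr (- (1 / 2)) * (t powr (- 1) * \<sigma> t)"
    using slow_decay[OF \<sigma>, of 1] by (metis zero_less_one)
  show ?thesis
  proof (rule that)
    show "ennreal D * Pq (1 / 2) q < top" by (simp add: ennreal_mult_less_top)
    fix f m and t :: real
    assume t: "0 < t" and f: "\<And>u. t < u \<Longrightarrow> f u \<le> ennreal (\<sigma> u / u) * m"
    have "mn q {t<..} f \<le> (ennreal (D * (\<sigma> t / t)) * m) * Pq (1 / 2) q"
    proof (rule mn_decay[OF q _ t])
      fix u assume u: "0 < u" "u \<in> {t<..}"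
      have "f u \<le> ennreal (dst u t powr (- (1 / 2)) * (D * (\<sigma> t / t))) * m"
        using D(2)[OF t, of u] u t f[of u]
        by (intro order_trans[OF f] ennreal_scale_mono) (auto simp: powr_minus field_simps)
      then show "f u \<le> (ennreal (D * (\<sigma> t / t)) * m) * ennreal (dst u t powr (- (1 / 2)))"
        unfolding ennreal_mult'[OF powr_ge_zero] by (simp only: mult_ac)
    qed simp
    moreover have "ennreal (D * (\<sigma> t / t)) = ennreal D * ennreal (\<sigma> t / t)"
      using D(1) by (intro ennreal_mult') simp
    ultimately show "mn q {t<..} f \<le> (ennreal D * Pq (1 / 2) q) * (ennreal (\<sigma> t / t) * m)"
      by (simp only: mult_ac)
  qed
qed

text \<open>The mirror image: \<open>u * \<sigma> u\<close> grows like a power, so a norm over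
  \<open>{0<..<t}\<close> is governed by the right end.\<close>

lemma mn_head_slow:
  assumes q: "0 < q" and \<sigma>: "slow \<sigma>"
  obtains C where "C < top"
    "\<And>f m t. 0 < t \<Longrightarrow> (\<And>u. 0 < u \<Longrightarrow> u < t \<Longrightarrow> f u \<le> ennreal (u * \<sigma> u) * m) \<Longrightarrow>
      mn q {0<..<t} f \<le> C * (ennreal (t * \<sigma> t) * m)"
proof -
  obtain D where D: "1 \<le> D"
    "\<And>u t. 0 < u \<Longrightarrow> u \<le> t \<Longrightarrow> u powr 1 * \<sigma> u \<le> D * dst u t powr (- (1 / 2)) * (t powr 1 * \<sigma> t)"
    using slow_decay[OF \<sigma>, of 1] by (metis zero_less_one)
  show ?thesis
  proof (rule that)
    show "ennreal D * Pq (1 / 2) q < top" by (simp add: ennreal_mult_less_top)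
    fix f m and t :: real
    assume t: "0 < t" and f: "\<And>u. 0 < u \<Longrightarrow> u < t \<Longrightarrow> f u \<le> ennreal (u * \<sigma> u) * m"
    have "mn q {0<..<t} f \<le> (ennreal (D * (t * \<sigma> t)) * m) * Pq (1 / 2) q"
    proof (rule mn_decay[OF q _ t])
      fix u assume u: "0 < u" "u \<in> {0<..<t}"
      have "f u \<le> ennreal (dst u t powr (- (1 / 2)) * (D * (t * \<sigma> t))) * m"
        using D(2)[OF u(1), of t] u t
        by (intro order_trans[OF f] ennreal_scale_mono) (auto simp: mult_ac)
      then show "f u \<le> (ennreal (D * (t * \<sigma> t)) * m) * ennreal (dst u t powr (- (1 / 2)))"
        unfolding ennreal_mult'[OF powr_ge_zero] by (simp only: mult_ac)
    qed simp
    moreover have "ennreal (D * (t * \<sigma> t)) = ennreal D * ennreal (t * \<sigma> t)"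
      using D(1) by (intro ennreal_mult') simp
    ultimately show "mn q {0<..<t} f \<le> (ennreal D * Pq (1 / 2) q) * (ennreal (t * \<sigma> t) * m)"
      by (simp only: mult_ac)
  qed
qed

section \<open>Bounds between the four terms and the two endpoint norms\<close>

context endpoint_weights
begin

definition rr :: "real \<Rightarrow> real" where
  "rr t = t * (chi0 t / chi1 t)"

text \<open>The inner norm of the space \<open>X1\<close> in Haar form; the divisor \<open>u\<close>
  is the power belonging to \<theta> = 1.\<close>

definition PP :: "(real \<Rightarrow> ennreal) \<Rightarrow> real \<Rightarrow> ennreal" where
  "PP k s = mn q1 {s<..} (\<lambda>u. ennreal (a1 u / u) * k u)"

definition N0 :: "(real \<Rightarrow> ennreal) \<Rightarrow> ennreal" where
  "N0 k = mn r0 {0<..} (\<lambda>u. ennreal (b0 u) * k u)"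

definition N1 :: "(real \<Rightarrow> ennreal) \<Rightarrow> ennreal" where
  "N1 k = mn r1 {0<..} (\<lambda>s. ennreal (b1 s) * PP k s)"

definition T1 :: "(real \<Rightarrow> ennreal) \<Rightarrow> real \<Rightarrow> ennreal" where
  "T1 k t = mn r0 {0<..<t} (\<lambda>u. ennreal (b0 u) * k u)"

definition T2 :: "(real \<Rightarrow> ennreal) \<Rightarrow> real \<Rightarrow> ennreal" where
  "T2 k t = ennreal (chi0 t) * k t"

definition T3 :: "(real \<Rightarrow> ennreal) \<Rightarrow> real \<Rightarrow> ennreal" where
  "T3 k t = ennreal (rr t * hh t) * PP k t"

definition T4 :: "(real \<Rightarrow> ennreal) \<Rightarrow> real \<Rightarrow> ennreal" where
  "T4 k t = ennreal (rr t) * mn r1 {t<..} (\<lambda>s. ennreal (b1 s) * PP k s)"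

text \<open>
  In terms of \<open>k = K(\<cdot>, f; A\<^sub>0, A\<^sub>1)\<close>, the norms of \<open>f\<close> in the two endpoint spaces are \<open>N0 k\<close> and \<open>N1 k\<close>,
  and \<open>TT k t\<close> will be equivalent to the K-functional of these spaces at \<open>rr t = \<rho>(t)\<close>.
\<close>

definition TT :: "(real \<Rightarrow> ennreal) \<Rightarrow> real \<Rightarrow> ennreal" where
  "TT k t = T1 k t + T2 k t + T3 k t + T4 k t"

lemma slow_sigma: "slow (\<lambda>t. chi0 t / chi1 t)"
  by (intro slow_divide slow_chi0 slow_chi1)

lemma rr_pos: "0 < t \<Longrightarrow> 0 < rr t"
  unfolding rr_def using chi0_pos chi1_pos by simp

lemma measurable_rr [measurable]: "rr \<in> borel_measurable borel"
  unfolding rr_def[abs_def] by measurable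

lemma measurable_PP [measurable]: "PP k \<in> borel_measurable borel"
  unfolding PP_def[abs_def] by (rule measurable_mn_Ioi[OF q1])

lemma PP_antimono: "s \<le> t \<Longrightarrow> PP k t \<le> PP k s"
  unfolding PP_def by (intro mn_mono q1) auto

lemma measurable_T [measurable]:
  assumes [measurable]: "k \<in> borel_measurable borel"
  shows "T1 k \<in> borel_measurable borel" "T2 k \<in> borel_measurable borel"
    "T3 k \<in> borel_measurable borel" "T4 k \<in> borel_measurable borel"
proof -
  show "T1 k \<in> borel_measurable borel"
    unfolding T1_def[abs_def] by (rule measurable_mn_Ioo_right[OF r0])
  show "T2 k \<in> borel_measurable borel" unfolding T2_def[abs_def] by measurable
  show "T3 k \<in> borel_measurable borel" unfolding T3_def[abs_def] by measurable
  have [measurable]: "(\<lambda>t. mn r1 {t<..} (\<lambda>s. ennreal (b1 s) * PP k s)) \<in> borel_measurable borel"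
    by (rule measurable_mn_Ioi[OF r1])
  show "T4 k \<in> borel_measurable borel" unfolding T4_def[abs_def] by measurable
qed

text \<open>\<open>k'\<close> stands for the K-functional of the first summand of a nearly optimal
  decomposition at \<open>t\<close>. Beyond \<open>t\<close> its bound is constant, so
  \<open>k t\<close> leaves the norm and the tail norm of \<open>b0\<close>, which is
  \<open>chi0 t\<close>, remains.\<close>

lemma N0_upper:
  assumes k: "qc k" and t: "0 < t" and le: "\<And>u. 0 < u \<Longrightarrow> k' u \<le> c * k (min u t)"
  shows "N0 k' \<le> (Kq r0 * c) * (T1 k t + T2 k t)"
proof -
  have [measurable]: "k \<in> borel_measurable borel" using k by (rule qc_measurable)
  have "N0 k' \<le> Kq r0 * (mn r0 {0<..<t} (\<lambda>u. c * (ennreal (b0 u) * k u))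
      + mn r0 {t<..} (\<lambda>u. (c * k t) * ennreal (b0 u)))"
    unfolding N0_def
  proof (rule mn_split[OF r0, where t = t])
    fix u assume u: "0 < u" "u \<noteq> t"
    have "ennreal (b0 u) * k' u \<le> ennreal (b0 u) * (c * k (min u t))"
      using le[OF u(1)] by (intro mult_left_mono) auto
    then show "u \<in> {0<..<t} \<and> ennreal (b0 u) * k' u \<le> c * (ennreal (b0 u) * k u) \<or>
       u \<in> {t<..} \<and> ennreal (b0 u) * k' u \<le> c * k t * ennreal (b0 u)"
      using u by (cases "u < t") (auto simp: mult_ac min_def)
  qed auto
  also have "mn r0 {0<..<t} (\<lambda>u. c * (ennreal (b0 u) * k u)) = c * T1 k t"
    unfolding T1_def by (rule mn_cmult[OF r0]) auto
  also have "mn r0 {t<..} (\<lambda>u. (c * k t) * ennreal (b0 u)) = c * T2 k t"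
    unfolding T2_def ennreal_chi0[OF t] E0_def by (subst mn_cmult[OF r0]) (auto simp: mult_ac)
  finally show ?thesis by (simp add: distrib_left mult.assoc)
qed

text \<open>\<open>k'\<close> stands for the K-functional of the second summand. Below
  \<open>t\<close> the factor \<open>u / t\<close> cancels the divisor \<open>u\<close> in
  \<open>PP\<close>; then \<open>k t / t\<close> comes out, and the norms of \<open>a1\<close> over
  \<open>(s, t)\<close> and of \<open>b1\<close> over \<open>(0, t)\<close> form
  \<open>E1 t\<close>. What the inner norm collects beyond \<open>t\<close> is
  \<open>PP k t\<close>, independent of \<open>s\<close>, and its outer norm produces
  \<open>EH t\<close>.\<close>

lemma N1_upper:
  assumes k: "qc k" and t: "0 < t"
    and le: "\<And>u. t < u \<Longrightarrow> k' u \<le> c * k u"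
      "\<And>u. 0 < u \<Longrightarrow> u < t \<Longrightarrow> k' u \<le> c * (ennreal (u / t) * k t)"
  shows "ennreal (rr t) * N1 k' \<le> (Kq r1 * c * (2 * Kq q1 * Kq r1 + 1)) * (T2 k t + T3 k t + T4 k t)"
proof -
  have [measurable]: "k \<in> borel_measurable borel" using k by (rule qc_measurable)
  let ?I = "\<lambda>s. mn q1 {s<..<t} (\<lambda>u. ennreal (a1 u))"
  let ?kt = "ennreal (1 / t) * k t"
  have large: "PP k' s \<le> c * PP k s" if "t \<le> s" for s
    unfolding PP_def
  proof (rule mn_le_cmult[OF q1])
    fix u assume "u \<in> {s<..}"
    then show "u \<in> {s<..} \<and> ennreal (a1 u / u) * k' u \<le> c * (ennreal (a1 u / u) * k u)"
      using that by (auto intro!: mult_cmult_mono le(1))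
  qed auto
  have small: "PP k' s \<le> (Kq q1 * c) * (?kt * ?I s + PP k t)" if s: "0 < s" "s < t" for s
  proof -
    have "PP k' s \<le> Kq q1 * (mn q1 {s<..<t} (\<lambda>u. (c * ?kt) * ennreal (a1 u))
        + mn q1 {t<..} (\<lambda>u. c * (ennreal (a1 u / u) * k u)))"
      unfolding PP_def
    proof (rule mn_split[OF q1, where t = t])
      fix u assume u: "0 < u" "u \<in> {s<..}" "u \<noteq> t"
      show "u \<in> {s<..<t} \<and> ennreal (a1 u / u) * k' u \<le> (c * ?kt) * ennreal (a1 u) \<or>
        u \<in> {t<..} \<and> ennreal (a1 u / u) * k' u \<le> c * (ennreal (a1 u / u) * k u)"
      proof (cases "u < t")
        case True
        have "ennreal (a1 u / u) * k' u \<le> ennreal (a1 u / u) * (c * (ennreal (u / t) * k t))"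
          using le(2)[OF u(1) True] by (intro mult_left_mono) auto
        also have "\<dots> = c * (ennreal (a1 u / u) * (ennreal (u / t) * k t))" by (simp add: mult_ac)
        also have "ennreal (a1 u / u) * (ennreal (u / t) * k t) = ennreal (a1 u) * ?kt"
          using u slow_pos[OF slow_a1 u(1)] t by (simp add: ennreal_assoc)
        finally show ?thesis using True u by (simp add: mult_ac)
      next
        case False
        then show ?thesis
          using u by (auto intro!: mult_cmult_mono le(1))
      qed
    qed auto
    also have "mn q1 {s<..<t} (\<lambda>u. (c * ?kt) * ennreal (a1 u)) = (c * ?kt) * ?I s"
      by (rule mn_cmult[OF q1]) auto
    also have "mn q1 {t<..} (\<lambda>u. c * (ennreal (a1 u / u) * k u)) = c * PP k t"
      unfolding PP_def by (rule mn_cmult[OF q1]) auto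
    finally show ?thesis by (simp add: distrib_left mult.assoc)
  qed
  have "N1 k' \<le> Kq r1 * (mn r1 {0<..<t} (\<lambda>s. (Kq q1 * c) * (?kt * (ennreal (b1 s) * ?I s) + PP k t * ennreal (b1 s)))
        + mn r1 {t<..} (\<lambda>s. c * (ennreal (b1 s) * PP k s)))"
    unfolding N1_def
  proof (rule mn_split[OF r1, where t = t])
    fix s assume s: "0 < s" "s \<noteq> t"
    show "s \<in> {0<..<t} \<and> ennreal (b1 s) * PP k' s \<le> (Kq q1 * c) * (?kt * (ennreal (b1 s) * ?I s) + PP k t * ennreal (b1 s)) \<or>
      s \<in> {t<..} \<and> ennreal (b1 s) * PP k' s \<le> c * (ennreal (b1 s) * PP k s)"
    proof (cases "s < t")
      case True
      have "ennreal (b1 s) * PP k' s \<le> ennreal (b1 s) * ((Kq q1 * c) * (?kt * ?I s + PP k t))"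
        using small[OF s(1) True] by (intro mult_left_mono) auto
      also have "\<dots> = (Kq q1 * c) * (?kt * (ennreal (b1 s) * ?I s) + PP k t * ennreal (b1 s))"
        by (simp add: distrib_left mult_ac)
      finally show ?thesis using True s by simp
    next
      case False
      then show ?thesis
        using s by (auto intro!: mult_cmult_mono large)
    qed
  qed (measurable, auto)
  also have "mn r1 {0<..<t} (\<lambda>s. (Kq q1 * c) * (?kt * (ennreal (b1 s) * ?I s) + PP k t * ennreal (b1 s)))
     = (Kq q1 * c) * mn r1 {0<..<t} (\<lambda>s. ?kt * (ennreal (b1 s) * ?I s) + PP k t * ennreal (b1 s))"
    by (rule mn_cmult[OF r1]) measurable
  also have "mn r1 {t<..} (\<lambda>s. c * (ennreal (b1 s) * PP k s)) = c * mn r1 {t<..} (\<lambda>s. ennreal (b1 s) * PP k s)"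
    by (rule mn_cmult[OF r1]) measurable
  also have "mn r1 {0<..<t} (\<lambda>s. ?kt * (ennreal (b1 s) * ?I s) + PP k t * ennreal (b1 s))
     \<le> 2 * Kq r1 * (mn r1 {0<..<t} (\<lambda>s. ?kt * (ennreal (b1 s) * ?I s)) + mn r1 {0<..<t} (\<lambda>s. PP k t * ennreal (b1 s)))"
    by (rule mn_add[OF r1]) measurable
  also have "mn r1 {0<..<t} (\<lambda>s. ?kt * (ennreal (b1 s) * ?I s)) = ?kt * E1 t"
    unfolding E1_def by (rule mn_cmult[OF r1]) measurable
  also have "mn r1 {0<..<t} (\<lambda>s. PP k t * ennreal (b1 s)) = PP k t * EH t"
    unfolding EH_def by (rule mn_cmult[OF r1]) measurable
  finally have "N1 k' \<le> Kq r1 * (Kq q1 * c * (2 * Kq r1 * (?kt * E1 t + PP k t * EH t))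
     + c * mn r1 {t<..} (\<lambda>s. ennreal (b1 s) * PP k s))"
    by (simp add: mult_left_mono add_right_mono)
  then have "ennreal (rr t) * N1 k' \<le> ennreal (rr t) * (Kq r1 * (Kq q1 * c * (2 * Kq r1 * (?kt * E1 t + PP k t * EH t))
     + c * mn r1 {t<..} (\<lambda>s. ennreal (b1 s) * PP k s)))"
    by (rule mult_left_mono) simp
  also have "\<dots> = Kq r1 * (Kq q1 * c * (2 * Kq r1 * (ennreal (rr t) * (?kt * E1 t) + ennreal (rr t) * (PP k t * EH t)))
     + c * (ennreal (rr t) * mn r1 {t<..} (\<lambda>s. ennreal (b1 s) * PP k s)))"
    by (simp add: distrib_left mult_ac)
  \<comment> \<open>This identity explains the choice of \<open>\<rho>\<close>:
    \<open>rr t * chi1 t / t = chi0 t\<close>, so both endpoint norms lead to the same term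
    \<open>T2\<close>.\<close>
  also have "ennreal (rr t) * (?kt * E1 t) = T2 k t"
  proof -
    have "ennreal (rr t) * (?kt * E1 t) = ennreal (rr t) * (ennreal (1 / t) * (ennreal (chi1 t) * k t))"
      using t by (simp add: ennreal_chi1 mult_ac)
    also have "\<dots> = ennreal (rr t * (1 / t * chi1 t)) * k t"
      using t rr_pos[OF t] by (simp add: ennreal_assoc mult.assoc)
    also have "rr t * (1 / t * chi1 t) = chi0 t"
      using t chi1_pos[OF t] by (simp add: rr_def)
    finally show ?thesis by (simp add: T2_def)
  qed
  also have "ennreal (rr t) * (PP k t * EH t) = T3 k t"
    unfolding T3_def ennreal_hh[OF t, symmetric] using rr_pos[OF t]
    by (subst ennreal_assoc[symmetric]) (auto simp: mult.commute)
  also have "ennreal (rr t) * mn r1 {t<..} (\<lambda>s. ennreal (b1 s) * PP k s) = T4 k t"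
    by (simp add: T4_def)
  finally have "ennreal (rr t) * N1 k' \<le>
      Kq r1 * c * (2 * Kq q1 * Kq r1 * (T2 k t + T3 k t) + T4 k t)"
    by (simp add: distrib_left mult_ac)
  also have "\<dots> \<le> Kq r1 * c * ((2 * Kq q1 * Kq r1 + 1) * (T2 k t + T3 k t) + (2 * Kq q1 * Kq r1 + 1) * T4 k t)"
    by (intro mult_left_mono add_mono mult_right_mono) (auto simp: distrib_right)
  finally show ?thesis by (simp only: distrib_left[symmetric] mult.assoc)
qed

text \<open>On \<open>{t<..}\<close> the function \<open>k\<close> is at least \<open>k t\<close>,
  and the remaining norm of \<open>b0\<close> is \<open>chi0 t\<close>.\<close>

lemma le_N0:
  assumes k: "qc k" and t: "0 < t"
  shows "T2 k t \<le> N0 k"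
proof -
  have "T2 k t = mn r0 {t<..} (\<lambda>u. k t * ennreal (b0 u))"
    unfolding T2_def ennreal_chi0[OF t] E0_def by (subst mn_cmult[OF r0]) (auto simp: mult.commute)
  also have "\<dots> \<le> N0 k"
    unfolding N0_def
    using t by (intro mn_mono r0) (auto simp: mult.commute[of _ "ennreal _"] intro!: mult_left_mono qc_mono[OF k])
  finally show ?thesis .
qed

text \<open>For \<open>u < t\<close> the quotient \<open>k u / u\<close> is at least
  \<open>k t / t\<close>. Restricting both norms to arguments below \<open>t\<close> therefore
  leaves \<open>k t / t\<close> times \<open>E1 t\<close>.\<close>

lemma le_N1:
  assumes k: "qc k" and t: "0 < t"
  shows "T2 k t \<le> ennreal (rr t) * N1 k"
proof -
  let ?kt = "ennreal (1 / t) * k t"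
  let ?I = "\<lambda>s. mn q1 {s<..<t} (\<lambda>u. ennreal (a1 u))"
  have I: "?kt * ?I s \<le> PP k s" if s: "0 < s" for s
  proof -
    have "?kt * ?I s = mn q1 {s<..<t} (\<lambda>u. ?kt * ennreal (a1 u))"
      by (rule mn_cmult[symmetric, OF q1]) auto
    also have "\<dots> \<le> PP k s" unfolding PP_def
    proof (rule mn_mono[OF q1])
      fix u assume u: "0 < u" "u \<in> {s<..<t}"
      have "?kt * ennreal (a1 u) \<le> (ennreal (1 / u) * k u) * ennreal (a1 u)"
        using qc_decr[OF k u(1), of t] u by (intro mult_right_mono) auto
      also have "\<dots> = ennreal (a1 u) * (ennreal (1 / u) * k u)" by (rule mult.commute)
      also have "\<dots> = ennreal (a1 u / u) * k u"
        using slow_pos[OF slow_a1 u(1)] by (simp add: ennreal_assoc)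
      finally show "u \<in> {s<..} \<and> ?kt * ennreal (a1 u) \<le> ennreal (a1 u / u) * k u" using u by auto
    qed
    finally show ?thesis .
  qed
  have "?kt * E1 t = mn r1 {0<..<t} (\<lambda>s. ?kt * (ennreal (b1 s) * ?I s))"
    unfolding E1_def by (rule mn_cmult[symmetric, OF r1]) measurable
  also have "\<dots> \<le> N1 k"
    unfolding N1_def
    using I by (intro mn_mono r1) (auto simp: mult.left_commute intro!: mult_left_mono)
  finally have *: "?kt * E1 t \<le> N1 k" .
  have "ennreal (rr t) * (?kt * E1 t) = ennreal (rr t) * (ennreal (1 / t) * (ennreal (chi1 t) * k t))"
    using t by (simp add: ennreal_chi1 mult_ac)
  also have "\<dots> = ennreal (rr t * (1 / t * chi1 t)) * k t"
    using t rr_pos[OF t] by (simp add: ennreal_assoc mult.assoc)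
  also have "rr t * (1 / t * chi1 t) = chi0 t"
    using t chi1_pos[OF t] by (simp add: rr_def)
  finally have "T2 k t = ennreal (rr t) * (?kt * E1 t)" by (simp add: T2_def)
  also have "\<dots> \<le> ennreal (rr t) * N1 k" using * by (rule mult_left_mono) simp
  finally show ?thesis .
qed

text \<open>\<open>T1\<close> is part of \<open>N0\<close>, and \<open>T2\<close> is covered by
  \<open>le_N0\<close>. In \<open>T3\<close> and \<open>T4\<close> the bound
  \<open>k u \<le> N0 k / chi0 u\<close> is inserted under the norms; the resulting weights are
  slowly varying divided by \<open>u\<close>, so the tail norms collapse to their values at
  \<open>t\<close>.\<close>

lemma TT_le_N0:
  obtains C where "C < top" "\<And>k t. qc k \<Longrightarrow> 0 < t \<Longrightarrow> TT k t \<le> C * N0 k"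
proof -
  obtain C where C: "1 \<le> C" "\<And>t. 0 < t \<Longrightarrow> b0 t \<le> C * chi0 t" "\<And>t. 0 < t \<Longrightarrow> b1 t \<le> C * hh t"
    "\<And>t. 0 < t \<Longrightarrow> hh t * a1 t \<le> C * chi1 t"
    using weight_bounds by metis
  \<comment> \<open>The weight of \<open>PP\<close> after inserting the bound by \<open>N0\<close>.
    At \<open>t\<close> the product \<open>rr t * hh t * v t / t\<close> is
    \<open>hh t * a1 t / chi1 t\<close>, which \<open>weight_bounds\<close> controls.\<close>
  define v where "v = (\<lambda>u. a1 u / chi0 u)"
  have v: "slow v" unfolding v_def by (intro slow_divide slow_a1 slow_chi0)
  have bv: "slow (\<lambda>u. b1 u * v u)" by (intro slow_mult v slow_b1)
  obtain P where P: "P < top"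
    "\<And>f m t. 0 < t \<Longrightarrow> (\<And>u. t < u \<Longrightarrow> f u \<le> ennreal (v u / u) * m) \<Longrightarrow>
      mn q1 {t<..} f \<le> P * (ennreal (v t / t) * m)"
    using mn_tail_slow[OF q1 v] by blast
  obtain Q where Q: "Q < top"
    "\<And>f m t. 0 < t \<Longrightarrow> (\<And>u. t < u \<Longrightarrow> f u \<le> ennreal (b1 u * v u / u) * m) \<Longrightarrow>
      mn r1 {t<..} f \<le> Q * (ennreal (b1 t * v t / t) * m)"
    using mn_tail_slow[OF r1 bv] by blast
  have PPb: "PP k t \<le> P * (ennreal (v t / t) * N0 k)" if k: "qc k" and t: "0 < t" for k t
    unfolding PP_def
  proof (rule P(2)[OF t])
    fix u assume "t < u"
    then have u: "0 < u" using t by simp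
    have "ennreal (v u / u) * T2 k u = ennreal (v u / u * chi0 u) * k u"
      unfolding T2_def using u slow_pos[OF v u] by (intro ennreal_assoc) simp
    also have "v u / u * chi0 u = a1 u / u" using chi0_pos[OF u] by (simp add: v_def)
    finally have "ennreal (a1 u / u) * k u = ennreal (v u / u) * T2 k u" ..
    also have "\<dots> \<le> ennreal (v u / u) * N0 k" using le_N0[OF k u] by (rule mult_left_mono) simp
    finally show "ennreal (a1 u / u) * k u \<le> ennreal (v u / u) * N0 k" .
  qed
  have t3: "T3 k t \<le> P * ennreal C * N0 k" if k: "qc k" and t: "0 < t" for k t
  proof -
    have "T3 k t \<le> P * (ennreal (rr t * hh t) * (ennreal (v t / t) * N0 k))"
      unfolding T3_def by (rule mult_cmult_mono[OF PPb[OF k t]])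
    also have "ennreal (rr t * hh t) * (ennreal (v t / t) * N0 k) = ennreal (rr t * hh t * (v t / t)) * N0 k"
      using rr_pos[OF t] hh_pos[OF t] by (intro ennreal_assoc) simp
    also have "\<dots> \<le> ennreal C * N0 k"
      using C(4)[OF t] chi0_pos[OF t] chi1_pos[OF t] t
      by (intro ennreal_scale_mono) (simp add: rr_def v_def field_simps)
    finally show ?thesis by (simp add: mult.assoc mult_left_mono)
  qed
  have t4: "T4 k t \<le> P * Q * ennreal (C * C) * N0 k" if k: "qc k" and t: "0 < t" for k t
  proof -
    have "mn r1 {t<..} (\<lambda>s. ennreal (b1 s) * PP k s) \<le> Q * (ennreal (b1 t * v t / t) * (P * N0 k))"
    proof (rule Q(2)[OF t])
      fix u assume "t < u"
      then have u: "0 < u" using t by simp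
      have "ennreal (b1 u) * PP k u \<le> P * (ennreal (b1 u) * (ennreal (v u / u) * N0 k))"
        by (rule mult_cmult_mono[OF PPb[OF k u]])
      also have "ennreal (b1 u) * (ennreal (v u / u) * N0 k) = ennreal (b1 u * v u / u) * N0 k"
        using slow_pos[OF slow_b1 u] by (simp add: ennreal_assoc)
      finally show "ennreal (b1 u) * PP k u \<le> ennreal (b1 u * v u / u) * (P * N0 k)"
        by (simp only: mult_ac)
    qed
    then have "T4 k t \<le> Q * (ennreal (rr t) * (ennreal (b1 t * v t / t) * (P * N0 k)))"
      unfolding T4_def by (rule mult_cmult_mono)
    also have "ennreal (rr t) * (ennreal (b1 t * v t / t) * (P * N0 k)) = ennreal (rr t * (b1 t * v t / t)) * (P * N0 k)"
      using rr_pos[OF t] by (intro ennreal_assoc) simp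
    also have "\<dots> \<le> ennreal (C * C) * (P * N0 k)"
    proof (rule ennreal_scale_mono)
      have "b1 t * a1 t \<le> C * hh t * a1 t"
        using C(3)[OF t] slow_pos[OF slow_a1 t] by (intro mult_right_mono) auto
      also have "\<dots> \<le> C * (C * chi1 t)"
        using C(4)[OF t] C(1) by (simp add: mult.assoc mult_left_mono)
      finally show "rr t * (b1 t * v t / t) \<le> C * C"
        using chi0_pos[OF t] chi1_pos[OF t] t by (simp add: rr_def v_def field_simps)
    qed
    finally have "T4 k t \<le> Q * (ennreal (C * C) * (P * N0 k))" by (simp add: mult_left_mono)
    then show ?thesis by (simp only: mult_ac)
  qed
  show ?thesis
  proof (rule that)
    show "1 + 1 + P * ennreal C + P * Q * ennreal (C * C) < top"
      using P Q by (simp add: ennreal_mult_less_top)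
    fix k t assume k: "qc k" and t: "0 < (t::real)"
    have "T1 k t \<le> 1 * N0 k" using t by (simp add: T1_def N0_def mn_mono r0)
    moreover have "T2 k t \<le> 1 * N0 k" using le_N0[OF k t] by simp
    ultimately have "TT k t \<le> 1 * N0 k + 1 * N0 k + P * ennreal C * N0 k + P * Q * ennreal (C * C) * N0 k"
      unfolding TT_def by (intro add_mono t3[OF k t] t4[OF k t])
    then show "TT k t \<le> (1 + 1 + P * ennreal C + P * Q * ennreal (C * C)) * N0 k" by (simp only: distrib_right)
  qed
qed

text \<open>\<open>T3\<close> and \<open>T4\<close> come from restricting the outer norm of
  \<open>N1\<close> to either side of \<open>t\<close>. \<open>T1\<close> requires the bound
  \<open>k u \<le> u * N1 k / chi1 u\<close>, after which the integrand grows like a power and the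
  head norm collapses to its value at \<open>t\<close>.\<close>

lemma TT_le_N1:
  obtains C where "C < top" "\<And>k t. qc k \<Longrightarrow> 0 < t \<Longrightarrow> TT k t \<le> C * (ennreal (rr t) * N1 k)"
proof -
  obtain C where C: "1 \<le> C" "\<And>t. 0 < t \<Longrightarrow> b0 t \<le> C * chi0 t"
    using weight_bounds by metis
  have v: "slow (\<lambda>u. b0 u / chi1 u)" by (intro slow_divide slow_b0 slow_chi1)
  obtain P where P: "P < top"
    "\<And>f m t. 0 < t \<Longrightarrow> (\<And>u. 0 < u \<Longrightarrow> u < t \<Longrightarrow> f u \<le> ennreal (u * (b0 u / chi1 u)) * m) \<Longrightarrow>
      mn r0 {0<..<t} f \<le> P * (ennreal (t * (b0 t / chi1 t)) * m)"
    using mn_head_slow[OF r0 v] by blast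
  have t1: "T1 k t \<le> P * ennreal C * (ennreal (rr t) * N1 k)" if k: "qc k" and t: "0 < t" for k t
  proof -
    have "T1 k t \<le> P * (ennreal (t * (b0 t / chi1 t)) * N1 k)"
      unfolding T1_def
    proof (rule P(2)[OF t])
      fix u :: real assume u: "0 < u"
      note p = slow_pos[OF slow_b0 u] chi0_pos[OF u]
      have "ennreal (b0 u) * k u = ennreal (b0 u / chi0 u) * T2 k u"
        using p by (simp add: T2_def ennreal_assoc)
      also have "\<dots> \<le> ennreal (b0 u / chi0 u) * (ennreal (rr u) * N1 k)"
        using le_N1[OF k u] by (intro mult_left_mono) auto
      also have "\<dots> = ennreal (b0 u / chi0 u * rr u) * N1 k"
        using p by (intro ennreal_assoc) simp
      also have "b0 u / chi0 u * rr u = u * (b0 u / chi1 u)"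
        using p by (simp add: rr_def)
      finally show "ennreal (b0 u) * k u \<le> ennreal (u * (b0 u / chi1 u)) * N1 k" .
    qed
    also have "ennreal (t * (b0 t / chi1 t)) * N1 k \<le> ennreal (C * rr t) * N1 k"
      using C(2)[OF t] chi1_pos[OF t] t
      by (intro ennreal_scale_mono) (simp add: rr_def field_simps)
    also have "\<dots> = ennreal C * (ennreal (rr t) * N1 k)"
      using C(1) by (simp add: ennreal_assoc)
    finally show ?thesis by (simp add: mult.assoc mult_left_mono)
  qed
  have t3: "T3 k t \<le> ennreal (rr t) * N1 k" if k: "qc k" and t: "0 < t" for k t
  proof -
    have "EH t * PP k t = mn r1 {0<..<t} (\<lambda>s. PP k t * ennreal (b1 s))"
      unfolding EH_def by (subst mn_cmult[OF r1]) (auto simp: mult.commute)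
    also have "\<dots> \<le> N1 k" unfolding N1_def
      using t by (intro mn_mono r1) (auto simp: mult.commute intro!: mult_left_mono PP_antimono)
    finally have "ennreal (rr t) * (EH t * PP k t) \<le> ennreal (rr t) * N1 k"
      by (rule mult_left_mono) simp
    then show ?thesis
      unfolding T3_def using rr_pos[OF t] t by (simp add: ennreal_mult' ennreal_hh mult.assoc)
  qed
  have t4: "T4 k t \<le> ennreal (rr t) * N1 k" if "0 < t" for k t
    unfolding T4_def N1_def using that by (intro mult_left_mono mn_mono r1) auto
  show ?thesis
  proof (rule that)
    show "P * ennreal C + 1 + 1 + 1 < top" using P by (simp add: ennreal_mult_less_top)
    fix k t assume k: "qc k" and t: "0 < (t::real)"
    have "TT k t \<le> P * ennreal C * (ennreal (rr t) * N1 k) + 1 * (ennreal (rr t) * N1 k)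
        + 1 * (ennreal (rr t) * N1 k) + 1 * (ennreal (rr t) * N1 k)"
      unfolding TT_def using t1[OF k t] le_N1[OF k t] t3[OF k t] t4[OF t, of k] by (intro add_mono) auto
    then show "TT k t \<le> (P * ennreal C + 1 + 1 + 1) * (ennreal (rr t) * N1 k)" by (simp only: distrib_right)
  qed
qed

text \<open>Each term is a positive, homogeneous, possibly nested norm, so it is quasi-subadditive
  in \<open>k\<close>. In the lower estimate of Holmstedt's formula this separates the two summands
  of an arbitrary decomposition.\<close>

lemma TT_subadd:
  assumes c: "c < top"
  obtains C where "C < top"
    "\<And>k k0 k1 t. qc k0 \<Longrightarrow> qc k1 \<Longrightarrow> (\<And>u. 0 < u \<Longrightarrow> k u \<le> c * (k0 u + k1 u)) \<Longrightarrow> 0 < t \<Longrightarrow>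
        TT k t \<le> C * (TT k0 t + TT k1 t)"
proof -
  define C1 where "C1 = c * (2 * Kq r0)"
  define CP where "CP = c * (2 * Kq q1)"
  define C4 where "C4 = CP * (2 * Kq r1)"
  define C where "C = C1 + c + CP + C4"
  show ?thesis
  proof (rule that)
    show "C < top" using c by (simp add: C_def C1_def CP_def C4_def ennreal_mult_less_top)
    fix k k0 k1 t
    assume k0: "qc k0" and k1: "qc k1" and le: "\<And>u. 0 < u \<Longrightarrow> k u \<le> c * (k0 u + k1 u)" and t: "0 < (t::real)"
    have [measurable]: "k0 \<in> borel_measurable borel" "k1 \<in> borel_measurable borel"
      using k0 k1 by (auto intro: qc_measurable)
    have w: "ennreal x * k u \<le> c * (ennreal x * k0 u + ennreal x * k1 u)" if "0 < u" for x u
    proof -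
      have "ennreal x * k u \<le> ennreal x * (c * (k0 u + k1 u))" using le[OF that] by (rule mult_left_mono) simp
      then show ?thesis by (simp add: distrib_left mult.left_commute)
    qed
    have P: "PP k s \<le> CP * (PP k0 s + PP k1 s)" if "0 < s" for s
    proof -
      have "PP k s \<le> c * mn q1 {s<..} (\<lambda>u. ennreal (a1 u / u) * k0 u + ennreal (a1 u / u) * k1 u)"
        unfolding PP_def by (rule mn_le_cmult[OF q1]) (use w in auto)
      also have "\<dots> \<le> c * (2 * Kq q1 * (PP k0 s + PP k1 s))"
        unfolding PP_def by (intro mult_left_mono mn_add q1) auto
      finally show ?thesis by (simp add: CP_def mult.assoc)
    qed
    have t1: "T1 k t \<le> C1 * (T1 k0 t + T1 k1 t)"
    proof -
      have "T1 k t \<le> c * mn r0 {0<..<t} (\<lambda>u. ennreal (b0 u) * k0 u + ennreal (b0 u) * k1 u)"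
        unfolding T1_def by (rule mn_le_cmult[OF r0]) (use w in auto)
      also have "\<dots> \<le> c * (2 * Kq r0 * (T1 k0 t + T1 k1 t))"
        unfolding T1_def by (intro mult_left_mono mn_add r0) auto
      finally show ?thesis by (simp add: C1_def mult.assoc)
    qed
    have t2: "T2 k t \<le> c * (T2 k0 t + T2 k1 t)"
      unfolding T2_def by (rule w[OF t])
    have t3: "T3 k t \<le> CP * (T3 k0 t + T3 k1 t)"
    proof -
      have "T3 k t \<le> ennreal (rr t * hh t) * (CP * (PP k0 t + PP k1 t))"
        unfolding T3_def using P[OF t] by (rule mult_left_mono) simp
      then show ?thesis unfolding T3_def by (simp add: distrib_left mult.left_commute)
    qed
    have t4: "T4 k t \<le> C4 * (T4 k0 t + T4 k1 t)"
    proof -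
      have "mn r1 {t<..} (\<lambda>s. ennreal (b1 s) * PP k s)
          \<le> CP * mn r1 {t<..} (\<lambda>s. ennreal (b1 s) * PP k0 s + ennreal (b1 s) * PP k1 s)"
      proof (rule mn_le_cmult[OF r1])
        fix s assume s: "0 < s" "s \<in> {t<..}"
        have "ennreal (b1 s) * PP k s \<le> ennreal (b1 s) * (CP * (PP k0 s + PP k1 s))"
          using P[OF s(1)] by (rule mult_left_mono) simp
        then show "s \<in> {t<..} \<and> ennreal (b1 s) * PP k s \<le> CP * (ennreal (b1 s) * PP k0 s + ennreal (b1 s) * PP k1 s)"
          using s by (simp add: distrib_left mult.left_commute)
      qed measurable
      also have "\<dots> \<le> CP * (2 * Kq r1 * (mn r1 {t<..} (\<lambda>s. ennreal (b1 s) * PP k0 s) + mn r1 {t<..} (\<lambda>s. ennreal (b1 s) * PP k1 s)))"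
        by (intro mult_left_mono mn_add r1) measurable
      finally have "T4 k t \<le> ennreal (rr t) * (C4 * (mn r1 {t<..} (\<lambda>s. ennreal (b1 s) * PP k0 s) + mn r1 {t<..} (\<lambda>s. ennreal (b1 s) * PP k1 s)))"
        unfolding T4_def C4_def mult.assoc by (rule mult_left_mono) simp
      then show ?thesis unfolding T4_def by (simp add: distrib_left mult.left_commute)
    qed
    have c: "C1 \<le> C" "c \<le> C" "CP \<le> C" "C4 \<le> C"
      unfolding C_def by (auto simp: add_increasing add_increasing2)
    have "TT k t \<le> C * (T1 k0 t + T1 k1 t) + C * (T2 k0 t + T2 k1 t) + C * (T3 k0 t + T3 k1 t) + C * (T4 k0 t + T4 k1 t)"
      unfolding TT_def
      by (intro add_mono le_cmult_mono[OF t1 c(1)] le_cmult_mono[OF t2 c(2)] le_cmult_mono[OF t3 c(3)] le_cmult_mono[OF t4 c(4)])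
    also have "\<dots> = C * (TT k0 t + TT k1 t)"
      by (simp add: TT_def distrib_left ac_simps)
    finally show "TT k t \<le> C * (TT k0 t + TT k1 t)" .
  qed
qed

end

section \<open>Hardy-type inequalities\<close>

text \<open>Half of the available decay pays for moving the bound from \<open>u\<close> to the
  centre \<open>t\<close>; the other half is left for \<open>mn_decay\<close>.\<close>

lemma dst_absorb:
  assumes "0 \<le> c" and "Z \<le> ennreal (dst u t powr \<gamma>) * Y"
  shows "ennreal (c * dst u t powr (- (2 * \<gamma>))) * Z \<le> (ennreal c * Y) * ennreal (dst u t powr (- \<gamma>))"
proof -
  have "ennreal (c * dst u t powr (- (2 * \<gamma>))) * Z
      \<le> ennreal (c * dst u t powr (- (2 * \<gamma>))) * (ennreal (dst u t powr \<gamma>) * Y)"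
    using assms(2) by (rule mult_left_mono) simp
  also have "\<dots> = ennreal (c * dst u t powr (- (2 * \<gamma>)) * dst u t powr \<gamma>) * Y"
    using assms(1) by (intro ennreal_assoc) simp
  also have "c * dst u t powr (- (2 * \<gamma>)) * dst u t powr \<gamma> = c * dst u t powr (- \<gamma>)"
    by (simp add: mult.assoc powr_add[symmetric])
  also have "ennreal \<dots> = ennreal c * ennreal (dst u t powr (- \<gamma>))"
    using assms(1) by (rule ennreal_mult')
  finally show ?thesis by (simp only: mult_ac)
qed

context endpoint_weights
begin

text \<open>For \<open>u < t\<close> the weight satisfies
  \<open>w t \<le> D * dst u t powr (- (\<theta> / 2)) * w u\<close> because \<theta> is positive.
  With \<open>b0\<close> replaced by \<open>chi0\<close> the integrand becomes a decaying multiple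
  of \<open>w u * T2 k u\<close>, which \<open>Mx\<close> dominates at \<open>t\<close>.\<close>

lemma Hardy_T1:
  assumes \<theta>: "0 < \<theta>" and \<tau>: "slow \<tau>"
  defines "w \<equiv> \<lambda>t. t powr (- \<theta>) * \<tau> t"
  obtains C where "C < top"
    "\<And>k t. qc k \<Longrightarrow> 0 < t \<Longrightarrow>
       ennreal (w t) * T1 k t \<le> C * Mx (\<theta> / 4) (\<lambda>u. ennreal (w u) * T2 k u) t"
proof -
  obtain C where C: "1 \<le> C" "\<And>t. 0 < t \<Longrightarrow> b0 t \<le> C * chi0 t"
    using weight_bounds by metis
  \<comment> \<open>Decay of \<open>w\<close> between \<open>u\<close> and a larger \<open>t\<close>
    is growth of \<open>1 / w\<close>, a positive power times the slowly varying
    \<open>1 / \<tau>\<close>.\<close>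
  obtain D where D: "1 \<le> D"
    "\<And>u t. 0 < u \<Longrightarrow> u \<le> t \<Longrightarrow> u powr \<theta> * inverse (\<tau> u) \<le> D * dst u t powr (- (\<theta> / 2)) * (t powr \<theta> * inverse (\<tau> t))"
    using slow_decay[OF slow_inverse[OF \<tau>] \<theta>] by metis
  have wpos: "0 < w t" if "0 < t" for t
    using that slow_pos[OF \<tau> that] by (simp add: w_def)
  have w: "w t \<le> D * dst u t powr (- (\<theta> / 2)) * w u" if u: "0 < u" "u \<le> t" for u t
  proof -
    have i: "x powr \<theta> * inverse (\<tau> x) = inverse (w x)" if "0 < x" for x
      using that slow_pos[OF \<tau> that] by (simp add: w_def powr_minus)
    have "inverse (w u) \<le> D * dst u t powr (- (\<theta> / 2)) * inverse (w t)"
      using D(2)[OF u] u by (simp add: i)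
    then show ?thesis
      using wpos[OF u(1)] wpos[of t] u by (simp add: field_simps)
  qed
  show ?thesis
  proof (rule that)
    show "ennreal (D * C) * Pq (\<theta> / 4) r0 < top" by (simp add: ennreal_mult_less_top)
    fix k t assume k: "qc k" and t: "0 < (t::real)"
    have [measurable]: "k \<in> borel_measurable borel" using k by (rule qc_measurable)
    let ?M = "Mx (\<theta> / 4) (\<lambda>u. ennreal (w u) * T2 k u)"
    have "ennreal (w t) * T1 k t = mn r0 {0<..<t} (\<lambda>u. ennreal (w t) * (ennreal (b0 u) * k u))"
      unfolding T1_def by (rule mn_cmult[symmetric, OF r0]) auto
    also have "\<dots> \<le> (ennreal (D * C) * ?M t) * Pq (\<theta> / 4) r0"
    proof (rule mn_decay[OF r0 _ t])
      fix u assume u: "0 < u" "u \<in> {0<..<t}"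
      let ?d = "dst u t"
      have "ennreal (w t) * (ennreal (b0 u) * k u) = ennreal (w t * b0 u) * k u"
        using wpos[OF t] by (intro ennreal_assoc) simp
      also have "\<dots> \<le> ennreal ((D * C * ?d powr (- (\<theta> / 2))) * (w u * chi0 u)) * k u"
      proof (rule ennreal_scale_mono)
        have "w t * b0 u \<le> (D * ?d powr (- (\<theta> / 2)) * w u) * (C * chi0 u)"
          using w[OF u(1), of t] C(2)[OF u(1)] u wpos[OF u(1)] wpos[OF t] slow_pos[OF slow_b0 u(1)] D(1)
          by (intro mult_mono) auto
        then show "w t * b0 u \<le> (D * C * ?d powr (- (\<theta> / 2))) * (w u * chi0 u)"
          by (simp only: mult_ac)
      qed
      also have "\<dots> = ennreal (D * C * ?d powr (- (\<theta> / 2))) * (ennreal (w u) * T2 k u)"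
        unfolding T2_def using D(1) C(1) wpos[OF u(1)] by (simp add: ennreal_assoc mult.assoc)
      also have "\<dots> \<le> (ennreal (D * C) * ?M t) * ennreal (?d powr (- (\<theta> / 4)))"
        using dst_absorb[OF _ Mx_ge[OF u(1) t], of "D * C" "\<theta> / 4"] D(1) C(1) by simp
      finally show "ennreal (w t) * (ennreal (b0 u) * k u) \<le> (ennreal (D * C) * ?M t) * ennreal (?d powr (- (\<theta> / 4)))" .
    qed (use \<theta> in auto)
    finally show "ennreal (w t) * T1 k t \<le> (ennreal (D * C) * Pq (\<theta> / 4) r0) * ?M t"
      by (simp only: mult_ac)
  qed
qed

text \<open>\<open>w t * rr t\<close> is \<open>t powr (1 - \<theta>)\<close> times a slowly varying
  function, hence grows like a power when \<theta> < 1. The proof applies \<open>slow_decay\<close>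
  to its reciprocal.\<close>

lemma weight_tail:
  assumes \<theta>: "\<theta> < 1" and \<tau>: "slow \<tau>"
  defines "w \<equiv> \<lambda>t. t powr (- \<theta>) * \<tau> t"
  obtains D where "1 \<le> D"
    "\<And>u t. 0 < t \<Longrightarrow> t \<le> u \<Longrightarrow> w t * rr t \<le> D * dst u t powr (- ((1 - \<theta>) / 2)) * (w u * rr u)"
proof -
  define g where "g = (\<lambda>t. inverse (\<tau> t * (chi0 t / chi1 t)))"
  have "slow g" unfolding g_def by (intro slow_inverse slow_mult \<tau> slow_sigma)
  then obtain D where D: "1 \<le> D"
    "\<And>u t. 0 < t \<Longrightarrow> t \<le> u \<Longrightarrow> u powr (- (1 - \<theta>)) * g u \<le> D * dst u t powr (- ((1 - \<theta>) / 2)) * (t powr (- (1 - \<theta>)) * g t)"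
    using slow_decay[of g "1 - \<theta>"] \<theta> by (metis diff_gt_0_iff_gt)
  have wpos: "0 < w t" if "0 < t" for t
    using that slow_pos[OF \<tau> that] by (simp add: w_def)
  have i: "x powr (- (1 - \<theta>)) * g x = inverse (w x * rr x)" if x: "0 < x" for x
  proof -
    have "x powr (1 - \<theta>) = x powr (- \<theta>) * x"
      using x powr_add[of x "- \<theta>" 1] by simp
    then have "x powr (- (1 - \<theta>)) = inverse (x powr (- \<theta>) * x)"
      by (simp only: powr_minus[of x "1 - \<theta>"])
    then show ?thesis
      using x slow_pos[OF \<tau> x] chi0_pos[OF x] chi1_pos[OF x]
      by (simp add: w_def rr_def g_def field_simps)
  qed
  show ?thesis
  proof (rule that[OF D(1)])
    fix u t :: real assume ut: "0 < t" "t \<le> u"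
    have p: "0 < w t * rr t" "0 < w u * rr u"
      using wpos[of t] wpos[of u] rr_pos[of t] rr_pos[of u] ut by auto
    have "inverse (w u * rr u) \<le> D * dst u t powr (- ((1 - \<theta>) / 2)) * inverse (w t * rr t)"
      using D(2)[OF ut] by (simp only: i[OF ut(1)] i[OF less_le_trans[OF ut]])
    then show "w t * rr t \<le> D * dst u t powr (- ((1 - \<theta>) / 2)) * (w u * rr u)"
      using p by (simp add: field_simps del: inverse_mult_distrib)
  qed
qed

text \<open>By \<open>weight_tail\<close> the factor \<open>w t * rr t\<close> may be replaced by
  its value at \<open>u > t\<close> with decay. At \<open>u\<close> the identity
  \<open>rr u * chi1 u / u = chi0 u\<close> recovers the weight of \<open>T2\<close>.\<close>

lemma Hardy_T3:
  assumes \<theta>: "\<theta> < 1" and \<tau>: "slow \<tau>"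
  defines "w \<equiv> \<lambda>t. t powr (- \<theta>) * \<tau> t"
  obtains C where "C < top"
    "\<And>k t. qc k \<Longrightarrow> 0 < t \<Longrightarrow>
       ennreal (w t) * T3 k t \<le> C * Mx ((1 - \<theta>) / 4) (\<lambda>u. ennreal (w u) * T2 k u) t"
proof -
  obtain C where C: "1 \<le> C" "\<And>t. 0 < t \<Longrightarrow> hh t * a1 t \<le> C * chi1 t"
    using weight_bounds by metis
  obtain D where D: "1 \<le> D"
    "\<And>u t. 0 < t \<Longrightarrow> t \<le> u \<Longrightarrow> w t * rr t \<le> D * dst u t powr (- ((1 - \<theta>) / 2)) * (w u * rr u)"
    unfolding w_def using weight_tail[OF \<theta> \<tau>] by metis
  have wpos: "0 < w t" if "0 < t" for t
    using that slow_pos[OF \<tau> that] by (simp add: w_def)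
  define \<gamma> where "\<gamma> = (1 - \<theta>) / 4"
  have \<gamma>: "0 < \<gamma>" "(1 - \<theta>) / 2 = 2 * \<gamma>" using \<theta> by (auto simp: \<gamma>_def)
  show ?thesis
  proof (rule that)
    show "ennreal (D * C) * Pq \<gamma> q1 < top" by (simp add: ennreal_mult_less_top)
    fix k t assume k: "qc k" and t: "0 < (t::real)"
    have [measurable]: "k \<in> borel_measurable borel" using k by (rule qc_measurable)
    let ?M = "Mx \<gamma> (\<lambda>u. ennreal (w u) * T2 k u)"
    have "ennreal (w t) * T3 k t = (ennreal (w t) * ennreal (rr t * hh t)) * PP k t"
      unfolding T3_def by (simp add: mult.assoc)
    also have "\<dots> = mn q1 {t<..} (\<lambda>u. (ennreal (w t) * ennreal (rr t * hh t)) * (ennreal (a1 u / u) * k u))"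
      unfolding PP_def by (rule mn_cmult[symmetric, OF q1]) auto
    also have "\<dots> \<le> (ennreal (D * C) * ?M t) * Pq \<gamma> q1"
    proof (rule mn_decay[OF q1 \<gamma>(1) t])
      fix u assume u: "0 < u" "u \<in> {t<..}"
      let ?d = "dst u t"
      have "(ennreal (w t) * ennreal (rr t * hh t)) * (ennreal (a1 u / u) * k u)
          = ennreal (w t * (rr t * hh t) * (a1 u / u)) * k u"
        using wpos[OF t] rr_pos[OF t] hh_pos[OF t] by (simp add: ennreal_assoc mult.assoc)
      also have "\<dots> \<le> ennreal ((D * C * ?d powr (- (2 * \<gamma>))) * (w u * chi0 u)) * k u"
      proof (rule ennreal_scale_mono)
        \<comment> \<open>\<open>hh\<close> is increasing, so the factor frozen at \<open>t\<close>
          can be moved to \<open>u\<close>, where it combines with \<open>a1 u\<close> into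
          \<open>chi1 u\<close>.\<close>
        have "hh t * a1 u \<le> hh u * a1 u"
          using hh_mono[OF t, of u] u slow_pos[OF slow_a1 u(1)] by (intro mult_right_mono) auto
        also have "\<dots> \<le> C * chi1 u" by (rule C(2)[OF u(1)])
        finally have "hh t * a1 u / u \<le> C * chi1 u / u"
          using u(1) by (intro divide_right_mono) auto
        then have "(w t * rr t) * (hh t * a1 u / u) \<le> (D * ?d powr (- (2 * \<gamma>)) * (w u * rr u)) * (C * chi1 u / u)"
          using D(2)[OF t, of u] u wpos[OF u(1)] rr_pos[OF u(1)] D(1) hh_pos[OF t] slow_pos[OF slow_a1 u(1)]
          unfolding \<gamma>(2) by - (rule mult_mono, auto)
        also have "\<dots> = (D * C * ?d powr (- (2 * \<gamma>))) * (w u * chi0 u)"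
          using u(1) chi1_pos[OF u(1)] by (simp add: rr_def)
        finally show "w t * (rr t * hh t) * (a1 u / u) \<le> (D * C * ?d powr (- (2 * \<gamma>))) * (w u * chi0 u)"
          by (simp add: mult.assoc)
      qed
      also have "\<dots> = ennreal (D * C * ?d powr (- (2 * \<gamma>))) * (ennreal (w u) * T2 k u)"
        unfolding T2_def using D(1) C(1) wpos[OF u(1)] by (simp add: ennreal_assoc mult.assoc)
      also have "\<dots> \<le> (ennreal (D * C) * ?M t) * ennreal (?d powr (- \<gamma>))"
        using D(1) C(1) by (intro dst_absorb Mx_ge u t) simp
      finally show "(ennreal (w t) * ennreal (rr t * hh t)) * (ennreal (a1 u / u) * k u)
          \<le> (ennreal (D * C) * ?M t) * ennreal (?d powr (- \<gamma>))" .
    qed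
    finally show "ennreal (w t) * T3 k t \<le> (ennreal (D * C) * Pq \<gamma> q1) * Mx ((1 - \<theta>) / 4) (\<lambda>u. ennreal (w u) * T2 k u) t"
      unfolding \<gamma>_def[symmetric] by (simp only: mult_ac)
  qed
qed

text \<open>With \<open>b1 \<le> C * hh\<close> the integrand of \<open>T4\<close> is a decaying
  multiple of \<open>w u * T3 k u\<close>. The estimate for \<open>T3\<close> bounds this by
  \<open>Mx\<close> at \<open>u\<close>, and \<open>Mx_shift\<close> moves the bound to
  \<open>t\<close>; no second maximal function arises.\<close>

lemma Hardy_T4:
  assumes \<theta>: "\<theta> < 1" and \<tau>: "slow \<tau>"
  defines "w \<equiv> \<lambda>t. t powr (- \<theta>) * \<tau> t"
  obtains C where "C < top"
    "\<And>k t. qc k \<Longrightarrow> 0 < t \<Longrightarrow>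
       ennreal (w t) * T4 k t \<le> C * Mx ((1 - \<theta>) / 4) (\<lambda>u. ennreal (w u) * T2 k u) t"
proof -
  obtain C where C: "1 \<le> C" "\<And>t. 0 < t \<Longrightarrow> b1 t \<le> C * hh t"
    using weight_bounds by metis
  obtain D where D: "1 \<le> D"
    "\<And>u t. 0 < t \<Longrightarrow> t \<le> u \<Longrightarrow> w t * rr t \<le> D * dst u t powr (- ((1 - \<theta>) / 2)) * (w u * rr u)"
    unfolding w_def using weight_tail[OF \<theta> \<tau>] by metis
  obtain G where G: "G < top"
    "\<And>k t. qc k \<Longrightarrow> 0 < t \<Longrightarrow>
       ennreal (w t) * T3 k t \<le> G * Mx ((1 - \<theta>) / 4) (\<lambda>u. ennreal (w u) * T2 k u) t"
    by (rule Hardy_T3[OF \<theta> \<tau>], rule that) (simp_all only: w_def)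
  have wpos: "0 < w t" if "0 < t" for t
    using that slow_pos[OF \<tau> that] by (simp add: w_def)
  define \<gamma> where "\<gamma> = (1 - \<theta>) / 4"
  have \<gamma>: "0 < \<gamma>" "(1 - \<theta>) / 2 = 2 * \<gamma>" using \<theta> by (auto simp: \<gamma>_def)
  show ?thesis
  proof (rule that)
    show "ennreal (D * C) * G * Pq \<gamma> r1 < top" using G by (simp add: ennreal_mult_less_top)
    fix k t assume k: "qc k" and t: "0 < (t::real)"
    let ?M = "Mx \<gamma> (\<lambda>u. ennreal (w u) * T2 k u)"
    have "ennreal (w t) * T4 k t = (ennreal (w t) * ennreal (rr t)) * mn r1 {t<..} (\<lambda>s. ennreal (b1 s) * PP k s)"
      unfolding T4_def by (simp add: mult.assoc)
    also have "\<dots> = mn r1 {t<..} (\<lambda>s. (ennreal (w t) * ennreal (rr t)) * (ennreal (b1 s) * PP k s))"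
      by (rule mn_cmult[symmetric, OF r1]) measurable
    also have "\<dots> \<le> (ennreal (D * C) * G * ?M t) * Pq \<gamma> r1"
    proof (rule mn_decay[OF r1 \<gamma>(1) t])
      fix u assume u: "0 < u" "u \<in> {t<..}"
      let ?d = "dst u t"
      have "(ennreal (w t) * ennreal (rr t)) * (ennreal (b1 u) * PP k u) = ennreal (w t * rr t * b1 u) * PP k u"
        using wpos[OF t] rr_pos[OF t] by (simp add: ennreal_assoc mult.assoc)
      also have "\<dots> \<le> ennreal ((D * C * ?d powr (- (2 * \<gamma>))) * (w u * (rr u * hh u))) * PP k u"
      proof (rule ennreal_scale_mono)
        have "(w t * rr t) * b1 u \<le> (D * ?d powr (- (2 * \<gamma>)) * (w u * rr u)) * (C * hh u)"
          using D(2)[OF t, of u] C(2)[OF u(1)] u wpos[OF u(1)] rr_pos[OF u(1)] D(1) slow_pos[OF slow_b1 u(1)]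
          unfolding \<gamma>(2) by - (rule mult_mono, auto)
        then show "w t * rr t * b1 u \<le> (D * C * ?d powr (- (2 * \<gamma>))) * (w u * (rr u * hh u))"
          by (simp only: mult_ac)
      qed
      also have "\<dots> = ennreal (D * C * ?d powr (- (2 * \<gamma>))) * (ennreal (w u) * T3 k u)"
        unfolding T3_def using D(1) C(1) wpos[OF u(1)] by (simp add: ennreal_assoc mult.assoc)
      also have "\<dots> \<le> (ennreal (D * C) * (G * ?M t)) * ennreal (?d powr (- \<gamma>))"
      proof (rule dst_absorb)
        have "ennreal (w u) * T3 k u \<le> G * ?M u" using G(2)[OF k u(1)] by (simp add: \<gamma>_def)
        also have "\<dots> \<le> G * (ennreal (?d powr \<gamma>) * ?M t)"
          using Mx_shift[OF u(1) t, of \<gamma>] \<gamma>(1) by (intro mult_left_mono) auto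
        finally show "ennreal (w u) * T3 k u \<le> ennreal (?d powr \<gamma>) * (G * ?M t)"
          by (simp only: mult_ac)
      qed (use D(1) C(1) in simp)
      finally show "(ennreal (w t) * ennreal (rr t)) * (ennreal (b1 u) * PP k u)
          \<le> (ennreal (D * C) * G * ?M t) * ennreal (?d powr (- \<gamma>))"
        by (simp only: mult_ac)
    qed
    finally show "ennreal (w t) * T4 k t \<le> (ennreal (D * C) * G * Pq \<gamma> r1) * Mx ((1 - \<theta>) / 4) (\<lambda>u. ennreal (w u) * T2 k u) t"
      unfolding \<gamma>_def[symmetric] by (simp only: mult_ac)
  qed
qed

end

section \<open>The K-functional\<close>

text \<open>The summands need not be known to lie in the spaces: otherwise one term is infinite, and
  \<open>0 < t\<close> keeps it infinite after multiplication by \<open>t\<close>.\<close>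

lemma Kfun_le:
  assumes "f = f0 + f1" "0 < t"
  shows "Kfun X0 X1 t f \<le> X0 f0 + ennreal t * X1 f1"
proof (cases "X0 f0 = top \<or> X1 f1 = top")
  case True
  then have eq: "X0 f0 + ennreal t * X1 f1 = top"
    using assms by (auto simp: ennreal_mult_top)
  show ?thesis unfolding eq by (rule top_greatest)
next
  case False
  then show ?thesis
    unfolding Kfun_def using assms by (intro Inf_lower) (auto simp: carrier_sp_def less_top)
qed

lemma Kfun_greatest:
  assumes "\<And>f0 f1. f = f0 + f1 \<Longrightarrow> f0 \<in> carrier_sp X0 \<Longrightarrow> f1 \<in> carrier_sp X1 \<Longrightarrow> z \<le> X0 f0 + ennreal t * X1 f1"
  shows "z \<le> Kfun X0 X1 t f"
  unfolding Kfun_def using assms by (intro Inf_greatest) auto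

lemma Kfun_greatest_cmult:
  assumes "0 < c" "c < top"
    and "\<And>f0 f1. f = f0 + f1 \<Longrightarrow> f0 \<in> carrier_sp X0 \<Longrightarrow> f1 \<in> carrier_sp X1 \<Longrightarrow>
      z \<le> c * (X0 f0 + ennreal t * X1 f1)"
  shows "z \<le> c * Kfun X0 X1 t f"
  unfolding ennreal_inverse_mult_le_iff[OF assms(1,2), symmetric]
  by (rule Kfun_greatest, unfold ennreal_inverse_mult_le_iff[OF assms(1,2)], rule assms(3))

lemma Kfun_mono: "u \<le> v \<Longrightarrow> Kfun X0 X1 u f \<le> Kfun X0 X1 v f"
proof (rule Kfun_greatest)
  fix f0 f1 assume *: "u \<le> v" "f = f0 + f1" "f0 \<in> carrier_sp X0" "f1 \<in> carrier_sp X1"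
  have "Kfun X0 X1 u f \<le> X0 f0 + ennreal u * X1 f1"
    unfolding Kfun_def using * by (intro Inf_lower) auto
  also have "\<dots> \<le> X0 f0 + ennreal v * X1 f1"
    using * by (intro add_left_mono mult_right_mono ennreal_leI) auto
  finally show "Kfun X0 X1 u f \<le> X0 f0 + ennreal v * X1 f1" .
qed

lemma Kfun_ratio:
  assumes u: "0 < u" "u \<le> v"
  shows "Kfun X0 X1 v f \<le> ennreal (v / u) * Kfun X0 X1 u f"
proof (rule Kfun_greatest_cmult)
  fix f0 f1 assume f: "f = f0 + f1"
  have "Kfun X0 X1 v f \<le> 1 * X0 f0 + ennreal v * X1 f1"
    using Kfun_le[OF f, of v X0 X1] u by simp
  also have "\<dots> \<le> ennreal (v / u) * X0 f0 + ennreal v * X1 f1"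
    using u by (intro add_right_mono mult_right_mono) (auto simp flip: ennreal_1 intro!: ennreal_leI)
  also have "\<dots> = ennreal (v / u) * (X0 f0 + ennreal u * X1 f1)"
    using u by (simp add: distrib_left ennreal_assoc)
  finally show "Kfun X0 X1 v f \<le> ennreal (v / u) * (X0 f0 + ennreal u * X1 f1)" .
qed (use u in auto)

lemma Kfun_finite: "f \<in> sum_sp X0 X1 \<Longrightarrow> Kfun X0 X1 u f < top"
proof -
  assume "f \<in> sum_sp X0 X1"
  then obtain f0 f1 where f: "f = f0 + f1" "f0 \<in> carrier_sp X0" "f1 \<in> carrier_sp X1"
    unfolding sum_sp_def by blast
  then have "Kfun X0 X1 u f \<le> X0 f0 + ennreal u * X1 f1"
    unfolding Kfun_def by (intro Inf_lower) auto
  also have "\<dots> < top" using f by (simp add: carrier_sp_def ennreal_mult_less_top)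
  finally show ?thesis .
qed

lemma Kfun_not_sum: "f \<notin> sum_sp X0 X1 \<Longrightarrow> Kfun X0 X1 u f = top"
proof -
  assume "f \<notin> sum_sp X0 X1"
  then have "top \<le> Kfun X0 X1 u f"
    by (intro Kfun_greatest) (auto simp: sum_sp_def)
  then show ?thesis by (simp add: top_unique)
qed

lemma qc_Kfun: "f \<in> sum_sp X0 X1 \<Longrightarrow> qc (\<lambda>u. Kfun X0 X1 u f)"
  unfolding qc_def by (auto simp: Kfun_finite Kfun_ratio intro: monoI Kfun_mono)

lemma measurable_Kfun [measurable]: "(\<lambda>u. Kfun X0 X1 u f) \<in> borel_measurable borel"
  by (intro borel_measurable_mono_ennreal monoI Kfun_mono)

lemma Kfun_dst:
  assumes "0 < u" "0 < v"
  shows "Kfun X0 X1 u f \<le> ennreal (dst u v) * Kfun X0 X1 v f"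
proof (cases "u \<le> v")
  case True
  have "1 * Kfun X0 X1 v f \<le> ennreal (dst u v) * Kfun X0 X1 v f"
    using dst_ge_1[OF assms] by (intro mult_right_mono) (auto simp flip: ennreal_1 intro!: ennreal_leI)
  then show ?thesis using Kfun_mono[OF True, of X0 X1 f] by simp
next
  case False
  then show ?thesis using Kfun_ratio[OF assms(2), of u X0 X1 f] assms by (simp add: dst_ge)
qed

lemma quasi_normed_zero: "quasi_normed N \<Longrightarrow> N 0 = 0"
  by (simp add: quasi_normed_def)

lemma quasi_normed_minus:
  assumes "quasi_normed N" shows "N (- x) = N x"
proof -
  have "N ((- 1) *\<^sub>R x) = ennreal \<bar>- 1\<bar> * N x"
    using assms unfolding quasi_normed_def by blast
  then show ?thesis by simp
qed

text \<open>Both infima are infima of sequences, and in \<open>ennreal\<close> adding a constant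
  commutes with the infimum of a sequence.\<close>

lemma le_add_InfI:
  fixes A B :: "ennreal set"
  assumes "\<And>x y. x \<in> A \<Longrightarrow> y \<in> B \<Longrightarrow> z \<le> x + y"
  shows "z \<le> Inf A + Inf B"
proof (cases "A = {} \<or> B = {}")
  case False
  then obtain x y :: "nat \<Rightarrow> ennreal" where x: "range x \<subseteq> A" "Inf A = (INF i. x i)"
    and y: "range y \<subseteq> B" "Inf B = (INF i. y i)"
    by (meson ennreal_Inf_countable_INF)
  have "z \<le> x i + Inf B" for i
    unfolding y(2) INF_ennreal_const_add[symmetric]
    using x(1) y(1) by (intro INF_greatest assms) auto
  then show ?thesis
    unfolding x(2) INF_ennreal_add_const[symmetric] by (intro INF_greatest)
qed auto

section \<open>Decompositions in a compatible couple of quasi-normed spaces\<close>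

locale quasi_couple =
  fixes A0 A1 :: "'v::real_vector qnorm"
  assumes qn0: "quasi_normed A0" and qn1: "quasi_normed A1"
    and compat: "compatible_couple A0 A1"
begin

abbreviation kk :: "'v \<Rightarrow> real \<Rightarrow> ennreal" where
  "kk f \<equiv> (\<lambda>u. Kfun A0 A1 u f)"

lemma quasi_triangle:
  obtains c where "1 \<le> c" "c < top" "\<And>x y. A0 (x + y) \<le> c * (A0 x + A0 y)" "\<And>x y. A1 (x + y) \<le> c * (A1 x + A1 y)"
proof -
  have "\<exists>C::real. \<forall>x y. A0 (x + y) \<le> ennreal C * (A0 x + A0 y)"
    using qn0 unfolding quasi_normed_def by (elim conjE)
  then obtain C :: real where "\<forall>x y. A0 (x + y) \<le> ennreal C * (A0 x + A0 y)" ..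
  then have C: "A0 (x + y) \<le> ennreal C * (A0 x + A0 y)" for x y by simp
  have "\<exists>D::real. \<forall>x y. A1 (x + y) \<le> ennreal D * (A1 x + A1 y)"
    using qn1 unfolding quasi_normed_def by (elim conjE)
  then obtain D :: real where "\<forall>x y. A1 (x + y) \<le> ennreal D * (A1 x + A1 y)" ..
  then have D: "A1 (x + y) \<le> ennreal D * (A1 x + A1 y)" for x y by simp
  define c where "c = 1 + ennreal C + ennreal D"
  have le: "ennreal C \<le> c" "ennreal D \<le> c" "1 \<le> c"
    unfolding c_def by (auto simp: add_increasing add_increasing2)
  show ?thesis
  proof (rule that[OF le(3)])
    show "c < top" by (simp add: c_def)
    show "A0 (x + y) \<le> c * (A0 x + A0 y)" for x y by (rule le_cmult_mono[OF C le(1)])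
    show "A1 (x + y) \<le> c * (A1 x + A1 y)" for x y by (rule le_cmult_mono[OF D le(2)])
  qed
qed

lemma carrier_subset_sum: "carrier_sp A0 \<subseteq> sum_sp A0 A1" "carrier_sp A1 \<subseteq> sum_sp A0 A1"
proof -
  have 0: "0 \<in> carrier_sp A0" "0 \<in> carrier_sp A1"
    using qn0 qn1 by (auto simp: carrier_sp_def quasi_normed_zero)
  show "carrier_sp A0 \<subseteq> sum_sp A0 A1"
  proof
    fix x assume "x \<in> carrier_sp A0"
    moreover have "x = x + 0" by simp
    ultimately show "x \<in> sum_sp A0 A1"
      unfolding sum_sp_def using 0(2) by blast
  qed
  show "carrier_sp A1 \<subseteq> sum_sp A0 A1"
  proof
    fix x assume "x \<in> carrier_sp A1"
    moreover have "x = 0 + x" by simp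
    ultimately show "x \<in> sum_sp A0 A1"
      unfolding sum_sp_def using 0(1) by blast
  qed
qed

lemma sum_sp_add:
  assumes "f \<in> sum_sp A0 A1" "g \<in> sum_sp A0 A1"
  shows "f + g \<in> sum_sp A0 A1"
proof -
  obtain c where c: "c < top" "\<And>x y. A0 (x + y) \<le> c * (A0 x + A0 y)" "\<And>x y. A1 (x + y) \<le> c * (A1 x + A1 y)"
    using quasi_triangle by metis
  obtain f0 f1 g0 g1 where *: "f = f0 + f1" "g = g0 + g1"
    "A0 f0 < top" "A1 f1 < top" "A0 g0 < top" "A1 g1 < top"
    using assms unfolding sum_sp_def carrier_sp_def by auto
  have "A0 (f0 + g0) < top"
    using * c by (intro le_less_trans[OF c(2)]) (auto simp: ennreal_mult_less_top)
  moreover have "A1 (f1 + g1) < top"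
    using * c by (intro le_less_trans[OF c(3)]) (auto simp: ennreal_mult_less_top)
  moreover have "f + g = (f0 + g0) + (f1 + g1)" using * by (simp add: algebra_simps)
  ultimately show ?thesis unfolding sum_sp_def carrier_sp_def infinity_ennreal_def by blast
qed

lemma Kfun_add:
  obtains c where "1 \<le> c" "c < top"
    "\<And>u f g. 0 < u \<Longrightarrow> Kfun A0 A1 u (f + g) \<le> c * (Kfun A0 A1 u f + Kfun A0 A1 u g)"
proof -
  obtain c where c: "1 \<le> c" "c < top" "\<And>x y. A0 (x + y) \<le> c * (A0 x + A0 y)" "\<And>x y. A1 (x + y) \<le> c * (A1 x + A1 y)"
    using quasi_triangle by metis
  have c0: "0 < c" using c(1) by (metis less_le_trans zero_less_one)
  show ?thesis
  proof (rule that[OF c(1,2)])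
    fix u :: real and f g assume u: "0 < u"
    have "(1 / c) * Kfun A0 A1 u (f + g) \<le> Kfun A0 A1 u f + Kfun A0 A1 u g"
      unfolding Kfun_def[of A0 A1 u f] Kfun_def[of A0 A1 u g]
    proof (rule le_add_InfI, clarify)
      fix f0 f1 g0 g1
      have "Kfun A0 A1 u ((f0 + f1) + (g0 + g1)) \<le> A0 (f0 + g0) + ennreal u * A1 (f1 + g1)"
        using u by (intro Kfun_le) (auto simp: algebra_simps)
      also have "\<dots> \<le> c * (A0 f0 + A0 g0) + ennreal u * (c * (A1 f1 + A1 g1))"
        by (intro add_mono mult_left_mono c) auto
      also have "\<dots> = c * ((A0 f0 + ennreal u * A1 f1) + (A0 g0 + ennreal u * A1 g1))"
        by (simp add: distrib_left ac_simps)
      finally show "(1 / c) * Kfun A0 A1 u ((f0 + f1) + (g0 + g1)) \<le> (A0 f0 + ennreal u * A1 f1) + (A0 g0 + ennreal u * A1 g1)"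
        by (simp only: ennreal_inverse_mult_le_iff[OF c0 c(2)])
    qed
    then show "Kfun A0 A1 u (f + g) \<le> c * (Kfun A0 A1 u f + Kfun A0 A1 u g)"
      by (simp only: ennreal_inverse_mult_le_iff[OF c0 c(2)])
  qed
qed

lemma Kfun_minus: "0 < u \<Longrightarrow> Kfun A0 A1 u (- f) \<le> Kfun A0 A1 u f"
proof (rule Kfun_greatest)
  fix f0 f1 assume "0 < u" "f = f0 + f1"
  then show "Kfun A0 A1 u (- f) \<le> A0 f0 + ennreal u * A1 f1"
    using Kfun_le[of "- f" "- f0" "- f1" u A0 A1] qn0 qn1 by (simp add: quasi_normed_minus)
qed

lemma Kfun_le_A0: "0 < u \<Longrightarrow> Kfun A0 A1 u f \<le> A0 f"
  using Kfun_le[of f f 0 u A0 A1] qn1 by (simp add: quasi_normed_zero)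

lemma Kfun_le_A1: "0 < u \<Longrightarrow> Kfun A0 A1 u f \<le> ennreal u * A1 f"
  using Kfun_le[of f 0 f u A0 A1] qn0 by (simp add: quasi_normed_zero)

lemma Kfun_less:
  assumes "Kfun X0 X1 t f < z"
  obtains f0 f1 where "f = f0 + f1" "f0 \<in> carrier_sp X0" "f1 \<in> carrier_sp X1" "X0 f0 + ennreal t * X1 f1 < z"
  using assms unfolding Kfun_def Inf_less_iff by auto

text \<open>Compatibility enters here. A vanishing K-functional splits \<open>f\<close> into parts
  arbitrarily small in each space. By continuity of the inclusions and of addition, \<open>f\<close>
  then lies in a neighbourhood of 0 chosen disjoint from a neighbourhood of
  \<open>f\<close>.\<close>

lemma Kfun_eq_0:
  assumes t: "0 < t" and K: "Kfun A0 A1 t f = 0"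
  shows "f = 0"
proof (rule ccontr)
  assume f: "f \<noteq> 0"
  obtain T where T: "hausdorff_tvs T" "embedded_in_tvs A0 T" "embedded_in_tvs A1 T"
    using compat unfolding compatible_couple_def by blast
  have top: "topspace T = UNIV" using T(1) by (simp add: hausdorff_tvs_def)
  obtain U V where U: "openin T U" "openin T V" "0 \<in> U" "f \<in> V" "disjnt U V"
    using T(1) f unfolding hausdorff_tvs_def Hausdorff_space_def by (metis UNIV_I)
  define S where "S = {z \<in> topspace (prod_topology T T). (\<lambda>(x, y). x + y) z \<in> U}"
  have "openin (prod_topology T T) S"
    unfolding S_def
    using T(1) U(1) unfolding hausdorff_tvs_def by (intro openin_continuous_map_preimage) auto
  then have "\<forall>x y. (x, y) \<in> S \<longrightarrow> (\<exists>W0 W1. openin T W0 \<and> openin T W1 \<and> x \<in> W0 \<and> y \<in> W1 \<and> W0 \<times> W1 \<subseteq> S)"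
    by (simp only: openin_prod_topology_alt)
  moreover have "(0, 0) \<in> S"
    using U(3) top by (simp add: S_def)
  ultimately obtain W0 W1 where W: "openin T W0" "openin T W1" "0 \<in> W0" "0 \<in> W1"
    "W0 \<times> W1 \<subseteq> S"
    by metis
  have 0: "0 \<in> carrier_sp A0" "0 \<in> carrier_sp A1"
    using qn0 qn1 by (auto simp: carrier_sp_def quasi_normed_zero)
  obtain e0 where e0: "e0 > 0" "\<And>y. y \<in> carrier_sp A0 \<Longrightarrow> A0 (y - 0) < e0 \<Longrightarrow> y \<in> W0"
    using T(2) W(1,3) 0(1) unfolding embedded_in_tvs_def by meson
  obtain e1 where e1: "e1 > 0" "\<And>y. y \<in> carrier_sp A1 \<Longrightarrow> A1 (y - 0) < e1 \<Longrightarrow> y \<in> W1"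
    using T(3) W(2,4) 0(2) unfolding embedded_in_tvs_def by meson
  \<comment> \<open>The decomposition bounds only \<open>t * A1 f1\<close>, hence the factor
    \<open>t\<close> on \<open>e1\<close>; the minimum makes both parts small at once.\<close>
  have "Kfun A0 A1 t f < min e0 (ennreal t * e1)"
    using K e0(1) e1(1) t by (simp add: ennreal_zero_less_mult_iff)
  then obtain f0 f1 where d: "f = f0 + f1" "f0 \<in> carrier_sp A0" "f1 \<in> carrier_sp A1"
    "A0 f0 + ennreal t * A1 f1 < min e0 (ennreal t * e1)"
    by (rule Kfun_less)
  have "A0 f0 < e0"
    using d(4) by (auto intro: le_less_trans[rotated])
  moreover have "ennreal t * A1 f1 \<le> A0 f0 + ennreal t * A1 f1" by simp
  then have "ennreal t * A1 f1 < ennreal t * e1" using d(4) by (meson le_less_trans min_less_iff_conj)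
  then have "A1 f1 < e1" by (meson leD leI mult_left_mono zero_le)
  ultimately have "f0 \<in> W0" "f1 \<in> W1" using e0(2) e1(2) d by auto
  then have "f \<in> U" using W(5) d(1) by (auto simp: S_def)
  then show False using U(4,5) by (auto simp: disjnt_def)
qed

text \<open>The infimum need not be attained, and \<open>K < 2 * K\<close> requires
  \<open>0 < K < top\<close>. Positivity is \<open>Kfun_eq_0\<close>; the zero element is split
  trivially.\<close>

lemma near_optimal:
  assumes t: "0 < t" and f: "f \<in> sum_sp A0 A1"
  obtains f0 f1 where "f = f0 + f1" "f0 \<in> carrier_sp A0" "f1 \<in> carrier_sp A1"
    "A0 f0 + ennreal t * A1 f1 \<le> 2 * Kfun A0 A1 t f"
proof (cases "f = 0")
  case True
  then show ?thesis
    using qn0 qn1 by (intro that[of 0 0]) (auto simp: carrier_sp_def quasi_normed_zero)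
next
  case False
  then have "0 < Kfun A0 A1 t f" using Kfun_eq_0[OF t] by (auto simp: zero_less_iff_neq_zero)
  moreover have "Kfun A0 A1 t f < top" by (rule Kfun_finite[OF f])
  ultimately have "Kfun A0 A1 t f < 2 * Kfun A0 A1 t f"
    using ennreal_add_left_cancel_less[of "Kfun A0 A1 t f" 0 "Kfun A0 A1 t f"] by (simp add: mult_2 less_top)
  then obtain f0 f1 where d: "f = f0 + f1" "f0 \<in> carrier_sp A0" "f1 \<in> carrier_sp A1"
    "A0 f0 + ennreal t * A1 f1 < 2 * Kfun A0 A1 t f"
    by (rule Kfun_less)
  then show ?thesis by (intro that[OF d(1-3)]) simp
qed

text \<open>On one side of \<open>t\<close> the trivial bounds \<open>K(u, f0) \<le> A0 f0\<close>
  and \<open>K(u, f1) \<le> u * A1 f1\<close> suffice. On the other side \<open>f0 = f - f1\<close>,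
  respectively \<open>f1 = f - f0\<close>, and the trivial bound for the subtracted part is
  dominated by \<open>K(u, f)\<close>.\<close>

lemma decomposition:
  obtains c where "c < top"
    "\<And>f t. f \<in> sum_sp A0 A1 \<Longrightarrow> 0 < t \<Longrightarrow>
      \<exists>f0 f1. f = f0 + f1 \<and> f0 \<in> sum_sp A0 A1 \<and> f1 \<in> sum_sp A0 A1 \<and>
        (\<forall>u>0. kk f0 u \<le> c * kk f (min u t)) \<and>
        (\<forall>u>t. kk f1 u \<le> c * kk f u) \<and>
        (\<forall>u. 0 < u \<longrightarrow> u < t \<longrightarrow> kk f1 u \<le> c * (ennreal (u / t) * kk f t))"
proof -
  obtain c where c: "1 \<le> c" "c < top"
    "\<And>u f g. 0 < u \<Longrightarrow> Kfun A0 A1 u (f + g) \<le> c * (Kfun A0 A1 u f + Kfun A0 A1 u g)"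
    using Kfun_add by metis
  \<comment> \<open>The trivial bounds have constant 2, the others \<open>c * (1 + 2)\<close>; this
    puts both under the common constant \<open>c * 3\<close>.\<close>
  have c2: "2 \<le> c * 3"
  proof -
    have "2 \<le> (1::ennreal) * 3" by simp
    also have "\<dots> \<le> c * 3" using c(1) by (rule mult_right_mono) simp
    finally show ?thesis .
  qed
  show ?thesis
  proof (rule that)
    show "c * 3 < top" using c by (simp add: ennreal_mult_less_top)
    fix f t assume f: "f \<in> sum_sp A0 A1" and t: "0 < (t::real)"
    obtain f0 f1 where d: "f = f0 + f1" "f0 \<in> carrier_sp A0" "f1 \<in> carrier_sp A1"
      "A0 f0 + ennreal t * A1 f1 \<le> 2 * kk f t"
      using near_optimal[OF t f] by metis
    have sum: "f0 \<in> sum_sp A0 A1" "f1 \<in> sum_sp A0 A1"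
      using carrier_subset_sum d by auto
    have a0: "A0 f0 \<le> 2 * kk f t"
      using d(4) by (rule order_trans[rotated]) simp
    have a1: "ennreal t * A1 f1 \<le> 2 * kk f t"
      using d(4) by (rule order_trans[rotated]) simp
    have k0: "kk f0 u \<le> 2 * kk f t" if "0 < u" for u
      using Kfun_le_A0[OF that] a0 by (rule order_trans)
    have k1: "kk f1 u \<le> 2 * (ennreal (u / t) * kk f t)" if u: "0 < u" for u
    proof -
      have "kk f1 u \<le> ennreal u * A1 f1" by (rule Kfun_le_A1[OF u])
      also have "\<dots> = ennreal (u / t) * (ennreal t * A1 f1)" using u t by (simp add: ennreal_assoc)
      also have "\<dots> \<le> ennreal (u / t) * (2 * kk f t)" using a1 by (rule mult_left_mono) simp
      finally show ?thesis by (simp add: mult.left_commute)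
    qed
    have shr: "ennreal (u / t) * kk f t \<le> kk f u" if u: "0 < u" "u < t" for u
    proof -
      have "ennreal u * (ennreal (1 / t) * kk f t) \<le> ennreal u * (ennreal (1 / u) * kk f u)"
        using qc_decr[OF qc_Kfun[OF f] u(1), of t] u by (intro mult_left_mono) auto
      then show ?thesis using u t by (simp add: ennreal_assoc)
    qed
    have A: "kk f0 u \<le> c * 3 * kk f (min u t)" if u: "0 < u" for u
      proof (cases "u < t")
        case True
        have "f0 = f + (- f1)" using d(1) by simp
        then have "kk f0 u \<le> c * (kk f u + kk (- f1) u)" using c(3)[OF u, of f "- f1"] by simp
        also have "\<dots> \<le> c * (kk f u + 2 * kk f u)"
        proof (intro mult_left_mono add_left_mono)
          have "kk (- f1) u \<le> kk f1 u" by (rule Kfun_minus[OF u])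
          also have "\<dots> \<le> 2 * (ennreal (u / t) * kk f t)" by (rule k1[OF u])
          also have "\<dots> \<le> 2 * kk f u" using shr[OF u True] by (rule mult_left_mono) simp
          finally show "kk (- f1) u \<le> 2 * kk f u" .
        qed simp
        also have "kk f u + 2 * kk f u = (1 + 2) * kk f u" by (simp only: distrib_right mult_1)
        finally show ?thesis using True by (simp add: mult.assoc min_def)
      next
        case False
        then have "min u t = t" by simp
        then show ?thesis using le_cmult_mono[OF k0[OF u] c2] by simp
      qed
    have B: "kk f1 u \<le> c * 3 * kk f u" if "t < u" for u
    proof -
      have u: "0 < u" "t < u" using t that by auto
      have "f1 = f + (- f0)" using d(1) by simp
      then have "kk f1 u \<le> c * (kk f u + kk (- f0) u)" using c(3)[OF u(1), of f "- f0"] by simp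
      also have "\<dots> \<le> c * (kk f u + 2 * kk f u)"
      proof (intro mult_left_mono add_left_mono)
        have "kk (- f0) u \<le> kk f0 u" by (rule Kfun_minus[OF u(1)])
        also have "\<dots> \<le> 2 * kk f t" by (rule k0[OF u(1)])
        also have "\<dots> \<le> 2 * kk f u" using u by (intro mult_left_mono Kfun_mono) auto
        finally show "kk (- f0) u \<le> 2 * kk f u" .
      qed simp
      also have "kk f u + 2 * kk f u = (1 + 2) * kk f u" by (simp only: distrib_right mult_1)
      finally show "kk f1 u \<le> c * 3 * kk f u" by (simp add: mult.assoc)
    qed
    have C: "kk f1 u \<le> c * 3 * (ennreal (u / t) * kk f t)" if "0 < u" for u
      by (rule le_cmult_mono[OF k1[OF that] c2])
    show "\<exists>f0 f1. f = f0 + f1 \<and> f0 \<in> sum_sp A0 A1 \<and> f1 \<in> sum_sp A0 A1 \<and>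
        (\<forall>u>0. kk f0 u \<le> c * 3 * kk f (min u t)) \<and>
        (\<forall>u>t. kk f1 u \<le> c * 3 * kk f u) \<and>
        (\<forall>u. 0 < u \<longrightarrow> u < t \<longrightarrow> kk f1 u \<le> c * 3 * (ennreal (u / t) * kk f t))"
      using d(1) sum A B C by blast
  qed
qed

end

section \<open>Holmstedt's formula\<close>

locale reiteration = endpoint_weights q1 r1 r0 a1 b1 b0 + quasi_couple A0 A1
  for q1 r1 r0 :: ennreal and a1 b1 b0 :: "real \<Rightarrow> real" and A0 A1 :: "'v::real_vector qnorm"
begin

abbreviation X0 :: "'v qnorm" where "X0 \<equiv> interp_sp A0 A1 0 r0 b0"
abbreviation X1 :: "'v qnorm" where "X1 \<equiv> R_sp A0 A1 1 r1 b1 q1 a1"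

lemma wnorm_PP:
  assumes "0 < t"
  shows "wnorm 1 q1 a1 {t<..} (kk f) = PP (kk f) t"
proof -
  have "wnorm 1 q1 a1 {t<..} (kk f) = mn q1 {t<..} (\<lambda>u. ennreal (u powr (- 1) * a1 u) * kk f u)"
    using assms by (intro wnorm_eq_mn q1) auto
  also have "\<dots> = PP (kk f) t"
    unfolding PP_def by (intro mn_cong q1) (simp add: powr_minus divide_inverse mult.commute)
  finally show ?thesis .
qed

lemma X0_eq: "f \<in> sum_sp A0 A1 \<Longrightarrow> X0 f = N0 (kk f)"
proof -
  assume f: "f \<in> sum_sp A0 A1"
  have "X0 f = mn r0 {0<..} (\<lambda>u. ennreal (u powr (- 0) * b0 u) * kk f u)"
    using f unfolding interp_sp_def by (simp only: if_True) (intro wnorm_eq_mn r0; simp)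
  also have "\<dots> = N0 (kk f)"
    unfolding N0_def by (intro mn_cong r0) simp
  finally show ?thesis .
qed

lemma X1_eq: "f \<in> sum_sp A0 A1 \<Longrightarrow> X1 f = N1 (kk f)"
proof -
  assume f: "f \<in> sum_sp A0 A1"
  have "X1 f = wnorm 0 r1 b1 {0<..} (PP (kk f))"
    using f wnorm_PP unfolding R_sp_def by (simp only: if_True) (intro wnorm_cong r1; simp)
  also have "\<dots> = mn r1 {0<..} (\<lambda>u. ennreal (u powr (- 0) * b1 u) * PP (kk f) u)"
    by (intro wnorm_eq_mn r1) auto
  also have "\<dots> = N1 (kk f)"
    unfolding N1_def by (intro mn_cong r1) simp
  finally show ?thesis .
qed

lemma carrier_X: "X0 f < top \<Longrightarrow> f \<in> sum_sp A0 A1" "X1 f < top \<Longrightarrow> f \<in> sum_sp A0 A1"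
  unfolding interp_sp_def R_sp_def by (auto split: if_splits)

lemma sum_X_subset: "sum_sp X0 X1 \<subseteq> sum_sp A0 A1"
proof
  fix f assume "f \<in> sum_sp X0 X1"
  then obtain f0 f1 where "f = f0 + f1" "X0 f0 < top" "X1 f1 < top"
    by (auto simp: sum_sp_def carrier_sp_def)
  then show "f \<in> sum_sp A0 A1" using carrier_X sum_sp_add by blast
qed

lemma Holmstedt_upper:
  obtains C where "C < top"
    "\<And>f t. f \<in> sum_sp A0 A1 \<Longrightarrow> 0 < t \<Longrightarrow> Kfun X0 X1 (rr t) f \<le> C * TT (kk f) t"
proof -
  obtain c where c: "c < top"
    "\<And>f t. f \<in> sum_sp A0 A1 \<Longrightarrow> 0 < t \<Longrightarrow>
      \<exists>f0 f1. f = f0 + f1 \<and> f0 \<in> sum_sp A0 A1 \<and> f1 \<in> sum_sp A0 A1 \<and>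
        (\<forall>u>0. kk f0 u \<le> c * kk f (min u t)) \<and>
        (\<forall>u>t. kk f1 u \<le> c * kk f u) \<and>
        (\<forall>u. 0 < u \<longrightarrow> u < t \<longrightarrow> kk f1 u \<le> c * (ennreal (u / t) * kk f t))"
    using decomposition by blast
  define C0 where "C0 = Kq r0 * c"
  define C1 where "C1 = Kq r1 * c * (2 * Kq q1 * Kq r1 + 1)"
  show ?thesis
  proof (rule that)
    show "C0 + C1 < top" using c(1) by (simp add: C0_def C1_def ennreal_mult_less_top)
    fix f t assume f: "f \<in> sum_sp A0 A1" and t: "0 < (t::real)"
    obtain f0 f1 where d: "f = f0 + f1" "f0 \<in> sum_sp A0 A1" "f1 \<in> sum_sp A0 A1"
      "\<And>u. 0 < u \<Longrightarrow> kk f0 u \<le> c * kk f (min u t)" "\<And>u. t < u \<Longrightarrow> kk f1 u \<le> c * kk f u"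
      "\<And>u. 0 < u \<Longrightarrow> u < t \<Longrightarrow> kk f1 u \<le> c * (ennreal (u / t) * kk f t)"
      using c(2)[OF f t] by blast
    have "Kfun X0 X1 (rr t) f \<le> X0 f0 + ennreal (rr t) * X1 f1"
      using rr_pos[OF t] by (intro Kfun_le d(1))
    also have "X0 f0 \<le> C0 * (T1 (kk f) t + T2 (kk f) t)"
      unfolding X0_eq[OF d(2)] C0_def by (rule N0_upper[OF qc_Kfun[OF f] t d(4)])
    also have "C0 * (T1 (kk f) t + T2 (kk f) t) \<le> C0 * TT (kk f) t"
      unfolding TT_def by (intro mult_left_mono) (auto simp: add.assoc add_left_mono)
    also have "ennreal (rr t) * X1 f1 \<le> C1 * (T2 (kk f) t + T3 (kk f) t + T4 (kk f) t)"
      unfolding X1_eq[OF d(3)] C1_def by (rule N1_upper[OF qc_Kfun[OF f] t d(5) d(6)])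
    also have "C1 * (T2 (kk f) t + T3 (kk f) t + T4 (kk f) t) \<le> C1 * TT (kk f) t"
      unfolding TT_def by (intro mult_left_mono) (auto simp: add.assoc)
    finally show "Kfun X0 X1 (rr t) f \<le> (C0 + C1) * TT (kk f) t"
      by (simp add: distrib_right add_mono)
  qed
qed

text \<open>For an arbitrary decomposition, \<open>TT\<close> is split by \<open>TT_subadd\<close>;
  the part of \<open>f0\<close> is bounded by its \<open>X0\<close> norm and the part of
  \<open>f1\<close> by \<open>rr t\<close> times its \<open>X1\<close> norm. Then the infimum over
  decompositions is taken.\<close>

lemma Holmstedt_lower:
  obtains C where "C < top"
    "\<And>f t. 0 < t \<Longrightarrow> TT (kk f) t \<le> C * Kfun X0 X1 (rr t) f"
proof -
  obtain c where c: "1 \<le> c" "c < top" "\<And>u f g. 0 < u \<Longrightarrow> Kfun A0 A1 u (f + g) \<le> c * (Kfun A0 A1 u f + Kfun A0 A1 u g)"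
    using Kfun_add by metis
  obtain C where C: "C < top"
    "\<And>k k0 k1 t. qc k0 \<Longrightarrow> qc k1 \<Longrightarrow> (\<And>u. 0 < u \<Longrightarrow> k u \<le> c * (k0 u + k1 u)) \<Longrightarrow> 0 < t \<Longrightarrow>
        TT k t \<le> C * (TT k0 t + TT k1 t)"
  proof (rule TT_subadd[OF c(2)], goal_cases)
    case (1 C)
    from 1(2,3) show ?case by (rule 1(1))
  qed
  obtain D0 where D0: "D0 < top" "\<And>k t. qc k \<Longrightarrow> 0 < t \<Longrightarrow> TT k t \<le> D0 * N0 k"
    using TT_le_N0 by metis
  obtain D1 where D1: "D1 < top" "\<And>k t. qc k \<Longrightarrow> 0 < t \<Longrightarrow> TT k t \<le> D1 * (ennreal (rr t) * N1 k)"
    using TT_le_N1 by metis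
  \<comment> \<open>The added 1 makes the constant positive, as required for moving it across the
    infimum.\<close>
  define E where "E = C * (D0 + D1) + 1"
  have E: "0 < E" "E < top"
    using C(1) D0(1) D1(1) by (auto simp: E_def ennreal_mult_less_top add_nonneg_pos)
  show ?thesis
  proof (rule that[OF E(2)])
    fix f t assume t: "0 < (t::real)"
    show "TT (kk f) t \<le> E * Kfun X0 X1 (rr t) f"
    proof (rule Kfun_greatest_cmult[OF E])
      fix f0 f1 assume f: "f = f0 + f1" "f0 \<in> carrier_sp X0" "f1 \<in> carrier_sp X1"
      have s: "f0 \<in> sum_sp A0 A1" "f1 \<in> sum_sp A0 A1"
        using f carrier_X by (auto simp: carrier_sp_def)
      have "TT (kk f) t \<le> C * (TT (kk f0) t + TT (kk f1) t)"
        unfolding f(1) by (intro C(2) qc_Kfun s c(3) t)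
      also have "\<dots> \<le> C * (D0 * X0 f0 + D1 * (ennreal (rr t) * X1 f1))"
        unfolding X0_eq[OF s(1)] X1_eq[OF s(2)]
        by (intro mult_left_mono add_mono D0(2) D1(2) qc_Kfun s t) auto
      also have "\<dots> \<le> C * ((D0 + D1) * X0 f0 + (D0 + D1) * (ennreal (rr t) * X1 f1))"
        by (intro mult_left_mono add_mono mult_right_mono) auto
      also have "\<dots> = (C * (D0 + D1)) * (X0 f0 + ennreal (rr t) * X1 f1)"
        by (simp only: distrib_left[symmetric] mult.assoc)
      also have "\<dots> \<le> E * (X0 f0 + ennreal (rr t) * X1 f1)"
        by (intro mult_right_mono) (auto simp: E_def)
      finally show "TT (kk f) t \<le> E * (X0 f0 + ennreal (rr t) * X1 f1)" .
    qed
  qed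
qed

end

section \<open>Comparison of quasi-norms\<close>

text \<open>This expresses that \<open>M\<close> embeds continuously into \<open>N\<close>: as
  \<open>C\<close> is finite, \<open>N f\<close> is finite wherever \<open>M f\<close> is. Stating
  it for all \<open>f\<close>, with infinite values, makes chaining free of carriers.\<close>

definition qle :: "'v qnorm \<Rightarrow> 'v qnorm \<Rightarrow> bool" where
  "qle N M \<longleftrightarrow> (\<exists>C<top. \<forall>f. N f \<le> C * M f)"

lemma qleI:
  assumes "C < top" "\<And>f. f \<in> S \<Longrightarrow> N f \<le> C * M f" "\<And>f. f \<notin> S \<Longrightarrow> M f = top"
  shows "qle N M"
  unfolding qle_def
\<comment> \<open>With \<open>C = 0\<close> the bound could fail outside \<open>S\<close>, as
  \<open>0 * top = 0\<close>; \<open>C + 1\<close> is positive.\<close>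
proof (intro exI[of _ "C + 1"] conjI allI)
  fix f
  show "N f \<le> (C + 1) * M f"
  proof (cases "f \<in> S")
    case True
    show ?thesis by (rule le_cmult_mono[OF assms(2)[OF True]]) simp
  next
    case False
    then show ?thesis using assms(3) by (simp add: ennreal_mult_top)
  qed
qed (use assms(1) in simp)

lemma qleE:
  assumes "qle N M"
  obtains C where "C < top" "\<And>f. N f \<le> C * M f"
proof -
  from assms obtain C where C: "C < top" "\<forall>f. N f \<le> C * M f" unfolding qle_def by (elim exE conjE)
  then show ?thesis by (intro that[OF C(1)]) simp
qed

lemma qle_trans:
  assumes "qle N M" "qle M L"
  shows "qle N L"
proof -
  obtain C where C: "C < top" "\<And>f. N f \<le> C * M f" using qleE[OF assms(1)] by metis
  obtain D where D: "D < top" "\<And>f. M f \<le> D * L f" using qleE[OF assms(2)] by metis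
  show ?thesis unfolding qle_def
  proof (intro exI[of _ "C * D"] conjI allI)
    fix f
    have "N f \<le> C * (D * L f)" by (rule order_trans[OF C(2) mult_left_mono[OF D(2)]]) simp
    then show "N f \<le> (C * D) * L f" by (simp add: mult.assoc)
  qed (use C D in \<open>simp add: ennreal_mult_less_top\<close>)
qed

lemma qle_inter:
  assumes "qle N N'" "qle M M'"
  shows "qle (N \<sqinter>\<^sub>q M) (N' \<sqinter>\<^sub>q M')"
proof -
  obtain C where C: "C < top" "\<And>f. N f \<le> C * N' f" using qleE[OF assms(1)] by metis
  obtain D where D: "D < top" "\<And>f. M f \<le> D * M' f" using qleE[OF assms(2)] by metis
  show ?thesis unfolding qle_def
  proof (intro exI[of _ "C + D"] conjI allI)
    fix f
    have "N f \<le> (C + D) * max (N' f) (M' f)"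
      by (rule order_trans[OF C(2)], rule mult_mono) auto
    moreover have "M f \<le> (C + D) * max (N' f) (M' f)"
      by (rule order_trans[OF D(2)], rule mult_mono) auto
    ultimately show "(N \<sqinter>\<^sub>q M) f \<le> (C + D) * (N' \<sqinter>\<^sub>q M') f"
      by (simp add: inter_sp_def)
  qed (use C D in simp)
qed

lemma equal_spI:
  assumes "qle N M" "qle M N"
  shows "N \<cong>\<^sub>q M"
proof -
  have emb: "M \<hookrightarrow>\<^sub>q N" if qle: "qle N M" for N M :: "'a qnorm"
  proof -
    obtain C where C: "C < top" "\<And>f. N f \<le> C * M f" using qleE[OF qle] by metis
    have "N f < top" if "M f < top" for f
      using C(2)[of f] C(1) that by (intro le_less_trans[OF C(2)]) (simp add: ennreal_mult_less_top)
    moreover have "N f \<le> ennreal (enn2real C) * M f" for f using C by simp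
    ultimately show ?thesis by (auto simp: embedded_sp_def carrier_sp_def)
  qed
  show ?thesis using emb assms by (simp add: equal_sp_def)
qed

section \<open>The reiteration formulas for Borel weights\<close>

locale reiteration_target = reiteration q1 r1 r0 a1 b1 b0 A0 A1
  for q1 r1 r0 :: ennreal and a1 b1 b0 :: "real \<Rightarrow> real" and A0 A1 :: "'v::real_vector qnorm" +
  fixes r :: ennreal and a :: "real \<Rightarrow> real"
  assumes r: "0 < r" and slow_a: "slow a" and meas_a [measurable]: "a \<in> borel_measurable borel"
begin

definition ww :: "real \<Rightarrow> real \<Rightarrow> real" where
  "ww \<theta> t = rr t powr (- \<theta>) * a (rr t)"

text \<open>What remains of \<open>ww\<close> when \<open>t powr (- \<theta>)\<close> is split off.
  It is slowly varying, the form of weight in which the Hardy-type lemmas are stated.\<close>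

definition tau :: "real \<Rightarrow> real \<Rightarrow> real" where
  "tau \<theta> t = (chi0 t / chi1 t) powr (- \<theta>) * a (rr t)"

text \<open>
  \<open>GG\<close> is the integrand of the interpolation norm of the endpoint spaces; after the substitution
  \<open>u = \<rho>(t)\<close> Holmstedt's formula splits this norm into the \<open>SS \<theta> T\<close> for \<open>T = T1, \<dots>, T4\<close>.
\<close>

definition SS :: "real \<Rightarrow> ((real \<Rightarrow> ennreal) \<Rightarrow> real \<Rightarrow> ennreal) \<Rightarrow> 'v \<Rightarrow> ennreal" where
  "SS \<theta> T f = mn r {0<..} (\<lambda>t. ennreal (ww \<theta> t) * T (kk f) t)"

definition GG :: "real \<Rightarrow> 'v \<Rightarrow> real \<Rightarrow> ennreal" where
  "GG \<theta> f u = ennreal (u powr (- \<theta>) * a u) * Kfun X0 X1 u f"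

lemma slow_a_rr: "slow (\<lambda>t. a (rr t))"
proof -
  obtain A where A: "1 \<le> A"
    "\<And>s t. 0 < s \<Longrightarrow> 0 < t \<Longrightarrow> dst (s * (chi0 s / chi1 s)) (t * (chi0 t / chi1 t)) \<le> A * (dst s t)\<^sup>2"
    using slow_times_id_dst[OF slow_sigma] by metis
  show ?thesis
  proof (rule slow_compose[OF slow_a rr_pos])
    show "dst (rr s) (rr t) \<le> A * (dst s t)\<^sup>2" if "0 < s" "0 < t" for s t
      unfolding rr_def using that by (rule A(2))
  qed
qed

lemma slow_tau: "slow (tau \<theta>)"
  unfolding tau_def[abs_def] by (intro slow_mult slow_powr slow_sigma slow_a_rr)

lemma ww_eq:
  assumes "0 < t"
  shows "ww \<theta> t = t powr (- \<theta>) * tau \<theta> t"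
proof -
  have "rr t powr (- \<theta>) = t powr (- \<theta>) * (chi0 t / chi1 t) powr (- \<theta>)"
    unfolding rr_def using chi0_pos[OF assms] chi1_pos[OF assms] assms by (intro powr_mult)
  then show ?thesis unfolding ww_def tau_def by (simp only: mult.assoc)
qed

lemma ww_pos: "0 < t \<Longrightarrow> 0 < ww \<theta> t"
  unfolding ww_def using rr_pos[of t] slow_pos[OF slow_a rr_pos[of t]] by simp

lemma measurable_ww [measurable]: "ww \<theta> \<in> borel_measurable borel"
  unfolding ww_def[abs_def] by measurable

lemma measurable_GG [measurable]: "GG \<theta> f \<in> borel_measurable borel"
  unfolding GG_def[abs_def] by measurable

lemma interp_X_eq:
  assumes f: "f \<in> sum_sp A0 A1"
  shows "interp_sp X0 X1 \<theta> r a f = mn r {0<..} (GG \<theta> f)"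
proof (cases "f \<in> sum_sp X0 X1")
  case True
  then show ?thesis
    unfolding interp_sp_def[of X0 X1] GG_def[abs_def] by (simp only: if_True) (intro wnorm_eq_mn r; simp)
next
  case False
  \<comment> \<open>Outside the sum of the endpoint spaces the K-functional is infinite everywhere,
    so the block from 1 to 2 alone makes the right-hand side infinite, in agreement with the default
    value of \<open>interp_sp\<close>.\<close>
  have "Lq r * top \<le> mn r {0<..} (GG \<theta> f)"
  proof (rule mn_ge[OF r, of 1])
    fix u :: real assume "1 < u" "u < 2 * 1"
    then show "u \<in> {0<..} \<and> top \<le> GG \<theta> f u"
      using slow_pos[OF slow_a, of u] Kfun_not_sum[OF False, of u] by (simp add: GG_def ennreal_mult_top)
  qed simp
  then have "mn r {0<..} (GG \<theta> f) = top"
    using Lq_pos[of r] by (simp add: ennreal_mult_top top_unique less_imp_neq[symmetric])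
  then show ?thesis using False by (simp add: interp_sp_def[of X0 X1])
qed

lemma interp_X_sum: "f \<notin> sum_sp A0 A1 \<Longrightarrow> interp_sp X0 X1 \<theta> r a f = top"
  unfolding interp_sp_def[of X0 X1] using sum_X_subset by auto

text \<open>The exponent collects \<theta> from the power, 1 from slow variation of \<open>a\<close>
  and 1 from the K-functional. Such a power bound, uniform in \<open>f\<close>, is what
  \<open>change_of_variables\<close> asks for.\<close>

lemma GG_moderate:
  assumes \<theta>: "0 \<le> \<theta>"
  obtains D where "D < top"
    "\<And>f u v. 0 < u \<Longrightarrow> 0 < v \<Longrightarrow> GG \<theta> f u \<le> D * ennreal (dst u v powr (\<theta> + 2)) * GG \<theta> f v"
proof -
  obtain C where C: "1 \<le> C" "\<And>s t. 0 < s \<Longrightarrow> 0 < t \<Longrightarrow> a s \<le> C * dst s t powr 1 * a t"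
    using slowE[OF slow_a, of 1] by auto
  show ?thesis
  proof (rule that)
    show "ennreal C < top" by simp
    fix f :: 'v and u v :: real assume uv: "0 < u" "0 < v"
    let ?d = "dst u v"
    note d = dst_pos[OF uv]
    have "u powr (- \<theta>) * a u \<le> (?d powr \<theta> * v powr (- \<theta>)) * (C * ?d powr 1 * a v)"
    proof (rule mult_mono)
      have "v powr \<theta> \<le> (?d * u) powr \<theta>"
        using dst_ge_ratio(2)[of v u] uv \<theta> by (intro powr_mono2) (auto simp: pos_divide_le_eq)
      then have "v powr \<theta> \<le> ?d powr \<theta> * u powr \<theta>" using d uv by (simp add: powr_mult)
      then show "u powr (- \<theta>) \<le> ?d powr \<theta> * v powr (- \<theta>)"
        using uv by (simp add: powr_minus field_simps)
    qed (use C uv slow_pos[OF slow_a uv(1)] in auto)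
    then have "ennreal (u powr (- \<theta>) * a u) \<le> ennreal ((?d powr \<theta> * v powr (- \<theta>)) * (C * ?d powr 1 * a v))"
      by (rule ennreal_leI)
    then have "GG \<theta> f u \<le> ennreal ((?d powr \<theta> * v powr (- \<theta>)) * (C * ?d powr 1 * a v)) * (ennreal ?d * Kfun X0 X1 v f)"
      unfolding GG_def by (intro mult_mono Kfun_dst uv) auto
    also have "\<dots> = ennreal ((?d powr \<theta> * v powr (- \<theta>)) * (C * ?d powr 1 * a v) * ?d) * Kfun X0 X1 v f"
      using C(1) slow_pos[OF slow_a uv(2)] by (intro ennreal_assoc) auto
    also have "(?d powr \<theta> * v powr (- \<theta>)) * (C * ?d powr 1 * a v) * ?d
        = (C * ?d powr (\<theta> + 2)) * (v powr (- \<theta>) * a v)"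
      using d powr_add[of ?d \<theta> 2] by (simp add: mult_ac power2_eq_square)
    also have "ennreal \<dots> = ennreal C * ennreal (?d powr (\<theta> + 2)) * ennreal (v powr (- \<theta>) * a v)"
      using C(1) by (simp add: ennreal_mult')
    finally show "GG \<theta> f u \<le> ennreal C * ennreal (?d powr (\<theta> + 2)) * GG \<theta> f v"
      by (simp add: GG_def mult.assoc)
  qed
qed

lemma GG_rr:
  assumes \<theta>: "0 \<le> \<theta>"
  obtains C where "C < top"
    "\<And>f. mn r {0<..} (\<lambda>t. GG \<theta> f (rr t)) \<le> C * mn r {0<..} (GG \<theta> f)"
    "\<And>f. mn r {0<..} (GG \<theta> f) \<le> C * mn r {0<..} (\<lambda>t. GG \<theta> f (rr t))"
proof -
  obtain D where D: "D < top"
    "\<And>f u v. 0 < u \<Longrightarrow> 0 < v \<Longrightarrow> GG \<theta> f u \<le> D * ennreal (dst u v powr (\<theta> + 2)) * GG \<theta> f v"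
    using GG_moderate[OF \<theta>] by metis
  have \<kappa>: "0 \<le> \<theta> + 2" using \<theta> by simp
  have m: "(\<lambda>t. chi0 t / chi1 t) \<in> borel_measurable borel" by measurable
  show ?thesis
  proof (rule change_of_variables[OF r slow_sigma m \<kappa> D(1)], goal_cases)
    case (1 C)
    have "mn r {0<..} (\<lambda>t. GG \<theta> f (rr t)) \<le> C * mn r {0<..} (GG \<theta> f) \<and>
       mn r {0<..} (GG \<theta> f) \<le> C * mn r {0<..} (\<lambda>t. GG \<theta> f (rr t))" for f
      unfolding rr_def[abs_def] by (rule 1(2)[OF measurable_GG D(2)])
    then show ?case using 1(1) that by blast
  qed
qed

text \<open>Holmstedt's formula at \<open>rr t\<close>, multiplied by \<open>ww \<theta> t\<close>,
  inside the substituted norm. The second estimate holds for each term separately because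
  \<open>TT\<close> dominates every one of them; this gives the embeddings into the
  intersections.\<close>

lemma SS_equiv:
  assumes \<theta>: "0 \<le> \<theta>"
  obtains C where "C < top"
    "\<And>f. f \<in> sum_sp A0 A1 \<Longrightarrow> interp_sp X0 X1 \<theta> r a f \<le> C * (SS \<theta> T1 f + SS \<theta> T2 f + SS \<theta> T3 f + SS \<theta> T4 f)"
    "\<And>f T. f \<in> sum_sp A0 A1 \<Longrightarrow> T \<in> {T1, T2, T3, T4} \<Longrightarrow> SS \<theta> T f \<le> C * interp_sp X0 X1 \<theta> r a f"
proof -
  obtain C where C: "C < top"
    "\<And>f. mn r {0<..} (\<lambda>t. GG \<theta> f (rr t)) \<le> C * mn r {0<..} (GG \<theta> f)"
    "\<And>f. mn r {0<..} (GG \<theta> f) \<le> C * mn r {0<..} (\<lambda>t. GG \<theta> f (rr t))"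
    using GG_rr[OF \<theta>] by metis
  obtain U where U: "U < top"
    "\<And>f t. f \<in> sum_sp A0 A1 \<Longrightarrow> 0 < t \<Longrightarrow> Kfun X0 X1 (rr t) f \<le> U * TT (kk f) t"
    using Holmstedt_upper by metis
  obtain L where L: "L < top" "\<And>f t. 0 < t \<Longrightarrow> TT (kk f) t \<le> L * Kfun X0 X1 (rr t) f"
    using Holmstedt_lower by metis
  \<comment> \<open>The cost of one use of \<open>mn_add\<close>. Four terms take three uses, and
    \<open>Q \<ge> 1\<close> allows all coefficients to be rounded up to
    \<open>Q * Q * Q\<close>.\<close>
  define Q where "Q = 2 * Kq r"
  define C1 where "C1 = C * (U * (Q * Q * Q))"
  have Q1: "1 \<le> Q"
  proof -
    have "1 \<le> Kq r"
      unfolding Kq_def by (auto intro!: ge_one_powr_ge_zero simp flip: ennreal_1 intro: ennreal_leI)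
    then have "1 * 1 \<le> 2 * Kq r" by (intro mult_mono) auto
    then show ?thesis by (simp add: Q_def)
  qed
  have QM: "x \<le> Q * x" for x using mult_right_mono[OF Q1, of x] by simp
  have G: "GG \<theta> f (rr t) = ennreal (ww \<theta> t) * Kfun X0 X1 (rr t) f" for f t
    by (simp add: GG_def ww_def)
  show ?thesis
  proof (rule that)
    show "C1 + C * L < top"
      using C L U by (simp add: C1_def Q_def ennreal_mult_less_top)
    fix f assume f: "f \<in> sum_sp A0 A1"
    have [measurable]: "kk f \<in> borel_measurable borel" by (rule measurable_Kfun)
    note [measurable] = measurable_T[OF this]
    have "mn r {0<..} (\<lambda>t. GG \<theta> f (rr t)) \<le> U * mn r {0<..} (\<lambda>t. ennreal (ww \<theta> t) * TT (kk f) t)"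
    proof (rule mn_le_cmult[OF r])
      show "(\<lambda>t. ennreal (ww \<theta> t) * TT (kk f) t) \<in> borel_measurable borel"
        unfolding TT_def by measurable
      fix t assume "0 < (t::real)" "t \<in> {0<..}"
      then show "t \<in> {0<..} \<and> GG \<theta> f (rr t) \<le> U * (ennreal (ww \<theta> t) * TT (kk f) t)"
        unfolding G by (auto intro!: mult_cmult_mono U(2) f)
    qed simp
    also have "mn r {0<..} (\<lambda>t. ennreal (ww \<theta> t) * TT (kk f) t)
        \<le> (Q * Q * Q) * (SS \<theta> T1 f + SS \<theta> T2 f + SS \<theta> T3 f + SS \<theta> T4 f)"
    proof -
      let ?g = "\<lambda>T t. ennreal (ww \<theta> t) * T (kk f) t"
      have "mn r {0<..} (\<lambda>t. ennreal (ww \<theta> t) * TT (kk f) t)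
          = mn r {0<..} (\<lambda>t. ((?g T1 t + ?g T2 t) + ?g T3 t) + ?g T4 t)"
        unfolding TT_def by (simp add: distrib_left)
      also have "\<dots> \<le> Q * (mn r {0<..} (\<lambda>t. (?g T1 t + ?g T2 t) + ?g T3 t) + SS \<theta> T4 f)"
        unfolding Q_def SS_def by (rule mn_add[OF r]) measurable
      also have "mn r {0<..} (\<lambda>t. (?g T1 t + ?g T2 t) + ?g T3 t)
          \<le> Q * (mn r {0<..} (\<lambda>t. ?g T1 t + ?g T2 t) + SS \<theta> T3 f)"
        unfolding Q_def SS_def by (rule mn_add[OF r]) measurable
      also have "mn r {0<..} (\<lambda>t. ?g T1 t + ?g T2 t) \<le> Q * (SS \<theta> T1 f + SS \<theta> T2 f)"
        unfolding Q_def SS_def by (rule mn_add[OF r]) measurable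
      finally have "mn r {0<..} (\<lambda>t. ennreal (ww \<theta> t) * TT (kk f) t)
          \<le> Q * (Q * (Q * (SS \<theta> T1 f + SS \<theta> T2 f) + SS \<theta> T3 f) + SS \<theta> T4 f)"
        by (simp add: mult_left_mono add_right_mono)
      also have "\<dots> \<le> Q * (Q * (Q * (SS \<theta> T1 f + SS \<theta> T2 f) + Q * SS \<theta> T3 f) + Q * (Q * SS \<theta> T4 f))"
        by (intro mult_left_mono add_mono order_refl QM order_trans[OF QM QM]) auto
      also have "\<dots> = (Q * Q * Q) * (SS \<theta> T1 f + SS \<theta> T2 f + SS \<theta> T3 f + SS \<theta> T4 f)"
        by (simp add: distrib_left mult.assoc)
      finally show ?thesis .
    qed
    finally have "mn r {0<..} (\<lambda>t. GG \<theta> f (rr t)) \<le> U * ((Q * Q * Q) * (SS \<theta> T1 f + SS \<theta> T2 f + SS \<theta> T3 f + SS \<theta> T4 f))"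
      by (simp add: mult_left_mono)
    then have "C * mn r {0<..} (\<lambda>t. GG \<theta> f (rr t)) \<le> C * (U * ((Q * Q * Q) * (SS \<theta> T1 f + SS \<theta> T2 f + SS \<theta> T3 f + SS \<theta> T4 f)))"
      by (rule mult_left_mono) simp
    then have "interp_sp X0 X1 \<theta> r a f \<le> C1 * (SS \<theta> T1 f + SS \<theta> T2 f + SS \<theta> T3 f + SS \<theta> T4 f)"
      unfolding interp_X_eq[OF f] C1_def mult.assoc by (rule order_trans[OF C(3)])
    then show "interp_sp X0 X1 \<theta> r a f \<le> (C1 + C * L) * (SS \<theta> T1 f + SS \<theta> T2 f + SS \<theta> T3 f + SS \<theta> T4 f)"
      by (rule le_cmult_mono) simp
    fix T assume T: "T \<in> {T1, T2, T3, T4}"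
    have "SS \<theta> T f \<le> L * mn r {0<..} (\<lambda>t. GG \<theta> f (rr t))"
      unfolding SS_def
    proof (rule mn_le_cmult[OF r])
      fix t assume t: "0 < (t::real)" "t \<in> {0<..}"
      have "T (kk f) t \<le> TT (kk f) t"
        using T unfolding TT_def by (auto simp: add_increasing add_increasing2)
      also have "\<dots> \<le> L * Kfun X0 X1 (rr t) f" by (rule L(2)[OF t(1)])
      finally show "t \<in> {0<..} \<and> ennreal (ww \<theta> t) * T (kk f) t \<le> L * GG \<theta> f (rr t)"
        unfolding G using t by (auto intro!: mult_cmult_mono)
    qed measurable
    also have "\<dots> \<le> L * (C * mn r {0<..} (GG \<theta> f))"
      using C(2) by (rule mult_left_mono) simp
    finally have "SS \<theta> T f \<le> (C * L) * interp_sp X0 X1 \<theta> r a f"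
      unfolding interp_X_eq[OF f] by (simp only: mult_ac)
    then show "SS \<theta> T f \<le> (C1 + C * L) * interp_sp X0 X1 \<theta> r a f"
      by (rule le_cmult_mono) simp
  qed
qed

text \<open>The factor \<open>G\<close> is carried inside \<open>Mx\<close> so that
  \<open>mn_cmult\<close>, which asks for a Borel function, is applied to \<open>T2\<close> and not
  to the maximal function.\<close>

lemma SS_maximal:
  assumes \<beta>: "0 < \<beta>"
  obtains C where "C < top"
    "\<And>f G. f \<in> sum_sp A0 A1 \<Longrightarrow>
       mn r {0<..} (\<lambda>t. G * Mx \<beta> (\<lambda>u. ennreal (ww \<theta> u) * T2 (kk f) u) t) \<le> C * (G * SS \<theta> T2 f)"
proof -
  have "slow (\<lambda>t. tau \<theta> t * chi0 t)" by (intro slow_mult slow_tau slow_chi0)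
  then obtain C where C: "1 \<le> C" "\<And>s t. 0 < s \<Longrightarrow> 0 < t \<Longrightarrow> tau \<theta> s * chi0 s \<le> C * dst s t powr 1 * (tau \<theta> t * chi0 t)"
    using slowE[of "\<lambda>t. tau \<theta> t * chi0 t" 1] by auto
  have pw: "u powr (- \<theta>) \<le> 2 powr \<bar>\<theta>\<bar> * v powr (- \<theta>)" if uv: "0 < u" "0 < v" "dst u v \<le> 2" for u v
  proof -
    have "(u / v) powr (- \<theta>) \<le> 2 powr \<bar>\<theta>\<bar>"
    proof (cases "0 \<le> \<theta>")
      case True
      have "(v / u) powr \<theta> \<le> 2 powr \<theta>"
        using dst_ge_ratio(2)[of v u] uv True by (intro powr_mono2) auto
      then show ?thesis using True uv by (simp add: powr_minus powr_divide)
    next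
      case False
      then have "(u / v) powr (- \<theta>) \<le> 2 powr (- \<theta>)"
        using dst_ge_ratio(1)[of u v] uv by (intro powr_mono2) auto
      then show ?thesis using False by simp
    qed
    then show ?thesis using uv by (simp add: powr_divide pos_divide_le_eq)
  qed
  \<comment> \<open>Variation of \<open>ww * T2\<close> over a factor 2:
    \<open>2 powr |\<theta>|\<close> from the power, \<open>C * 2\<close> from
    \<open>tau * chi0\<close>, and 2 from the K-functional.\<close>
  define D where "D = ennreal (2 powr \<bar>\<theta>\<bar> * (C * 2)) * 2"
  have D: "D < top" by (simp add: D_def ennreal_mult_less_top)
  show ?thesis
  proof (rule mn_Mx[OF r \<beta> D], goal_cases)
    case (1 E)
    show ?case
    proof (rule that[OF 1(1)])
      fix f and G :: ennreal assume f: "f \<in> sum_sp A0 A1"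
      have [measurable]: "kk f \<in> borel_measurable borel" by (rule measurable_Kfun)
      note [measurable] = measurable_T[OF this]
      have "(\<lambda>t. G * Mx \<beta> (\<lambda>u. ennreal (ww \<theta> u) * T2 (kk f) u) t) =
          Mx \<beta> (\<lambda>u. G * (ennreal (ww \<theta> u) * T2 (kk f) u))"
        unfolding Mx_def SUP_mult_left_ennreal by (simp add: mult.left_commute)
      moreover have "G * SS \<theta> T2 f = mn r {0<..} (\<lambda>u. G * (ennreal (ww \<theta> u) * T2 (kk f) u))"
        unfolding SS_def by (rule mn_cmult[symmetric, OF r]) measurable
      moreover have "mn r {0<..} (Mx \<beta> (\<lambda>u. G * (ennreal (ww \<theta> u) * T2 (kk f) u)))
          \<le> E * mn r {0<..} (\<lambda>u. G * (ennreal (ww \<theta> u) * T2 (kk f) u))"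
      proof (rule 1(2))
        fix u v :: real assume uv: "0 < u" "0 < v" "dst u v \<le> 2"
        note tpos = slow_pos[OF slow_tau, of _ \<theta>]
        have "ww \<theta> u * chi0 u = u powr (- \<theta>) * (tau \<theta> u * chi0 u)"
          using uv by (simp add: ww_eq)
        also have "\<dots> \<le> (2 powr \<bar>\<theta>\<bar> * v powr (- \<theta>)) * (C * 2 * (tau \<theta> v * chi0 v))"
        proof (rule mult_mono[OF pw[OF uv]])
          have "tau \<theta> u * chi0 u \<le> C * dst u v powr 1 * (tau \<theta> v * chi0 v)" by (rule C(2)[OF uv(1,2)])
          also have "\<dots> \<le> C * 2 * (tau \<theta> v * chi0 v)"
            using uv(3) C(1) tpos[OF uv(2)] chi0_pos[OF uv(2)] dst_pos[OF uv(1,2)]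
            by (intro mult_right_mono mult_left_mono) auto
          finally show "tau \<theta> u * chi0 u \<le> C * 2 * (tau \<theta> v * chi0 v)" .
        qed (use tpos[OF uv(1)] chi0_pos[OF uv(1)] in auto)
        also have "\<dots> = (2 powr \<bar>\<theta>\<bar> * (C * 2)) * (ww \<theta> v * chi0 v)"
          using uv by (simp add: ww_eq mult_ac)
        finally have le: "ww \<theta> u * chi0 u \<le> (2 powr \<bar>\<theta>\<bar> * (C * 2)) * (ww \<theta> v * chi0 v)" .
        have "kk f u \<le> ennreal (dst u v) * kk f v" by (rule Kfun_dst[OF uv(1,2)])
        also have "\<dots> \<le> 2 * kk f v"
          using ennreal_leI[OF uv(3)] by (intro mult_right_mono) auto
        finally have k: "kk f u \<le> 2 * kk f v" .
        have T2w: "ennreal (ww \<theta> x) * T2 (kk f) x = ennreal (ww \<theta> x * chi0 x) * kk f x" if "0 < x" for x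
          unfolding T2_def using ww_pos[OF that, of \<theta>] by (intro ennreal_assoc) simp
        have "ennreal (ww \<theta> u) * T2 (kk f) u \<le> ennreal ((2 powr \<bar>\<theta>\<bar> * (C * 2)) * (ww \<theta> v * chi0 v)) * (2 * kk f v)"
          unfolding T2w[OF uv(1)] by (intro mult_mono ennreal_leI le k) auto
        also have "\<dots> = D * (ennreal (ww \<theta> v) * T2 (kk f) v)"
        proof -
          have "ennreal ((2 powr \<bar>\<theta>\<bar> * (C * 2)) * (ww \<theta> v * chi0 v)) =
              ennreal (2 powr \<bar>\<theta>\<bar> * (C * 2)) * ennreal (ww \<theta> v * chi0 v)"
            using C(1) by (intro ennreal_mult') simp
          then show ?thesis unfolding T2w[OF uv(2)] D_def by (simp only: mult_ac)
        qed
        finally show "G * (ennreal (ww \<theta> u) * T2 (kk f) u) \<le> D * (G * (ennreal (ww \<theta> v) * T2 (kk f) v))"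
          by (rule mult_cmult_mono)
      qed measurable
      ultimately show "mn r {0<..} (\<lambda>t. G * Mx \<beta> (\<lambda>u. ennreal (ww \<theta> u) * T2 (kk f) u) t) \<le> E * (G * SS \<theta> T2 f)"
        by simp
    qed
  qed
qed

lemma SS_Hardy:
  assumes \<beta>: "0 < \<beta>" and G: "G < top"
    and le: "\<And>k t. qc k \<Longrightarrow> 0 < t \<Longrightarrow>
       ennreal (t powr (- \<theta>) * tau \<theta> t) * T k t \<le> G * Mx \<beta> (\<lambda>u. ennreal (u powr (- \<theta>) * tau \<theta> u) * T2 k u) t"
  obtains C where "C < top" "\<And>f. f \<in> sum_sp A0 A1 \<Longrightarrow> SS \<theta> T f \<le> C * SS \<theta> T2 f"
proof -
  obtain C where C: "C < top"
    "\<And>f G. f \<in> sum_sp A0 A1 \<Longrightarrow>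
       mn r {0<..} (\<lambda>t. G * Mx \<beta> (\<lambda>u. ennreal (ww \<theta> u) * T2 (kk f) u) t) \<le> C * (G * SS \<theta> T2 f)"
    using SS_maximal[OF \<beta>] by metis
  show ?thesis
  proof (rule that)
    show "C * G < top" using G C by (simp add: ennreal_mult_less_top)
    fix f assume f: "f \<in> sum_sp A0 A1"
    have cong: "Mx \<beta> (\<lambda>u. ennreal (u powr (- \<theta>) * tau \<theta> u) * T2 (kk f) u) = Mx \<beta> (\<lambda>u. ennreal (ww \<theta> u) * T2 (kk f) u)"
      unfolding Mx_def by (intro ext SUP_cong) (auto simp: ww_eq)
    have "SS \<theta> T f \<le> mn r {0<..} (\<lambda>t. G * Mx \<beta> (\<lambda>u. ennreal (ww \<theta> u) * T2 (kk f) u) t)"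
      unfolding SS_def
    proof (rule mn_mono[OF r])
      fix t assume t: "0 < (t::real)" "t \<in> {0<..}"
      show "t \<in> {0<..} \<and> ennreal (ww \<theta> t) * T (kk f) t \<le> G * Mx \<beta> (\<lambda>u. ennreal (ww \<theta> u) * T2 (kk f) u) t"
        using le[OF qc_Kfun[OF f] t(1)] t unfolding cong by (simp add: ww_eq)
    qed
    also have "\<dots> \<le> C * (G * SS \<theta> T2 f)" by (rule C(2)[OF f])
    finally show "SS \<theta> T f \<le> (C * G) * SS \<theta> T2 f" by (simp only: mult.assoc)
  qed
qed

lemma SS_Hardy_1:
  assumes "0 < \<theta>"
  obtains C where "C < top" "\<And>f. f \<in> sum_sp A0 A1 \<Longrightarrow> SS \<theta> T1 f \<le> C * SS \<theta> T2 f"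
proof (rule Hardy_T1[OF assms slow_tau[of \<theta>]], goal_cases)
  case (1 G)
  have "0 < \<theta> / 4" using assms by simp
  from SS_Hardy[OF this 1(2) 1(3)] that show ?case by metis
qed

lemma SS_Hardy_34:
  assumes "\<theta> < 1"
  obtains C where "C < top" "\<And>f. f \<in> sum_sp A0 A1 \<Longrightarrow> SS \<theta> T3 f \<le> C * SS \<theta> T2 f"
    "\<And>f. f \<in> sum_sp A0 A1 \<Longrightarrow> SS \<theta> T4 f \<le> C * SS \<theta> T2 f"
proof -
  have \<beta>: "0 < (1 - \<theta>) / 4" using assms by simp
  have 3: "\<exists>C<top. \<forall>f\<in>sum_sp A0 A1. SS \<theta> T3 f \<le> C * SS \<theta> T2 f"
  proof (rule Hardy_T3[OF assms slow_tau[of \<theta>]], goal_cases)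
    case (1 G)
    from SS_Hardy[OF \<beta> 1(1) 1(2)] show ?case by metis
  qed
  have 4: "\<exists>C<top. \<forall>f\<in>sum_sp A0 A1. SS \<theta> T4 f \<le> C * SS \<theta> T2 f"
  proof (rule Hardy_T4[OF assms slow_tau[of \<theta>]], goal_cases)
    case (1 G)
    from SS_Hardy[OF \<beta> 1(1) 1(2)] show ?case by metis
  qed
  from 3 obtain C where C: "C < top" "\<forall>f\<in>sum_sp A0 A1. SS \<theta> T3 f \<le> C * SS \<theta> T2 f" by blast
  from 4 obtain D where D: "D < top" "\<forall>f\<in>sum_sp A0 A1. SS \<theta> T4 f \<le> D * SS \<theta> T2 f" by blast
  show ?thesis
  proof (rule that[of "C + D"])
    show "C + D < top" using C D by simp
    show "SS \<theta> T3 f \<le> (C + D) * SS \<theta> T2 f" if "f \<in> sum_sp A0 A1" for f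
      by (rule le_cmult_mono[OF C(2)[rule_format, OF that]]) simp
    show "SS \<theta> T4 f \<le> (C + D) * SS \<theta> T2 f" if "f \<in> sum_sp A0 A1" for f
      by (rule le_cmult_mono[OF D(2)[rule_format, OF that]]) simp
  qed
qed

text \<open>This is where \<open>a^#\<close> comes from:
  \<open>(chi0 / chi1) powr (- \<theta>) * chi0\<close> equals
  \<open>chi0 powr (1 - \<theta>) * chi1 powr \<theta>\<close>, so \<open>a^#\<close> is the weight
  of \<open>T2\<close> after the substitution.\<close>

lemma interp_sharp_eq:
  assumes f: "f \<in> sum_sp A0 A1"
  shows "interp_sp A0 A1 \<theta> r (sharp \<theta> chi0 chi1 a) f = SS \<theta> T2 f"
proof -
  have eq: "rho chi0 chi1 = rr" by (simp add: fun_eq_iff rho_def rr_def)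
  have [measurable]: "sharp \<theta> chi0 chi1 a \<in> borel_measurable borel"
    unfolding sharp_def[abs_def] eq comp_def by measurable
  have "interp_sp A0 A1 \<theta> r (sharp \<theta> chi0 chi1 a) f =
      mn r {0<..} (\<lambda>u. ennreal (u powr (- \<theta>) * sharp \<theta> chi0 chi1 a u) * kk f u)"
    using f unfolding interp_sp_def by (simp only: if_True) (intro wnorm_eq_mn r; simp)
  also have "\<dots> = SS \<theta> T2 f"
    unfolding SS_def
  proof (rule mn_cong[OF r])
    fix t assume t: "0 < (t::real)"
    note p = chi0_pos[OF t] chi1_pos[OF t]
    have "t powr (- \<theta>) * sharp \<theta> chi0 chi1 a t = ww \<theta> t * chi0 t"
    proof -
      have "chi0 t powr (1 - \<theta>) = chi0 t powr (- \<theta>) * chi0 t"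
        using powr_add[of "chi0 t" "- \<theta>" 1] p by simp
      moreover have "(chi0 t / chi1 t) powr (- \<theta>) = chi0 t powr (- \<theta>) * chi1 t powr \<theta>"
        using p by (simp add: powr_divide powr_minus field_simps)
      ultimately show ?thesis
        by (simp add: ww_eq[OF t] tau_def sharp_def eq mult_ac)
    qed
    then show "ennreal (t powr (- \<theta>) * sharp \<theta> chi0 chi1 a t) * kk f t = ennreal (ww \<theta> t) * T2 (kk f) t"
      unfolding T2_def using ww_pos[OF t, of \<theta>] by (simp add: ennreal_assoc)
  qed
  finally show ?thesis .
qed

lemma L_sp_eq:
  assumes f: "f \<in> sum_sp A0 A1"
  shows "L_sp A0 A1 0 r (a \<circ> rr) r0 b0 f = SS 0 T1 f"
proof -
  have T1: "wnorm 0 r0 b0 {0<..<t} (kk f) = T1 (kk f) t" if "0 < t" for t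
  proof -
    have "wnorm 0 r0 b0 {0<..<t} (kk f) = mn r0 {0<..<t} (\<lambda>u. ennreal (u powr (- 0) * b0 u) * kk f u)"
      by (intro wnorm_eq_mn r0) auto
    also have "\<dots> = T1 (kk f) t" unfolding T1_def by (intro mn_cong r0) simp
    finally show ?thesis .
  qed
  have [measurable]: "kk f \<in> borel_measurable borel" by (rule measurable_Kfun)
  note [measurable] = measurable_T[OF this]
  have "L_sp A0 A1 0 r (a \<circ> rr) r0 b0 f = wnorm 0 r (a \<circ> rr) {0<..} (T1 (kk f))"
    using f T1 unfolding L_sp_def by (simp only: if_True) (intro wnorm_cong r; simp)
  also have "\<dots> = mn r {0<..} (\<lambda>u. ennreal (u powr (- 0) * (a \<circ> rr) u) * T1 (kk f) u)"
    unfolding comp_def by (intro wnorm_eq_mn r) auto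
  also have "\<dots> = SS 0 T1 f"
    unfolding SS_def by (intro mn_cong r) (simp add: ww_def rr_pos less_imp_neq[symmetric])
  finally show ?thesis .
qed

text \<open>For \<theta> = 1 the weight contains \<open>1 / rr t\<close>, which cancels the factor
  \<open>rr t\<close> of \<open>T3\<close> and \<open>T4\<close>. The choice \<open>x = hh t\<close>
  gives the weight \<open>B_1\<close>, and \<open>x = 1\<close> gives
  \<open>a \<circ> rr\<close>.\<close>

lemma ww_1: "0 < t \<Longrightarrow> ennreal (ww 1 t) * (ennreal (rr t * x) * z) = ennreal (x * a (rr t)) * z"
proof -
  assume t: "0 < t"
  have "ww 1 t * (rr t * x) = x * a (rr t)"
    using rr_pos[OF t] by (simp add: ww_def powr_minus)
  moreover have "ennreal (ww 1 t) * (ennreal (rr t * x) * z) = ennreal (ww 1 t * (rr t * x)) * z"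
    using ww_pos[OF t, of 1] by (intro ennreal_assoc) simp
  ultimately show ?thesis by (simp only:)
qed

lemma R_sp_eq:
  assumes f: "f \<in> sum_sp A0 A1"
  shows "R_sp A0 A1 1 r (\<lambda>t. hh t * a (rr t)) q1 a1 f = SS 1 T3 f"
proof -
  have "R_sp A0 A1 1 r (\<lambda>t. hh t * a (rr t)) q1 a1 f = wnorm 0 r (\<lambda>t. hh t * a (rr t)) {0<..} (PP (kk f))"
    using f wnorm_PP unfolding R_sp_def by (simp only: if_True) (intro wnorm_cong r; simp)
  also have "\<dots> = mn r {0<..} (\<lambda>u. ennreal (u powr (- 0) * (hh u * a (rr u))) * PP (kk f) u)"
    by (intro wnorm_eq_mn r) auto
  also have "\<dots> = SS 1 T3 f"
    unfolding SS_def T3_def by (intro mn_cong r) (simp add: ww_1)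
  finally show ?thesis .
qed

lemma RR_sp_eq:
  assumes f: "f \<in> sum_sp A0 A1"
  shows "RR_sp A0 A1 1 r (a \<circ> rr) r1 b1 q1 a1 f = SS 1 T4 f"
proof -
  let ?N = "\<lambda>t. mn r1 {t<..} (\<lambda>s. ennreal (b1 s) * PP (kk f) s)"
  have [measurable]: "?N \<in> borel_measurable borel" by (rule measurable_mn_Ioi[OF r1])
  have N: "wnorm 0 r1 b1 {t<..} (\<lambda>u. wnorm 1 q1 a1 {u<..} (kk f)) = ?N t" if t: "0 < t" for t
  proof -
    have "wnorm 0 r1 b1 {t<..} (\<lambda>u. wnorm 1 q1 a1 {u<..} (kk f)) = wnorm 0 r1 b1 {t<..} (PP (kk f))"
      using t wnorm_PP by (intro wnorm_cong r1) auto
    also have "\<dots> = mn r1 {t<..} (\<lambda>u. ennreal (u powr (- 0) * b1 u) * PP (kk f) u)"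
      using t by (intro wnorm_eq_mn r1) auto
    also have "\<dots> = ?N t" by (intro mn_cong r1) simp
    finally show ?thesis .
  qed
  have "RR_sp A0 A1 1 r (a \<circ> rr) r1 b1 q1 a1 f = wnorm 0 r (a \<circ> rr) {0<..} ?N"
    using f N unfolding RR_sp_def by (simp only: if_True) (intro wnorm_cong r; simp)
  also have "\<dots> = mn r {0<..} (\<lambda>u. ennreal (u powr (- 0) * (a \<circ> rr) u) * ?N u)"
    unfolding comp_def by (intro wnorm_eq_mn r) measurable
  also have "\<dots> = SS 1 T4 f"
    unfolding SS_def T4_def using ww_1[of _ 1] by (intro mn_cong r) simp
  finally show ?thesis .
qed

end

section \<open>Assembling the three cases from the four terms\<close>

context reiteration_target
begin

abbreviation Sharp :: "real \<Rightarrow> 'v qnorm" where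
  "Sharp \<theta> \<equiv> interp_sp A0 A1 \<theta> r (sharp \<theta> chi0 chi1 a)"

abbreviation Inter0 :: "'v qnorm" where
  "Inter0 \<equiv> Sharp 0 \<sqinter>\<^sub>q L_sp A0 A1 0 r (a \<circ> rr) r0 b0"

abbreviation Inter1 :: "'v qnorm" where
  "Inter1 \<equiv> Sharp 1 \<sqinter>\<^sub>q R_sp A0 A1 1 r (\<lambda>t. hh t * a (rr t)) q1 a1 \<sqinter>\<^sub>q RR_sp A0 A1 1 r (a \<circ> rr) r1 b1 q1 a1"

lemma not_sum_top:
  assumes "f \<notin> sum_sp A0 A1"
  shows "interp_sp A0 A1 \<theta> q b f = top" "L_sp A0 A1 \<theta> p b q c f = top"
    "R_sp A0 A1 \<theta> p b q c f = top" "RR_sp A0 A1 \<theta> p b s d q c f = top"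
  using assms by (simp_all add: interp_sp_def L_sp_def R_sp_def RR_sp_def)

lemma reiteration_i:
  assumes \<theta>: "0 < \<theta>" "\<theta> < 1"
  shows "qle (interp_sp X0 X1 \<theta> r a) (Sharp \<theta>)"
    and "qle (Sharp \<theta>) (interp_sp X0 X1 \<theta> r a)"
proof -
  have \<theta>0: "0 \<le> \<theta>" using \<theta> by simp
  obtain C where C: "C < top"
    "\<And>f. f \<in> sum_sp A0 A1 \<Longrightarrow> interp_sp X0 X1 \<theta> r a f \<le> C * (SS \<theta> T1 f + SS \<theta> T2 f + SS \<theta> T3 f + SS \<theta> T4 f)"
    "\<And>f T. f \<in> sum_sp A0 A1 \<Longrightarrow> T \<in> {T1, T2, T3, T4} \<Longrightarrow> SS \<theta> T f \<le> C * interp_sp X0 X1 \<theta> r a f"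
    using SS_equiv[OF \<theta>0] by metis
  obtain D where D: "D < top" "\<And>f. f \<in> sum_sp A0 A1 \<Longrightarrow> SS \<theta> T1 f \<le> D * SS \<theta> T2 f"
    using SS_Hardy_1[OF \<theta>(1)] by metis
  obtain E where E: "E < top" "\<And>f. f \<in> sum_sp A0 A1 \<Longrightarrow> SS \<theta> T3 f \<le> E * SS \<theta> T2 f"
    "\<And>f. f \<in> sum_sp A0 A1 \<Longrightarrow> SS \<theta> T4 f \<le> E * SS \<theta> T2 f"
    using SS_Hardy_34[OF \<theta>(2)] by metis
  show "qle (interp_sp X0 X1 \<theta> r a) (Sharp \<theta>)"
  proof (rule qleI)
    show "C * (D + 1 + E + E) < top" using C D E by (simp add: ennreal_mult_less_top)
    fix f assume f: "f \<in> sum_sp A0 A1"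
    have "interp_sp X0 X1 \<theta> r a f \<le> C * (D * SS \<theta> T2 f + 1 * SS \<theta> T2 f + E * SS \<theta> T2 f + E * SS \<theta> T2 f)"
      by (rule order_trans[OF C(2)[OF f]], intro mult_left_mono add_mono D(2)[OF f] E(2,3)[OF f]) auto
    then show "interp_sp X0 X1 \<theta> r a f \<le> (C * (D + 1 + E + E)) * Sharp \<theta> f"
      unfolding interp_sharp_eq[OF f] by (simp only: distrib_right[symmetric] mult.assoc)
  qed (rule not_sum_top(1))
  show "qle (Sharp \<theta>) (interp_sp X0 X1 \<theta> r a)"
    by (rule qleI[where S = "sum_sp A0 A1", OF C(1)]) (simp_all add: interp_sharp_eq C(3) interp_X_sum)
qed

lemma reiteration_ii:
  shows "qle (interp_sp X0 X1 0 r a) Inter0"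
    and "qle Inter0 (interp_sp X0 X1 0 r a)"
proof -
  obtain C where C: "C < top"
    "\<And>f. f \<in> sum_sp A0 A1 \<Longrightarrow> interp_sp X0 X1 0 r a f \<le> C * (SS 0 T1 f + SS 0 T2 f + SS 0 T3 f + SS 0 T4 f)"
    "\<And>f T. f \<in> sum_sp A0 A1 \<Longrightarrow> T \<in> {T1, T2, T3, T4} \<Longrightarrow> SS 0 T f \<le> C * interp_sp X0 X1 0 r a f"
    using SS_equiv[of 0] by (metis order_refl)
  obtain E where E: "E < top" "\<And>f. f \<in> sum_sp A0 A1 \<Longrightarrow> SS 0 T3 f \<le> E * SS 0 T2 f"
    "\<And>f. f \<in> sum_sp A0 A1 \<Longrightarrow> SS 0 T4 f \<le> E * SS 0 T2 f"
    using SS_Hardy_34[of 0] by (metis zero_less_one)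
  show "qle (interp_sp X0 X1 0 r a) Inter0"
  proof (rule qleI)
    show "C * (1 + 1 + E + E) < top" using C E by (simp add: ennreal_mult_less_top)
    fix f assume f: "f \<in> sum_sp A0 A1"
    let ?m = "max (SS 0 T2 f) (SS 0 T1 f)"
    have "interp_sp X0 X1 0 r a f \<le> C * (1 * SS 0 T1 f + 1 * SS 0 T2 f + E * SS 0 T2 f + E * SS 0 T2 f)"
      by (rule order_trans[OF C(2)[OF f]], intro mult_left_mono add_mono E(2,3)[OF f]) auto
    also have "\<dots> \<le> C * (1 * ?m + 1 * ?m + E * ?m + E * ?m)"
      by (intro mult_left_mono add_mono) auto
    finally show "interp_sp X0 X1 0 r a f \<le> (C * (1 + 1 + E + E)) * Inter0 f"
      unfolding inter_sp_def interp_sharp_eq[OF f] L_sp_eq[OF f] by (simp only: distrib_right[symmetric] mult.assoc)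
  qed (simp add: inter_sp_def not_sum_top)
  show "qle Inter0 (interp_sp X0 X1 0 r a)"
    by (rule qleI[where S = "sum_sp A0 A1", OF C(1)]) (simp_all add: inter_sp_def interp_sharp_eq L_sp_eq C(3) interp_X_sum)
qed

lemma reiteration_iii:
  shows "qle (interp_sp X0 X1 1 r a) Inter1"
    and "qle Inter1 (interp_sp X0 X1 1 r a)"
proof -
  obtain C where C: "C < top"
    "\<And>f. f \<in> sum_sp A0 A1 \<Longrightarrow> interp_sp X0 X1 1 r a f \<le> C * (SS 1 T1 f + SS 1 T2 f + SS 1 T3 f + SS 1 T4 f)"
    "\<And>f T. f \<in> sum_sp A0 A1 \<Longrightarrow> T \<in> {T1, T2, T3, T4} \<Longrightarrow> SS 1 T f \<le> C * interp_sp X0 X1 1 r a f"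
    using SS_equiv[of 1] by (metis zero_le_one)
  obtain D where D: "D < top" "\<And>f. f \<in> sum_sp A0 A1 \<Longrightarrow> SS 1 T1 f \<le> D * SS 1 T2 f"
    using SS_Hardy_1[of 1] by (metis zero_less_one)
  show "qle (interp_sp X0 X1 1 r a) Inter1"
  proof (rule qleI)
    show "C * (D + 1 + 1 + 1) < top" using C D by (simp add: ennreal_mult_less_top)
    fix f assume f: "f \<in> sum_sp A0 A1"
    let ?m = "max (max (SS 1 T2 f) (SS 1 T3 f)) (SS 1 T4 f)"
    have "interp_sp X0 X1 1 r a f \<le> C * (D * SS 1 T2 f + 1 * SS 1 T2 f + 1 * SS 1 T3 f + 1 * SS 1 T4 f)"
      by (rule order_trans[OF C(2)[OF f]], intro mult_left_mono add_mono D(2)[OF f]) auto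
    also have "\<dots> \<le> C * (D * ?m + 1 * ?m + 1 * ?m + 1 * ?m)"
      by (intro mult_left_mono add_mono) (auto simp: le_max_iff_disj)
    finally show "interp_sp X0 X1 1 r a f \<le> (C * (D + 1 + 1 + 1)) * Inter1 f"
      unfolding inter_sp_def interp_sharp_eq[OF f] R_sp_eq[OF f] RR_sp_eq[OF f]
      by (simp only: distrib_right[symmetric] mult.assoc)
  qed (simp add: inter_sp_def not_sum_top)
  show "qle Inter1 (interp_sp X0 X1 1 r a)"
    by (rule qleI[where S = "sum_sp A0 A1", OF C(1)])
       (simp_all add: inter_sp_def interp_sharp_eq R_sp_eq RR_sp_eq C(3) interp_X_sum)
qed

end

section \<open>Passing to equivalent weights\<close>

lemma equiv_funE:
  assumes "equiv_fun f g"
  obtains C where "0 < C" "\<And>t. 0 < t \<Longrightarrow> f t \<le> C * g t" "\<And>t. 0 < t \<Longrightarrow> g t \<le> C * f t"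
proof -
  obtain C where C: "C > 0" "\<forall>t>0. inverse C * g t \<le> f t \<and> f t \<le> C * g t"
    using assms unfolding equiv_fun_def by (elim conjE exE)
  show ?thesis
  proof (rule that[OF C(1)])
    fix t :: real assume "0 < t"
    then have *: "inverse C * g t \<le> f t" "f t \<le> C * g t" using C(2) by auto
    show "f t \<le> C * g t" by (rule *(2))
    show "g t \<le> C * f t" using *(1) C(1) by (simp add: field_simps)
  qed
qed

lemma equiv_fun_pos: "equiv_fun f g \<Longrightarrow> 0 < t \<Longrightarrow> 0 < f t" "equiv_fun f g \<Longrightarrow> 0 < t \<Longrightarrow> 0 < g t"
  by (simp_all add: equiv_fun_def)

lemma equiv_funI:
  assumes "0 < C" "\<And>t. 0 < t \<Longrightarrow> 0 < f t" "\<And>t. 0 < t \<Longrightarrow> 0 < g t"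
    "\<And>t. 0 < t \<Longrightarrow> f t \<le> C * g t" "\<And>t. 0 < t \<Longrightarrow> g t \<le> C * f t"
  shows "equiv_fun f g"
  unfolding equiv_fun_def
proof (intro conjI exI[of _ C] allI impI assms)
  fix t :: real assume "0 < t"
  from assms(5)[OF this] show "inverse C * g t \<le> f t" using assms(1) by (simp add: field_simps)
qed

lemma equiv_fun_sym:
  assumes "equiv_fun f g"
  shows "equiv_fun g f"
proof -
  obtain C where C: "0 < C" "\<And>t. 0 < t \<Longrightarrow> f t \<le> C * g t" "\<And>t. 0 < t \<Longrightarrow> g t \<le> C * f t"
    using equiv_funE[OF assms] by metis
  show ?thesis
    by (rule equiv_funI[OF C(1) equiv_fun_pos(2)[OF assms] equiv_fun_pos(1)[OF assms] C(3) C(2)])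
qed

lemma equiv_fun_mult:
  assumes f: "equiv_fun f f'" and g: "equiv_fun g g'"
  shows "equiv_fun (\<lambda>t. f t * g t) (\<lambda>t. f' t * g' t)"
proof -
  obtain C where C: "0 < C" "\<And>t. 0 < t \<Longrightarrow> f t \<le> C * f' t" "\<And>t. 0 < t \<Longrightarrow> f' t \<le> C * f t"
    using equiv_funE[OF f] by metis
  obtain D where D: "0 < D" "\<And>t. 0 < t \<Longrightarrow> g t \<le> D * g' t" "\<And>t. 0 < t \<Longrightarrow> g' t \<le> D * g t"
    using equiv_funE[OF g] by metis
  show ?thesis
  proof (rule equiv_funI[of "C * D"])
    fix t :: real assume t: "0 < t"
    note p = equiv_fun_pos[OF f t] equiv_fun_pos[OF g t]
    show "0 < f t * g t" "0 < f' t * g' t" using p by auto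
    have "f t * g t \<le> (C * f' t) * (D * g' t)"
      using C(1) D(1) p by (intro mult_mono C(2) D(2) t) auto
    then show "f t * g t \<le> (C * D) * (f' t * g' t)" by (simp only: mult_ac)
    have "f' t * g' t \<le> (C * f t) * (D * g t)"
      using C(1) D(1) p by (intro mult_mono C(3) D(3) t) auto
    then show "f' t * g' t \<le> (C * D) * (f t * g t)" by (simp only: mult_ac)
  qed (use C D in auto)
qed

lemma equiv_fun_powr:
  assumes f: "equiv_fun f f'" and \<gamma>: "0 \<le> \<gamma>"
  shows "equiv_fun (\<lambda>t. f t powr \<gamma>) (\<lambda>t. f' t powr \<gamma>)"
proof -
  obtain C where C: "0 < C" "\<And>t. 0 < t \<Longrightarrow> f t \<le> C * f' t" "\<And>t. 0 < t \<Longrightarrow> f' t \<le> C * f t"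
    using equiv_funE[OF f] by metis
  show ?thesis
  proof (rule equiv_funI[of "C powr \<gamma>"])
    fix t :: real assume t: "0 < t"
    note p = equiv_fun_pos[OF f t]
    show "0 < f t powr \<gamma>" "0 < f' t powr \<gamma>" using p by auto
    have "f t powr \<gamma> \<le> (C * f' t) powr \<gamma>" using p \<gamma> by (intro powr_mono2 C t) auto
    then show "f t powr \<gamma> \<le> C powr \<gamma> * f' t powr \<gamma>" using C(1) p by (simp add: powr_mult)
    have "f' t powr \<gamma> \<le> (C * f t) powr \<gamma>" using p \<gamma> by (intro powr_mono2 C t) auto
    then show "f' t powr \<gamma> \<le> C powr \<gamma> * f t powr \<gamma>" using C(1) p by (simp add: powr_mult)
  qed (use C in auto)
qed

text \<open>Two changes are made: from \<open>a\<close> to \<open>a'\<close> at the same argument,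
  and from \<open>\<rho> t\<close> to \<open>\<rho>' t\<close>, which stay within bounded distance.
  Slow variation of \<open>a'\<close> controls the second.\<close>

lemma equiv_fun_compose:
  assumes a: "equiv_fun a a'" and s: "slow a'" and \<rho>: "equiv_fun \<rho> \<rho>'"
  shows "equiv_fun (a \<circ> \<rho>) (a' \<circ> \<rho>')"
proof -
  obtain C where C: "0 < C" "\<And>t. 0 < t \<Longrightarrow> \<rho> t \<le> C * \<rho>' t" "\<And>t. 0 < t \<Longrightarrow> \<rho>' t \<le> C * \<rho> t"
    using equiv_funE[OF \<rho>] by metis
  obtain D where D: "0 < D" "\<And>t. 0 < t \<Longrightarrow> a t \<le> D * a' t" "\<And>t. 0 < t \<Longrightarrow> a' t \<le> D * a t"
    using equiv_funE[OF a] by metis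
  obtain E where E: "1 \<le> E" "\<And>s t. 0 < s \<Longrightarrow> 0 < t \<Longrightarrow> a' s \<le> E * dst s t powr 1 * a' t"
    using slowE[OF s, of 1] by auto
  have near: "a' x \<le> E * C * a' y" if xy: "0 < x" "0 < y" "dst x y \<le> C" for x y
  proof -
    have "a' x \<le> E * dst x y powr 1 * a' y" by (rule E(2)[OF xy(1,2)])
    also have "\<dots> \<le> E * C * a' y"
      using xy dst_pos[OF xy(1,2)] E(1) slow_pos[OF s xy(2)]
      by (intro mult_right_mono mult_left_mono) auto
    finally show ?thesis .
  qed
  show ?thesis
  proof (rule equiv_funI[of "D * (E * C)"])
    fix t :: real assume t: "0 < t"
    note p = equiv_fun_pos[OF \<rho> t]
    show "0 < (a \<circ> \<rho>) t" "0 < (a' \<circ> \<rho>') t" using equiv_fun_pos[OF a] p by auto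
    have d: "dst (\<rho> t) (\<rho>' t) \<le> C"
      using C(2,3)[OF t] p by (simp add: dst_def pos_divide_le_eq)
    have "a (\<rho> t) \<le> D * a' (\<rho> t)" by (rule D(2)[OF p(1)])
    also have "\<dots> \<le> D * (E * C * a' (\<rho>' t))"
      using D(1) by (intro mult_left_mono near p d) auto
    finally show "(a \<circ> \<rho>) t \<le> D * (E * C) * (a' \<circ> \<rho>') t" by (simp add: mult.assoc)
    have "a' (\<rho>' t) \<le> E * C * a' (\<rho> t)"
      using d by (intro near p) (simp add: dst_commute)
    also have "\<dots> \<le> E * C * (D * a (\<rho> t))"
      using E(1) C(1) by (intro mult_left_mono D(3) p) auto
    finally show "(a' \<circ> \<rho>') t \<le> D * (E * C) * (a \<circ> \<rho>) t" by (simp add: mult_ac)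
  qed (use C D E in auto)
qed

text \<open>For \<open>s \<le> t\<close> use the almost increasing function
  \<open>t powr \<epsilon> * b t\<close>, otherwise the almost decreasing one. Passing to the
  monotone comparison function and back squares the constants.\<close>

lemma SV_almost_monotone:
  assumes b: "b \<in> SV" and \<epsilon>: "0 < \<epsilon>"
  obtains C where "0 < C" "\<And>s t. 0 < s \<Longrightarrow> 0 < t \<Longrightarrow> b s \<le> C * dst s t powr \<epsilon> * b t"
proof -
  have ex: "(\<exists>g. mono_on {0<..} g \<and> equiv_fun (\<lambda>t. t powr \<epsilon> * b t) g) \<and>
        (\<exists>g. antimono_on {0<..} g \<and> equiv_fun (\<lambda>t. t powr (- \<epsilon>) * b t) g)"
    using b \<epsilon> by (simp add: SV_def)
  obtain g where g: "mono_on {0<..} g" "equiv_fun (\<lambda>t. t powr \<epsilon> * b t) g" using ex by blast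
  obtain h where h: "antimono_on {0<..} h" "equiv_fun (\<lambda>t. t powr (- \<epsilon>) * b t) h" using ex by blast
  have pos: "0 < b t" if "0 < t" for t using b that by (simp add: SV_def)
  obtain C where C: "0 < C" "\<And>t. 0 < t \<Longrightarrow> t powr \<epsilon> * b t \<le> C * g t" "\<And>t. 0 < t \<Longrightarrow> g t \<le> C * (t powr \<epsilon> * b t)"
    using equiv_funE[OF g(2)] by metis
  obtain D where D: "0 < D" "\<And>t. 0 < t \<Longrightarrow> t powr (- \<epsilon>) * b t \<le> D * h t" "\<And>t. 0 < t \<Longrightarrow> h t \<le> D * (t powr (- \<epsilon>) * b t)"
    using equiv_funE[OF h(2)] by metis
  show ?thesis
  proof (rule that[of "C * C + D * D"])
    show "0 < C * C + D * D" using C(1) by (simp add: add_pos_nonneg)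
    fix s t :: real assume st: "0 < s" "0 < t"
    show "b s \<le> (C * C + D * D) * dst s t powr \<epsilon> * b t"
    proof (cases "s \<le> t")
      case True
      have "s powr \<epsilon> * b s \<le> C * g s" by (rule C(2)[OF st(1)])
      also have "\<dots> \<le> C * g t"
        using C(1) st True by (intro mult_left_mono mono_onD[OF g(1)]) auto
      also have "\<dots> \<le> C * (C * (t powr \<epsilon> * b t))" using C(1) by (intro mult_left_mono C(3) st) auto
      finally have "b s \<le> C * C * (t powr \<epsilon> / s powr \<epsilon>) * b t" using st by (simp add: field_simps)
      also have "t powr \<epsilon> / s powr \<epsilon> = dst s t powr \<epsilon>" using st True by (simp add: dst_le powr_divide)
      also have "C * C * dst s t powr \<epsilon> * b t \<le> (C * C + D * D) * dst s t powr \<epsilon> * b t"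
        using pos[OF st(2)] by (intro mult_right_mono) auto
      finally show ?thesis .
    next
      case False
      have "s powr (- \<epsilon>) * b s \<le> D * h s" by (rule D(2)[OF st(1)])
      also have "\<dots> \<le> D * h t"
        using D(1) st False monotone_onD[OF h(1), of t s] by (intro mult_left_mono) auto
      also have "\<dots> \<le> D * (D * (t powr (- \<epsilon>) * b t))" using D(1) by (intro mult_left_mono D(3) st) auto
      finally have "b s \<le> D * D * (s powr \<epsilon> / t powr \<epsilon>) * b t" using st by (simp add: powr_minus field_simps)
      also have "s powr \<epsilon> / t powr \<epsilon> = dst s t powr \<epsilon>" using st False by (simp add: dst_ge powr_divide)
      also have "D * D * dst s t powr \<epsilon> * b t \<le> (C * C + D * D) * dst s t powr \<epsilon> * b t"
        using pos[OF st(2)] by (intro mult_right_mono) auto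
      finally show ?thesis .
    qed
  qed
qed

text \<open>Sampling on a geometric grid turns any slowly varying function into a Borel one.\<close>

lemma SV_Borel:
  assumes b: "b \<in> SV"
  obtains b' where "slow b'" "b' \<in> borel_measurable borel" "equiv_fun b b'"
proof -
  have pos: "0 < b t" if "0 < t" for t using b that by (simp add: SV_def)
  have sl: "slow b"
    unfolding slow_def
  proof (intro conjI allI impI pos)
    fix \<epsilon> :: real assume "0 < \<epsilon>"
    then obtain C where "\<And>s t. 0 < s \<Longrightarrow> 0 < t \<Longrightarrow> b s \<le> C * dst s t powr \<epsilon> * b t"
      using SV_almost_monotone[OF b] by metis
    then show "\<exists>C. \<forall>s>0. \<forall>t>0. b s \<le> C * dst s t powr \<epsilon> * b t" by blast
  qed
  define n where "n = (\<lambda>t::real. \<lfloor>log 2 t\<rfloor>)"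
  define b' where "b' = (\<lambda>t. b (2 powr real_of_int (n t)))"
  \<comment> \<open>The grid index takes values in a discrete space, where every function is
    measurable; hence \<open>b'\<close> is Borel whatever the values of \<open>b\<close>
    are.\<close>
  have [measurable]: "n \<in> measurable borel (count_space UNIV)" unfolding n_def by measurable
  have "b' \<in> borel_measurable borel" unfolding b'_def
    by (rule measurable_compose[of n]) measurable
  moreover have near: "dst t (2 powr real_of_int (n t)) \<le> 2" if t: "0 < t" for t
  proof -
    have "real_of_int (n t) \<le> log 2 t" "log 2 t < real_of_int (n t) + 1" unfolding n_def by linarith+
    then have "2 powr real_of_int (n t) \<le> 2 powr log 2 t" "2 powr log 2 t \<le> 2 powr (real_of_int (n t) + 1)"
      by (auto intro: powr_mono)
    then have "2 powr real_of_int (n t) \<le> t" "t \<le> 2 * 2 powr real_of_int (n t)"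
      using t by (auto simp: powr_add)
    then show ?thesis by (simp add: dst_ge pos_divide_le_eq)
  qed
  have eq: "equiv_fun b b'"
  proof -
    obtain C where C: "1 \<le> C" "\<And>s t. 0 < s \<Longrightarrow> 0 < t \<Longrightarrow> b s \<le> C * dst s t powr 1 * b t"
      using slowE[OF sl, of 1] by auto
    have cl: "b x \<le> C * 2 * b y" if xy: "0 < x" "0 < y" "dst x y \<le> 2" for x y
    proof -
      have "b x \<le> C * dst x y powr 1 * b y" by (rule C(2)[OF xy(1,2)])
      also have "\<dots> \<le> C * 2 * b y"
        using xy dst_pos[OF xy(1,2)] C(1) pos[OF xy(2)] by (intro mult_right_mono mult_left_mono) auto
      finally show ?thesis .
    qed
    show ?thesis
    proof (rule equiv_funI[of "C * 2"])
      fix t :: real assume t: "0 < t"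
      show "0 < b t" "0 < b' t" using pos t by (auto simp: b'_def)
      show "b t \<le> C * 2 * b' t" unfolding b'_def using near[OF t] t by (intro cl) auto
      show "b' t \<le> C * 2 * b t" unfolding b'_def using near[OF t] t by (intro cl) (auto simp: dst_commute)
    qed (use C in auto)
  qed
  moreover have "slow b'"
    unfolding slow_def
  proof (intro conjI allI impI)
    show "0 < b' t" if "0 < t" for t using equiv_fun_pos(2)[OF eq that] .
    fix \<epsilon> :: real assume "0 < \<epsilon>"
    then obtain C where C: "1 \<le> C" "\<And>s t. 0 < s \<Longrightarrow> 0 < t \<Longrightarrow> b s \<le> C * dst s t powr \<epsilon> * b t"
      using slowE[OF sl] by metis
    obtain D where D: "0 < D" "\<And>t. 0 < t \<Longrightarrow> b t \<le> D * b' t" "\<And>t. 0 < t \<Longrightarrow> b' t \<le> D * b t"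
      using equiv_funE[OF eq] by metis
    show "\<exists>C. \<forall>s>0. \<forall>t>0. b' s \<le> C * dst s t powr \<epsilon> * b' t"
    proof (intro exI[of _ "D * C * D"] allI impI)
      fix s t :: real assume st: "0 < s" "0 < t"
      have "b' s \<le> D * b s" by (rule D(3)[OF st(1)])
      also have "\<dots> \<le> D * (C * dst s t powr \<epsilon> * b t)" using D(1) by (intro mult_left_mono C(2) st) auto
      also have "\<dots> \<le> D * (C * dst s t powr \<epsilon> * (D * b' t))"
        using D(1) C(1) by (intro mult_left_mono D(2) st) auto
      finally show "b' s \<le> D * C * D * dst s t powr \<epsilon> * b' t" by (simp add: mult_ac)
    qed
  qed
  ultimately show ?thesis using that eq by blast
qed

section \<open>Invariance of norms, spaces and weight functions under equivalence of weights\<close>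

lemma wnorm_equiv:
  assumes q: "0 < q" and S: "S \<in> sets borel" "S \<subseteq> {0<..}"
    and C: "0 < C" "\<And>t. 0 < t \<Longrightarrow> b t \<le> C * b' t"
    and D: "D < top" "\<And>u. u \<in> S \<Longrightarrow> F u \<le> D * G u"
  shows "wnorm \<theta> q b S F \<le> (ennreal C * D) * wnorm \<theta> q b' S G"
proof (rule wnorm_le_cmult[OF q _ S])
  show "ennreal C * D < top" using D by (simp add: ennreal_mult_less_top)
  fix u assume u: "u \<in> S"
  then have "b u \<le> C * b' u" using S C by auto
  then have "ennreal (b u) \<le> ennreal C * ennreal (b' u)"
    using C(1) by (simp add: ennreal_mult'[symmetric] ennreal_leI)
  then have "ennreal (b u) * F u \<le> (ennreal C * ennreal (b' u)) * (D * G u)"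
    using D(2)[OF u] by (intro mult_mono) auto
  then show "ennreal (b u) * F u \<le> ennreal C * D * (ennreal (b' u) * G u)"
    by (simp only: mult_ac)
qed

lemma Kfun_qle:
  assumes "qle X0 Y0" "qle X1 Y1"
  obtains C where "C < top" "\<And>u f. 0 < u \<Longrightarrow> Kfun X0 X1 u f \<le> C * Kfun Y0 Y1 u f"
proof -
  obtain C where C: "C < top" "\<And>f. X0 f \<le> C * Y0 f" using qleE[OF assms(1)] by metis
  obtain D where D: "D < top" "\<And>f. X1 f \<le> D * Y1 f" using qleE[OF assms(2)] by metis
  define E where "E = C + D + 1"
  have E: "0 < E" "E < top" "C \<le> E" "D \<le> E"
    using C D by (auto simp: E_def add_nonneg_pos add.assoc add_increasing)
  show ?thesis
  proof (rule that[OF E(2)])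
    fix u :: real and f assume u: "0 < u"
    show "Kfun X0 X1 u f \<le> E * Kfun Y0 Y1 u f"
    proof (rule Kfun_greatest_cmult[OF E(1,2)])
      fix f0 f1 assume f: "f = f0 + f1"
      have "Kfun X0 X1 u f \<le> X0 f0 + ennreal u * X1 f1" by (rule Kfun_le[OF f u])
      also have "\<dots> \<le> E * Y0 f0 + ennreal u * (E * Y1 f1)"
        by (intro add_mono mult_left_mono le_cmult_mono[OF C(2) E(3)] le_cmult_mono[OF D(2) E(4)]) auto
      also have "\<dots> = E * (Y0 f0 + ennreal u * Y1 f1)" by (simp add: distrib_left mult.left_commute)
      finally show "Kfun X0 X1 u f \<le> E * (Y0 f0 + ennreal u * Y1 f1)" .
    qed
  qed
qed

lemma sum_sp_qle:
  assumes "qle X0 Y0" "qle X1 Y1"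
  shows "sum_sp Y0 Y1 \<subseteq> sum_sp X0 X1"
proof -
  have "carrier_sp Y \<subseteq> carrier_sp X" if qle: "qle X Y" for X Y :: "'a qnorm"
  proof -
    obtain C where C: "C < top" "\<And>f. X f \<le> C * Y f" using qleE[OF qle] by metis
    show ?thesis
      unfolding carrier_sp_def using C(1) by (auto intro!: le_less_trans[OF C(2)] simp: ennreal_mult_less_top)
  qed
  from this[OF assms(1)] this[OF assms(2)] show ?thesis
    unfolding sum_sp_def by blast
qed

lemma interp_qle:
  assumes q: "0 < q" and X: "qle X0 Y0" "qle X1 Y1" and b: "equiv_fun b b'"
  shows "qle (interp_sp X0 X1 \<theta> q b) (interp_sp Y0 Y1 \<theta> q b')"
proof -
  obtain C where C: "0 < C" "\<And>t. 0 < t \<Longrightarrow> b t \<le> C * b' t" using equiv_funE[OF b] by metis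
  obtain D where D: "D < top" "\<And>u f. 0 < u \<Longrightarrow> Kfun X0 X1 u f \<le> D * Kfun Y0 Y1 u f"
    using Kfun_qle[OF X] by metis
  show ?thesis
  proof (rule qleI)
    show "ennreal C * D < top" using D by (simp add: ennreal_mult_less_top)
    show "interp_sp X0 X1 \<theta> q b f \<le> (ennreal C * D) * interp_sp Y0 Y1 \<theta> q b' f" if "f \<in> sum_sp Y0 Y1" for f
    proof -
      have "f \<in> sum_sp X0 X1" using that sum_sp_qle[OF X] by auto
      then show ?thesis
        using that unfolding interp_sp_def by (simp only: if_True) (intro wnorm_equiv q C D; simp)
    qed
  qed (simp add: interp_sp_def)
qed

lemma qle_refl: "qle N N"
  unfolding qle_def by (intro exI[of _ 1]) auto

lemma L_qle:
  assumes q: "0 < r" "0 < q" and b: "equiv_fun b b'" and a: "equiv_fun a a'"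
  shows "qle (L_sp A0 A1 \<theta> r b q a) (L_sp A0 A1 \<theta> r b' q a')"
proof -
  obtain C where C: "0 < C" "\<And>t. 0 < t \<Longrightarrow> b t \<le> C * b' t" using equiv_funE[OF b] by metis
  obtain D where D: "0 < D" "\<And>t. 0 < t \<Longrightarrow> a t \<le> D * a' t" using equiv_funE[OF a] by metis
  have inner: "wnorm \<theta> q a {0<..<t} F \<le> ennreal D * 1 * wnorm \<theta> q a' {0<..<t} F" for t F
    by (intro wnorm_equiv q D) auto
  show ?thesis
  proof (rule qleI)
    show "ennreal C * (ennreal D * 1) < top" by (simp add: ennreal_mult_less_top)
    show "L_sp A0 A1 \<theta> r b q a f \<le> (ennreal C * (ennreal D * 1)) * L_sp A0 A1 \<theta> r b' q a' f" if "f \<in> sum_sp A0 A1" for f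
      using that unfolding L_sp_def by (simp only: if_True) (intro wnorm_equiv q C inner; simp)
  qed (simp add: L_sp_def)
qed

lemma R_qle:
  assumes q: "0 < r" "0 < q" and b: "equiv_fun b b'" and a: "equiv_fun a a'"
  shows "qle (R_sp A0 A1 \<theta> r b q a) (R_sp A0 A1 \<theta> r b' q a')"
proof -
  obtain C where C: "0 < C" "\<And>t. 0 < t \<Longrightarrow> b t \<le> C * b' t" using equiv_funE[OF b] by metis
  obtain D where D: "0 < D" "\<And>t. 0 < t \<Longrightarrow> a t \<le> D * a' t" using equiv_funE[OF a] by metis
  have inner: "wnorm \<theta> q a {t<..} F \<le> ennreal D * 1 * wnorm \<theta> q a' {t<..} F" if "t \<in> {0<..}" for t F
    using that by (intro wnorm_equiv q D) auto
  show ?thesis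
  proof (rule qleI)
    show "ennreal C * (ennreal D * 1) < top" by (simp add: ennreal_mult_less_top)
    show "R_sp A0 A1 \<theta> r b q a f \<le> (ennreal C * (ennreal D * 1)) * R_sp A0 A1 \<theta> r b' q a' f" if "f \<in> sum_sp A0 A1" for f
      using that unfolding R_sp_def by (simp only: if_True) (intro wnorm_equiv q C inner; simp)
  qed (simp add: R_sp_def)
qed

lemma RR_qle:
  assumes q: "0 < p" "0 < r" "0 < q" and c: "equiv_fun c c'" and b: "equiv_fun b b'" and a: "equiv_fun a a'"
  shows "qle (RR_sp A0 A1 \<theta> p c r b q a) (RR_sp A0 A1 \<theta> p c' r b' q a')"
proof -
  obtain B where B: "0 < B" "\<And>t. 0 < t \<Longrightarrow> c t \<le> B * c' t" using equiv_funE[OF c] by metis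
  obtain C where C: "0 < C" "\<And>t. 0 < t \<Longrightarrow> b t \<le> C * b' t" using equiv_funE[OF b] by metis
  obtain D where D: "0 < D" "\<And>t. 0 < t \<Longrightarrow> a t \<le> D * a' t" using equiv_funE[OF a] by metis
  have inner: "wnorm \<theta> q a {u<..} F \<le> ennreal D * 1 * wnorm \<theta> q a' {u<..} F" if "0 < u" for u F
    using that by (intro wnorm_equiv q D) auto
  have mid: "wnorm 0 r b {t<..} (\<lambda>u. wnorm \<theta> q a {u<..} F)
      \<le> ennreal C * (ennreal D * 1) * wnorm 0 r b' {t<..} (\<lambda>u. wnorm \<theta> q a' {u<..} F)"
    if "t \<in> {0<..}" for t F
    using that by (intro wnorm_equiv q C inner) auto
  have fin: "ennreal C * (ennreal D * 1) < top" by (simp add: ennreal_mult_less_top)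
  show ?thesis
  proof (rule qleI)
    show "ennreal B * (ennreal C * (ennreal D * 1)) < top" by (simp add: ennreal_mult_less_top)
    show "RR_sp A0 A1 \<theta> p c r b q a f \<le> (ennreal B * (ennreal C * (ennreal D * 1))) * RR_sp A0 A1 \<theta> p c' r b' q a' f"
      if "f \<in> sum_sp A0 A1" for f
      using that unfolding RR_sp_def by (simp only: if_True) (intro wnorm_equiv q B mid fin; simp)
  qed (simp add: RR_sp_def)
qed

text \<open>Positivity and finiteness are known for \<open>Y\<close>, which will be built from the
  Borel weights, and pass to \<open>X\<close> through the two inequalities. An infinite value would
  be turned into 0 by \<open>enn2real\<close>.\<close>

lemma equiv_fun_enn2real:
  fixes X Y :: "real \<Rightarrow> ennreal"
  assumes C: "C < top" "\<And>t. 0 < t \<Longrightarrow> X t \<le> C * Y t" and D: "D < top" "\<And>t. 0 < t \<Longrightarrow> Y t \<le> D * X t"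
    and Y: "\<And>t. 0 < t \<Longrightarrow> 0 < Y t \<and> Y t < top"
  shows "equiv_fun (\<lambda>t. enn2real (X t)) (\<lambda>t. enn2real (Y t))"
proof -
  have X: "0 < X t \<and> X t < top" if "0 < t" for t
  proof
    show "X t < top" using C Y[OF that] by (intro le_less_trans[OF C(2)[OF that]]) (simp add: ennreal_mult_less_top)
    show "0 < X t" using D(2)[OF that] Y[OF that] by (metis le_zero_eq mult_zero_right not_gr_zero)
  qed
  define K where "K = enn2real C + enn2real D + 1"
  show ?thesis
  proof (rule equiv_funI[of K])
    show "0 < K" by (simp add: K_def add_nonneg_pos)
    fix t :: real assume t: "0 < t"
    show "0 < enn2real (X t)" "0 < enn2real (Y t)" using X[OF t] Y[OF t] by (auto simp: enn2real_positive_iff)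
    have "enn2real (X t) \<le> enn2real (C * Y t)"
      using C Y[OF t] by (intro enn2real_mono C(2) t) (simp add: ennreal_mult_less_top)
    also have "\<dots> = enn2real C * enn2real (Y t)" by (rule enn2real_mult)
    also have "\<dots> \<le> K * enn2real (Y t)" by (intro mult_right_mono) (auto simp: K_def)
    finally show "enn2real (X t) \<le> K * enn2real (Y t)" .
    have "enn2real (Y t) \<le> enn2real (D * X t)"
      using D X[OF t] by (intro enn2real_mono D(2) t) (simp add: ennreal_mult_less_top)
    also have "\<dots> = enn2real D * enn2real (X t)" by (rule enn2real_mult)
    also have "\<dots> \<le> K * enn2real (X t)" by (intro mult_right_mono) (auto simp: K_def)
    finally show "enn2real (Y t) \<le> K * enn2real (X t)" .
  qed
qed

lemma tail_wnorm_equiv: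
  assumes q: "0 < q" and b: "equiv_fun b b'"
  obtains C where "C < top"
    "\<And>t. 0 < t \<Longrightarrow> wnorm 0 q b {t<..} (\<lambda>s. 1) \<le> C * wnorm 0 q b' {t<..} (\<lambda>s. 1)"
    "\<And>t. wnorm 0 q b {0<..<t} (\<lambda>s. 1) \<le> C * wnorm 0 q b' {0<..<t} (\<lambda>s. 1)"
    "\<And>s t. 0 < s \<Longrightarrow> wnorm 0 q b {s<..<t} (\<lambda>s. 1) \<le> C * wnorm 0 q b' {s<..<t} (\<lambda>s. 1)"
proof -
  obtain C where C: "0 < C" "\<And>t. 0 < t \<Longrightarrow> b t \<le> C * b' t" using equiv_funE[OF b] by metis
  show ?thesis
  proof (rule that)
    show "ennreal C * 1 < top" by simp
  qed (intro wnorm_equiv q C; auto)+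
qed

lemma head2_wnorm_equiv:
  assumes q: "0 < q" "0 < r" and b: "equiv_fun b b'" and a: "equiv_fun a a'"
  obtains C where "C < top"
    "\<And>t. wnorm 0 r b {0<..<t} (\<lambda>s. wnorm 0 q a {s<..<t} (\<lambda>u. 1))
        \<le> C * wnorm 0 r b' {0<..<t} (\<lambda>s. wnorm 0 q a' {s<..<t} (\<lambda>u. 1))"
proof -
  obtain C where C: "0 < C" "\<And>t. 0 < t \<Longrightarrow> b t \<le> C * b' t" using equiv_funE[OF b] by metis
  obtain D where D: "D < top" "\<And>s t. 0 < s \<Longrightarrow> wnorm 0 q a {s<..<t} (\<lambda>s. 1) \<le> D * wnorm 0 q a' {s<..<t} (\<lambda>s. 1)"
    using tail_wnorm_equiv[OF q(1) a] by metis
  show ?thesis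
  proof (rule that)
    show "ennreal C * D < top" using D by (simp add: ennreal_mult_less_top)
    show "wnorm 0 r b {0<..<t} (\<lambda>s. wnorm 0 q a {s<..<t} (\<lambda>u. 1))
        \<le> (ennreal C * D) * wnorm 0 r b' {0<..<t} (\<lambda>s. wnorm 0 q a' {s<..<t} (\<lambda>u. 1))" for t
      by (intro wnorm_equiv q C D) auto
  qed
qed

lemma wnorm_one:
  assumes "0 < q" "b \<in> borel_measurable borel" "S \<in> sets borel" "S \<subseteq> {0<..}"
  shows "wnorm 0 q b S (\<lambda>s. 1) = mn q S (\<lambda>u. ennreal (b u))"
proof -
  have "wnorm 0 q b S (\<lambda>s. 1) = mn q S (\<lambda>u. ennreal (u powr (- 0) * b u) * 1)"
    using assms by (intro wnorm_eq_mn) auto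
  also have "\<dots> = mn q S (\<lambda>u. ennreal (b u))"
    using assms by (intro mn_cong) auto
  finally show ?thesis .
qed

lemma wnorm_head2:
  assumes q: "0 < q" "0 < r" and [measurable]: "a \<in> borel_measurable borel" "b \<in> borel_measurable borel"
  shows "wnorm 0 r b {0<..<t} (\<lambda>s. wnorm 0 q a {s<..<t} (\<lambda>u. 1)) =
    mn r {0<..<t} (\<lambda>s. ennreal (b s) * mn q {s<..<t} (\<lambda>u. ennreal (a u)))"
proof -
  have [measurable]: "(\<lambda>s. mn q {s<..<t} (\<lambda>u. ennreal (a u))) \<in> borel_measurable borel"
    by (rule measurable_mn_Ioo_left[OF q(1)])
  have "wnorm 0 r b {0<..<t} (\<lambda>s. wnorm 0 q a {s<..<t} (\<lambda>u. 1)) =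
      wnorm 0 r b {0<..<t} (\<lambda>s. mn q {s<..<t} (\<lambda>u. ennreal (a u)))"
  proof (rule wnorm_cong[OF q(2)])
    fix s assume "s \<in> {0<..<t}"
    then show "wnorm 0 q a {s<..<t} (\<lambda>u. 1) = mn q {s<..<t} (\<lambda>u. ennreal (a u))"
      using q by (intro wnorm_one) auto
  qed auto
  also have "\<dots> = mn r {0<..<t} (\<lambda>u. ennreal (u powr (- 0) * b u) * mn q {u<..<t} (\<lambda>u. ennreal (a u)))"
    using q by (intro wnorm_eq_mn) auto
  also have "\<dots> = mn r {0<..<t} (\<lambda>s. ennreal (b s) * mn q {s<..<t} (\<lambda>u. ennreal (a u)))"
    using q by (intro mn_cong) auto
  finally show ?thesis .
qed

lemma equiv_fun_inverse:
  assumes f: "equiv_fun f f'"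
  shows "equiv_fun (\<lambda>t. inverse (f t)) (\<lambda>t. inverse (f' t))"
proof -
  obtain C where C: "0 < C" "\<And>t. 0 < t \<Longrightarrow> f t \<le> C * f' t" "\<And>t. 0 < t \<Longrightarrow> f' t \<le> C * f t"
    using equiv_funE[OF f] by metis
  show ?thesis
  proof (rule equiv_funI[OF C(1)])
    fix t :: real assume t: "0 < t"
    note p = equiv_fun_pos[OF f t]
    show "0 < inverse (f t)" "0 < inverse (f' t)" using p by auto
    show "inverse (f t) \<le> C * inverse (f' t)" using p C(3)[OF t] by (simp add: field_simps)
    show "inverse (f' t) \<le> C * inverse (f t)" using p C(2)[OF t] by (simp add: field_simps)
  qed
qed

lemma equiv_fun_rho:
  assumes "equiv_fun \<chi>0 \<chi>0'" "equiv_fun \<chi>1 \<chi>1'"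
  shows "equiv_fun (rho \<chi>0 \<chi>1) (rho \<chi>0' \<chi>1')"
proof -
  have "equiv_fun (\<lambda>t. t) (\<lambda>t. t)" by (rule equiv_funI[of 1]) auto
  then show ?thesis
    unfolding rho_def[abs_def] divide_inverse
    by (intro equiv_fun_mult equiv_fun_inverse assms)
qed

lemma equiv_fun_sharp:
  assumes "equiv_fun \<chi>0 \<chi>0'" "equiv_fun \<chi>1 \<chi>1'" "equiv_fun a a'" "slow a'" "0 \<le> \<theta>" "\<theta> \<le> 1"
  shows "equiv_fun (sharp \<theta> \<chi>0 \<chi>1 a) (sharp \<theta> \<chi>0' \<chi>1' a')"
  unfolding sharp_def[abs_def] using assms
  by (intro equiv_fun_mult equiv_fun_powr equiv_fun_compose equiv_fun_rho) auto

theorem theorem42: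
  fixes A0 A1 :: "'v::real_vector qnorm"
    and q1 r1 r r0 :: ennreal
    and a1 b1 a b0 \<chi>0 \<chi>1 :: "real \<Rightarrow> real"
  assumes "quasi_banach A0" and "quasi_banach A1"
    and "compatible_couple A0 A1"
    and "carrier_sp A0 \<inter> carrier_sp A1 \<noteq> {0}"
    and "0 < q1" and "0 < r1" and "a1 \<in> SV" and "b1 \<in> SV"
    and "wnorm 0 r1 b1 {0<..<1} (\<lambda>s. wnorm 0 q1 a1 {s<..<1} (\<lambda>u. 1)) < \<infinity>"
    and "0 < r" and "0 < r0" and "a \<in> SV" and "b0 \<in> SV"
    and "wnorm 0 r0 b0 {1<..} (\<lambda>s. 1) < \<infinity>"
    and "\<chi>1 = head_norm2 r1 b1 q1 a1"
    and "\<chi>0 = tail_norm r0 b0"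
  shows
    "(\<forall>\<theta>. 0 < \<theta> \<and> \<theta> < 1 \<longrightarrow>
        interp_sp (interp_sp A0 A1 0 r0 b0) (R_sp A0 A1 1 r1 b1 q1 a1) \<theta> r a
          \<cong>\<^sub>q interp_sp A0 A1 \<theta> r (sharp \<theta> \<chi>0 \<chi>1 a)) \<and>
     (wnorm 0 r a {1<..} (\<lambda>s. 1) < \<infinity> \<longrightarrow>
        interp_sp (interp_sp A0 A1 0 r0 b0) (R_sp A0 A1 1 r1 b1 q1 a1) 0 r a
          \<cong>\<^sub>q interp_sp A0 A1 0 r (sharp 0 \<chi>0 \<chi>1 a) \<sqinter>\<^sub>q L_sp A0 A1 0 r (a \<circ> rho \<chi>0 \<chi>1) r0 b0) \<and>
     (wnorm 0 r a {0<..<1} (\<lambda>s. 1) < \<infinity> \<longrightarrow>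
        interp_sp (interp_sp A0 A1 0 r0 b0) (R_sp A0 A1 1 r1 b1 q1 a1) 1 r a
          \<cong>\<^sub>q interp_sp A0 A1 1 r (sharp 1 \<chi>0 \<chi>1 a)
             \<sqinter>\<^sub>q R_sp A0 A1 1 r (\<lambda>t. head_norm r1 b1 t * a (rho \<chi>0 \<chi>1 t)) q1 a1
             \<sqinter>\<^sub>q RR_sp A0 A1 1 r (a \<circ> rho \<chi>0 \<chi>1) r1 b1 q1 a1)"
proof -
  note q1 = assms(5) and r1 = assms(6) and r = assms(10) and r0 = assms(11)
  obtain a1' where a1: "slow a1'" "a1' \<in> borel_measurable borel" "equiv_fun a1 a1'"
    using SV_Borel[OF assms(7)] by metis
  obtain b1' where b1: "slow b1'" "b1' \<in> borel_measurable borel" "equiv_fun b1 b1'"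
    using SV_Borel[OF assms(8)] by metis
  obtain a' where a: "slow a'" "a' \<in> borel_measurable borel" "equiv_fun a a'"
    using SV_Borel[OF assms(12)] by metis
  obtain b0' where b0: "slow b0'" "b0' \<in> borel_measurable borel" "equiv_fun b0 b0'"
    using SV_Borel[OF assms(13)] by metis
  note sym = equiv_fun_sym
  obtain C0 where C0: "C0 < top"
    "\<And>t. 0 < t \<Longrightarrow> wnorm 0 r0 b0 {t<..} (\<lambda>s. 1) \<le> C0 * wnorm 0 r0 b0' {t<..} (\<lambda>s. 1)"
    using tail_wnorm_equiv[OF r0 b0(3)] by metis
  obtain D0 where D0: "D0 < top"
    "\<And>t. 0 < t \<Longrightarrow> wnorm 0 r0 b0' {t<..} (\<lambda>s. 1) \<le> D0 * wnorm 0 r0 b0 {t<..} (\<lambda>s. 1)"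
    using tail_wnorm_equiv[OF r0 sym[OF b0(3)]] by metis
  obtain CH where CH: "CH < top"
    "\<And>t. wnorm 0 r1 b1 {0<..<t} (\<lambda>s. 1) \<le> CH * wnorm 0 r1 b1' {0<..<t} (\<lambda>s. 1)"
    using tail_wnorm_equiv[OF r1 b1(3)] by metis
  obtain DH where DH: "DH < top"
    "\<And>t. wnorm 0 r1 b1' {0<..<t} (\<lambda>s. 1) \<le> DH * wnorm 0 r1 b1 {0<..<t} (\<lambda>s. 1)"
    using tail_wnorm_equiv[OF r1 sym[OF b1(3)]] by metis
  obtain C1 where C1: "C1 < top"
    "\<And>t. wnorm 0 r1 b1 {0<..<t} (\<lambda>s. wnorm 0 q1 a1 {s<..<t} (\<lambda>u. 1))
        \<le> C1 * wnorm 0 r1 b1' {0<..<t} (\<lambda>s. wnorm 0 q1 a1' {s<..<t} (\<lambda>u. 1))"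
    using head2_wnorm_equiv[OF q1 r1 b1(3) a1(3)] by metis
  obtain D1 where D1: "D1 < top"
    "\<And>t. wnorm 0 r1 b1' {0<..<t} (\<lambda>s. wnorm 0 q1 a1' {s<..<t} (\<lambda>u. 1))
        \<le> D1 * wnorm 0 r1 b1 {0<..<t} (\<lambda>s. wnorm 0 q1 a1 {s<..<t} (\<lambda>u. 1))"
    using head2_wnorm_equiv[OF q1 r1 sym[OF b1(3)] sym[OF a1(3)]] by metis
  \<comment> \<open>The finiteness assumptions concern the given weights; the finite comparison
    constants carry them over to the Borel ones.\<close>
  have fin0: "mn r0 {1<..} (\<lambda>s. ennreal (b0' s)) < top"
  proof -
    have "mn r0 {1<..} (\<lambda>s. ennreal (b0' s)) = wnorm 0 r0 b0' {1<..} (\<lambda>s. 1)"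
      by (rule wnorm_one[symmetric, OF r0 b0(2)]) auto
    also have "\<dots> \<le> D0 * wnorm 0 r0 b0 {1<..} (\<lambda>s. 1)" by (rule D0(2)) simp
    also have "\<dots> < top" using D0(1) assms(14) by (simp add: ennreal_mult_less_top)
    finally show ?thesis .
  qed
  have fin1: "mn r1 {0<..<1} (\<lambda>s. ennreal (b1' s) * mn q1 {s<..<1} (\<lambda>u. ennreal (a1' u))) < top"
    unfolding wnorm_head2[OF q1 r1 a1(2) b1(2), symmetric]
    using D1(1) assms(9) by (intro le_less_trans[OF D1(2)]) (simp add: ennreal_mult_less_top)
  have qn: "quasi_normed A0" "quasi_normed A1"
    using assms(1,2) by (simp_all add: quasi_banach_def)
  interpret W: reiteration_target q1 r1 r0 a1' b1' b0' A0 A1 r a'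
    by unfold_locales (rule q1 r1 r r0 a1 b1 a b0 fin0 fin1 qn assms(3))+
  have chi0: "equiv_fun \<chi>0 W.chi0"
    unfolding assms(16) tail_norm_def[abs_def] W.chi0_def[abs_def]
  proof (rule equiv_fun_enn2real[OF C0(1) _ D0(1)])
    fix t :: real assume t: "0 < t"
    have E: "W.E0 t = wnorm 0 r0 b0' {t<..} (\<lambda>s. 1)"
      unfolding W.E0_def using t by (intro wnorm_one[symmetric, OF r0 b0(2)]) auto
    show "wnorm 0 r0 b0 {t<..} (\<lambda>s. 1) \<le> C0 * W.E0 t" unfolding E by (rule C0(2)[OF t])
    show "W.E0 t \<le> D0 * wnorm 0 r0 b0 {t<..} (\<lambda>s. 1)" unfolding E by (rule D0(2)[OF t])
    show "0 < W.E0 t \<and> W.E0 t < top" using W.E0_pos[OF t] W.ennreal_chi0[OF t, symmetric] by simp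
  qed
  have hh: "equiv_fun (head_norm r1 b1) W.hh"
    unfolding head_norm_def[abs_def] W.hh_def[abs_def]
  proof (rule equiv_fun_enn2real[OF CH(1) _ DH(1)])
    fix t :: real assume t: "0 < t"
    have E: "W.EH t = wnorm 0 r1 b1' {0<..<t} (\<lambda>s. 1)"
      unfolding W.EH_def by (intro wnorm_one[symmetric, OF r1 b1(2)]) auto
    show "wnorm 0 r1 b1 {0<..<t} (\<lambda>s. 1) \<le> CH * W.EH t" unfolding E by (rule CH(2))
    show "W.EH t \<le> DH * wnorm 0 r1 b1 {0<..<t} (\<lambda>s. 1)" unfolding E by (rule DH(2))
    show "0 < W.EH t \<and> W.EH t < top" using W.EH_pos[OF t] W.ennreal_hh[OF t, symmetric] by simp
  qed
  have chi1: "equiv_fun \<chi>1 W.chi1"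
    unfolding assms(15) head_norm2_def[abs_def] W.chi1_def[abs_def]
  proof (rule equiv_fun_enn2real[OF C1(1) _ D1(1)])
    fix t :: real assume t: "0 < t"
    have E: "W.E1 t = wnorm 0 r1 b1' {0<..<t} (\<lambda>s. wnorm 0 q1 a1' {s<..<t} (\<lambda>u. 1))"
      unfolding W.E1_def by (rule wnorm_head2[symmetric, OF q1 r1 a1(2) b1(2)])
    show "wnorm 0 r1 b1 {0<..<t} (\<lambda>s. wnorm 0 q1 a1 {s<..<t} (\<lambda>u. 1)) \<le> C1 * W.E1 t"
      unfolding E by (rule C1(2))
    show "W.E1 t \<le> D1 * wnorm 0 r1 b1 {0<..<t} (\<lambda>s. wnorm 0 q1 a1 {s<..<t} (\<lambda>u. 1))"
      unfolding E by (rule D1(2))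
    show "0 < W.E1 t \<and> W.E1 t < top" using W.E1_pos[OF t] W.ennreal_chi1[OF t, symmetric] by simp
  qed
  have rr: "rho W.chi0 W.chi1 = W.rr" by (simp add: fun_eq_iff rho_def W.rr_def)
  have arr: "equiv_fun (a \<circ> rho \<chi>0 \<chi>1) (a' \<circ> W.rr)"
    using equiv_fun_compose[OF a(3,1) equiv_fun_rho[OF chi0 chi1]] by (simp only: rr)
  have harr: "equiv_fun (\<lambda>t. head_norm r1 b1 t * a (rho \<chi>0 \<chi>1 t)) (\<lambda>t. W.hh t * a' (W.rr t))"
    using equiv_fun_mult[OF hh arr] by (simp only: comp_def)
  have sh: "equiv_fun (sharp \<theta> \<chi>0 \<chi>1 a) (sharp \<theta> W.chi0 W.chi1 a')" if "0 \<le> \<theta>" "\<theta> \<le> 1" for \<theta>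
    by (rule equiv_fun_sharp[OF chi0 chi1 a(3,1) that])
  let ?X = "\<lambda>\<theta>. interp_sp (interp_sp A0 A1 0 r0 b0) (R_sp A0 A1 1 r1 b1 q1 a1) \<theta> r a"
  let ?Y = "\<lambda>\<theta>. interp_sp (interp_sp A0 A1 0 r0 b0') (R_sp A0 A1 1 r1 b1' q1 a1') \<theta> r a'"
  have X: "qle (?X \<theta>) (?Y \<theta>)" "qle (?Y \<theta>) (?X \<theta>)" for \<theta>
    by (rule interp_qle[OF r interp_qle[OF r0 qle_refl qle_refl b0(3)] R_qle[OF r1 q1 b1(3) a1(3)] a(3)],
        rule interp_qle[OF r interp_qle[OF r0 qle_refl qle_refl sym[OF b0(3)]]
          R_qle[OF r1 q1 sym[OF b1(3)] sym[OF a1(3)]] sym[OF a(3)]])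
  have S: "qle (interp_sp A0 A1 \<theta> r (sharp \<theta> \<chi>0 \<chi>1 a)) (interp_sp A0 A1 \<theta> r (sharp \<theta> W.chi0 W.chi1 a'))"
    "qle (interp_sp A0 A1 \<theta> r (sharp \<theta> W.chi0 W.chi1 a')) (interp_sp A0 A1 \<theta> r (sharp \<theta> \<chi>0 \<chi>1 a))"
    if "0 \<le> \<theta>" "\<theta> \<le> 1" for \<theta>
    by (rule interp_qle[OF r qle_refl qle_refl sh[OF that]],
        rule interp_qle[OF r qle_refl qle_refl sym[OF sh[OF that]]])
  \<comment> \<open>\<open>N\<close> and \<open>M\<close> are the two spaces of the statement,
    \<open>N'\<close> and \<open>M'\<close> their versions for the Borel weights, between which the
    formula is already available.\<close>
  have sandwich: "N \<cong>\<^sub>q M"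
    if "qle N N'" "qle N' N" "qle N' M'" "qle M' N'" "qle M M'" "qle M' M" for N N' M M' :: "'v qnorm"
    by (rule equal_spI[OF qle_trans[OF that(1) qle_trans[OF that(3,6)]]
          qle_trans[OF that(5) qle_trans[OF that(4,2)]]])
  have i: "?X \<theta> \<cong>\<^sub>q interp_sp A0 A1 \<theta> r (sharp \<theta> \<chi>0 \<chi>1 a)" if "0 < \<theta>" "\<theta> < 1" for \<theta>
    by (rule sandwich[OF X W.reiteration_i[OF that] S]) (use that in auto)
  have ii: "?X 0 \<cong>\<^sub>q interp_sp A0 A1 0 r (sharp 0 \<chi>0 \<chi>1 a) \<sqinter>\<^sub>q L_sp A0 A1 0 r (a \<circ> rho \<chi>0 \<chi>1) r0 b0"
    by (rule sandwich[OF X W.reiteration_ii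
          qle_inter[OF S(1) L_qle[OF r r0 arr b0(3)]]
          qle_inter[OF S(2) L_qle[OF r r0 sym[OF arr] sym[OF b0(3)]]]]) simp_all
  have iii: "?X 1 \<cong>\<^sub>q interp_sp A0 A1 1 r (sharp 1 \<chi>0 \<chi>1 a)
             \<sqinter>\<^sub>q R_sp A0 A1 1 r (\<lambda>t. head_norm r1 b1 t * a (rho \<chi>0 \<chi>1 t)) q1 a1
             \<sqinter>\<^sub>q RR_sp A0 A1 1 r (a \<circ> rho \<chi>0 \<chi>1) r1 b1 q1 a1"
    by (rule sandwich[OF X W.reiteration_iii
          qle_inter[OF qle_inter[OF S(1) R_qle[OF r q1 harr a1(3)]] RR_qle[OF r r1 q1 arr b1(3) a1(3)]]
          qle_inter[OF qle_inter[OF S(2) R_qle[OF r q1 sym[OF harr] sym[OF a1(3)]]]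
            RR_qle[OF r r1 q1 sym[OF arr] sym[OF b1(3)] sym[OF a1(3)]]]]) simp_all
  show ?thesis using i ii iii by blast
qed

end
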